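(* Let $(M,g,V)$ be a Riemannian $G$-manifold. Assume that the intrinsic torsion takes values in a $G$-submodule $W\subset V\otimes\mathfrak g^{\perp}$. Then $g$ is an Einstein metric when the following three conditions are satisfied: (a) $(V\otimes W\otimes S^2_0V)^G=\{0\}$; (b) $(S^2W\otimes S^2_0V)^G=\{0\}$; (c) $(\mathcal K(\mathfrak g)\otimes S^2_0V)^G=\{0\}$.
   Context: All representations are real; Lie groups and Lie algebras are subgroups and subalgebras of the orthogonal ones, and representations are identified with their duals; $\mathfrak{so}(V)\cong\Lambda^2V$. A $G$-manifold $(M,g,V)$ is a Riemannian manifold $(M^n,g)$ together with a reduction $P$ of the orthonormal frame bundle $O(M)$ to a Lie subgroup $G\subset O(n)$, where $V\cong\mathbb R^n$ is the induced representation of $G$ on tangent spaces. Tensor fields are identified with $G$-equivariant maps from $P$ to tensor powers of $V$; a tensor field "takes values in" a $G$-submodule $W$ if this map has image in $W$. Let $\mathfrak g\subset\mathfrak{so}(n)$ be the Lie algebra of $G$ and $\mathfrak g^{\perp}$ its orthogonal complement in $\mathfrak{so}(n)$. A $G$-connection is a connection whose holonomy group acts on tangent spaces as a subgroup of $G$. For a $G$-connection $\hat\nabla$ put $\eta=\nabla^g-\hat\nabla\in V\otimes\mathfrak{so}(n)$, with $\nabla^g$ the Levi-Civita connection; the component $\xi$ of $\eta$ in $V\otimes\mathfrak g^\perp$ is independent of $\hat\nabla$ and is called the intrinsic torsion. $\mathcal K(\mathfrak g)$ is the space of algebraic curvature tensors with values in $\mathfrak g$: the kernel of $\mathrm b_1\colon\Lambda^2V\otimes\mathfrak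 g\to\Lambda^3V\otimes V$, $(\mathrm b_1R)(X,Y,Z)=R(X,Y,Z)+R(Y,Z,X)+R(Z,X,Y)$, where $R(X,Y,Z)=R_{X,Y}Z$. $S^2_0V$ is the space of trace-free symmetric two-tensors on $V$, and $U^G$ denotes the $G$-invariants of a $G$-module $U$.
   Formalization: In dimension 2 "Einstein" is taken to mean Ric = s g with s a function, since with s constant the claim fails for oriented surfaces of non-constant curvature (G = SO(2), W = 0); in all other dimensions s is constant on connected subsets. *)

theory Defs
  imports "HOL-Analysis.Analysis"
begin

section \<open>Smooth maps between Euclidean spaces\<close>

primrec Ck_on :: "nat \<Rightarrow> 'a::euclidean_space set \<Rightarrow> ('a \<Rightarrow> 'b::real_normed_vector) \<Rightarrow> bool" where
  "Ck_on 0 S f \<longleftrightarrow> continuous_on S f"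
| "Ck_on (Suc k) S f \<longleftrightarrow>
     (\<exists>f'. (\<forall>x\<in>S. (f has_derivative f' x) (at x)) \<and> (\<forall>v. Ck_on k S (\<lambda>x. f' x v)))"

text \<open>Only used for open \<open>S\<close>.\<close>
definition smooth_on :: "'a::euclidean_space set \<Rightarrow> ('a \<Rightarrow> 'b::real_normed_vector) \<Rightarrow> bool" where
  "smooth_on S f \<longleftrightarrow> (\<forall>k. Ck_on k S f)"

text \<open>Smoothness on an arbitrary subset, by local smooth extension; needed for relatively open
  subsets of linear subspaces.\<close>
definition smooth_within :: "'a::euclidean_space set \<Rightarrow> ('a \<Rightarrow> 'b::real_normed_vector) \<Rightarrow> bool" where
  "smooth_within S f \<longleftrightarrow>
     (\<forall>x\<in>S. \<exists>T F. open T \<and> x \<in> T \<and> smooth_on T F \<and> (\<forall>y\<in>S \<inter> T. F y = f y))"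

text \<open>\<open>dir_deriv f x v\<close> is the derivative of \<open>f\<close> at \<open>x\<close> in the direction \<open>v\<close>.\<close>
abbreviation dir_deriv :: "('a::euclidean_space \<Rightarrow> 'b::real_normed_vector) \<Rightarrow> 'a \<Rightarrow> 'a \<Rightarrow> 'b" where
  "dir_deriv f x v \<equiv> frechet_derivative f (at x) v"


section \<open>Lie subgroups of the orthogonal group\<close>

text \<open>A Lie subgroup is a subgroup with a second countable manifold structure, not necessarily the
  subspace topology, for which the inclusion into the space of matrices is an immersion and the
  group operations are smooth.  The manifold structure is given by parametrizations \<open>(U, \<phi>)\<close> whose
  domains \<open>U\<close> are open in a fixed linear space \<open>E\<close>; a subspace of the space of matrices is used as
  model \<open>E\<close> so that its dimension may be arbitrary, including zero.\<close>

definition immersed_atlas ::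
  "(real^'n^'n) set \<Rightarrow> ((real^'n^'n) set \<times> (real^'n^'n \<Rightarrow> real^'n^'n)) set \<Rightarrow> (real^'n^'n) set \<Rightarrow> bool" where
  "immersed_atlas E \<U> G \<longleftrightarrow>
     subspace E \<and> countable \<U> \<and> (\<Union>(U, \<phi>)\<in>\<U>. \<phi> ` U) = G \<and>
     (\<forall>(U, \<phi>)\<in>\<U>. openin (top_of_set E) U \<and> smooth_within U \<phi> \<and> inj_on \<phi> U \<and>
        (\<forall>x\<in>U. \<forall>v\<in>E. ((\<lambda>t. \<phi> (x + t *\<^sub>R v)) has_vector_derivative 0) (at 0) \<longrightarrow> v = 0)) \<and>
     (\<forall>(U, \<phi>)\<in>\<U>. \<forall>(V, \<psi>)\<in>\<U>.
        openin (top_of_set E) {x\<in>U. \<phi> x \<in> \<psi> ` V} \<and>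
        smooth_within {x\<in>U. \<phi> x \<in> \<psi> ` V} (\<lambda>x. inv_into V \<psi> (\<phi> x)))"

definition smooth_group_operations ::
  "(real^'n^'n) set \<Rightarrow> ((real^'n^'n) set \<times> (real^'n^'n \<Rightarrow> real^'n^'n)) set \<Rightarrow> bool" where
  "smooth_group_operations E \<U> \<longleftrightarrow>
     (\<forall>(U, \<phi>)\<in>\<U>. \<forall>(V, \<psi>)\<in>\<U>. \<forall>(Y, \<theta>)\<in>\<U>.
        let D = {z\<in>U \<times> V. \<phi> (fst z) ** \<psi> (snd z) \<in> \<theta> ` Y}
        in openin (top_of_set (E \<times> E)) D \<and>
           smooth_within D (\<lambda>z. inv_into Y \<theta> (\<phi> (fst z) ** \<psi> (snd z)))) \<and>
     (\<forall>(U, \<phi>)\<in>\<U>. \<forall>(V, \<psi>)\<in>\<U>.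
        let D = {x\<in>U. transpose (\<phi> x) \<in> \<psi> ` V}
        in openin (top_of_set E) D \<and> smooth_within D (\<lambda>x. inv_into V \<psi> (transpose (\<phi> x))))"

definition orthogonal_lie_subgroup :: "(real^'n^'n) set \<Rightarrow> bool" where
  "orthogonal_lie_subgroup G \<longleftrightarrow>
     (\<forall>a\<in>G. orthogonal_matrix a) \<and>
     mat 1 \<in> G \<and> (\<forall>a\<in>G. \<forall>b\<in>G. a ** b \<in> G) \<and> (\<forall>a\<in>G. transpose a \<in> G) \<and>
     (\<exists>E \<U>. immersed_atlas E \<U> G \<and> smooth_group_operations E \<U>)"

text \<open>The tangent space at the identity.  Lie subgroups are initial submanifolds, so a curve in
  \<open>G\<close> that is smooth as a curve of matrices is smooth for the manifold structure of \<open>G\<close>.\<close>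
definition lie_algebra :: "(real^'n^'n) set \<Rightarrow> (real^'n^'n) set" where
  "lie_algebra G = {A. \<exists>\<gamma> \<epsilon>. 0 < \<epsilon> \<and> smooth_on {-\<epsilon><..<\<epsilon>} \<gamma> \<and> \<gamma> ` {-\<epsilon><..<\<epsilon>} \<subseteq> G \<and>
     \<gamma> 0 = mat 1 \<and> (\<gamma> has_vector_derivative A) (at (0::real))}"

definition so_algebra :: "(real^'n^'n) set" where
  "so_algebra = {A. transpose A = - A}"

definition lie_perp :: "(real^'n^'n) set \<Rightarrow> (real^'n^'n) set" where
  "lie_perp \<gg> = {A \<in> so_algebra. \<forall>B\<in>\<gg>. A \<bullet> B = 0}"


section \<open>Tensor products of representations\<close>

text \<open>A representation of \<open>G\<close> is a matrix-valued function on \<open>G\<close>, a submodule is an invariant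
  subspace.  The tensor product of \<open>\<real>\<^sup>I\<close> and \<open>\<real>\<^sup>J\<close> is \<open>\<real>\<^bsup>I\<times>J\<^esup>\<close>.  As \<open>G\<close> is orthogonal, \<open>V\<close> is
  identified with its dual, and matrices (endomorphisms of \<open>V\<close>, with \<open>G\<close> acting by conjugation)
  with elements of \<open>V \<otimes> V\<close>.\<close>

definition tensor :: "real^'i::finite \<Rightarrow> real^'j::finite \<Rightarrow> real^('i \<times> 'j)" where
  "tensor x y = (\<chi> p. x $ fst p * y $ snd p)"

definition tensor_space :: "(real^'i::finite) set \<Rightarrow> (real^'j::finite) set \<Rightarrow> (real^('i \<times> 'j)) set"
    (infixl \<open>\<otimes>\<^sub>S\<close> 70) where
  "S \<otimes>\<^sub>S T = span {tensor x y | x y. x \<in> S \<and> y \<in> T}"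

definition rep_tensor ::
  "('g \<Rightarrow> real^'i::finite^'i) \<Rightarrow> ('g \<Rightarrow> real^'j::finite^'j) \<Rightarrow> 'g \<Rightarrow> real^('i \<times> 'j)^('i \<times> 'j)"
    (infixl \<open>\<otimes>\<^sub>R\<close> 70) where
  "(\<rho> \<otimes>\<^sub>R \<sigma>) a = (\<chi> p q. \<rho> a $ fst p $ fst q * \<sigma> a $ snd p $ snd q)"

definition invariants :: "'g set \<Rightarrow> ('g \<Rightarrow> real^'i^'i) \<Rightarrow> (real^'i) set \<Rightarrow> (real^'i) set" where
  "invariants G \<rho> S = {x \<in> S. \<forall>a\<in>G. \<rho> a *v x = x}"

definition submodule :: "'g set \<Rightarrow> ('g \<Rightarrow> real^'i^'i) \<Rightarrow> (real^'i) set \<Rightarrow> (real^'i) set \<Rightarrow> bool" where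
  "submodule G \<rho> S T \<longleftrightarrow> subspace S \<and> S \<subseteq> T \<and> (\<forall>a\<in>G. \<forall>x\<in>S. \<rho> a *v x \<in> S)"

definition std_rep :: "real^'n^'n \<Rightarrow> real^'n^'n" where
  "std_rep a = a"

definition mat_tensor :: "real^'n::finite^'n \<Rightarrow> real^('n \<times> 'n)" where
  "mat_tensor A = (\<chi> p. A $ fst p $ snd p)"

definition Sym2_0 :: "(real^('n::finite \<times> 'n)) set" where
  "Sym2_0 = {T. (\<forall>i j. T $ (i, j) = T $ (j, i)) \<and> (\<Sum>i\<in>UNIV. T $ (i, i)) = 0}"

definition Lambda2 :: "(real^('n::finite \<times> 'n)) set" where
  "Lambda2 = {T. \<forall>i j. T $ (i, j) = - T $ (j, i)}"

definition Sym2 :: "(real^'i::finite) set \<Rightarrow> (real^('i \<times> 'i)) set" where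
  "Sym2 S = {T \<in> S \<otimes>\<^sub>S S. \<forall>i j. T $ (i, j) = T $ (j, i)}"

text \<open>\<open>V \<otimes> \<hh>\<close> for a subspace \<open>\<hh>\<close> of \<open>\<ss>\<oo>(n)\<close>: the component \<open>(i, (j, k))\<close> of an element is the
  matrix entry \<open>(j, k)\<close> of its value on \<open>e\<^sub>i\<close>.\<close>
definition V_tensor :: "(real^'n::finite^'n) set \<Rightarrow> (real^('n \<times> ('n \<times> 'n))) set" where
  "V_tensor \<hh> = UNIV \<otimes>\<^sub>S (mat_tensor ` \<hh>)"

text \<open>The component \<open>((x, y), (j, z))\<close> of \<open>R\<close> is the \<open>j\<close>-th component of \<open>R\<^bsub>X,Y\<^esub>Z\<close> on basis vectors.\<close>
definition bianchi_map :: "real^(('n::finite \<times> 'n) \<times> ('n \<times> 'n)) \<Rightarrow> real^(('n \<times> 'n \<times> 'n) \<times> 'n)" where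
  "bianchi_map R = (\<chi> p. case p of ((x, y, z), j) \<Rightarrow>
     R $ ((x, y), (j, z)) + R $ ((y, z), (j, x)) + R $ ((z, x), (j, y)))"

definition curvature_space :: "(real^'n::finite^'n) set \<Rightarrow> (real^(('n \<times> 'n) \<times> ('n \<times> 'n))) set" where
  "curvature_space \<gg> = {R \<in> Lambda2 \<otimes>\<^sub>S (mat_tensor ` \<gg>). bianchi_map R = 0}"


section \<open>Riemannian manifolds\<close>

text \<open>Geometric objects on a manifold are given by their components in each chart of the atlas,
  subject to the transformation laws.\<close>

type_synonym ('m, 'n) chart = "'m set \<times> ('m \<Rightarrow> real^'n)"

abbreviation chart_inv :: "('m, 'n::finite) chart \<Rightarrow> real^'n \<Rightarrow> 'm" where
  "chart_inv c \<equiv> inv_into (fst c) (snd c)"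

abbreviation transition :: "('m, 'n::finite) chart \<Rightarrow> ('m, 'n) chart \<Rightarrow> real^'n \<Rightarrow> real^'n" where
  "transition c c' \<equiv> snd c' \<circ> chart_inv c"

definition smooth_atlas ::
  "('m::{t2_space,second_countable_topology}, 'n::finite) chart set \<Rightarrow> bool" where
  "smooth_atlas \<A> \<longleftrightarrow>
     (\<forall>c\<in>\<A>. open (fst c) \<and> open (snd c ` fst c) \<and>
        homeomorphism (fst c) (snd c ` fst c) (snd c) (chart_inv c)) \<and>
     (\<forall>c\<in>\<A>. \<forall>c'\<in>\<A>. smooth_on (snd c ` (fst c \<inter> fst c')) (transition c c'))"

definition manifold_of :: "('m, 'n::finite) chart set \<Rightarrow> 'm set" where
  "manifold_of \<A> = (\<Union>c\<in>\<A>. fst c)"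

definition jacobian :: "('m, 'n::finite) chart \<Rightarrow> ('m, 'n) chart \<Rightarrow> 'm \<Rightarrow> real^'n^'n" where
  "jacobian c c' p = matrix (dir_deriv (transition c c') (snd c p))"

type_synonym ('m, 'n) metric = "('m, 'n) chart \<Rightarrow> 'm \<Rightarrow> real^'n^'n"

definition riemannian_metric ::
  "('m::{t2_space,second_countable_topology}, 'n::finite) chart set \<Rightarrow> ('m, 'n) metric \<Rightarrow> bool" where
  "riemannian_metric \<A> g \<longleftrightarrow>
     (\<forall>c\<in>\<A>. smooth_on (snd c ` fst c) (\<lambda>x. g c (chart_inv c x)) \<and>
        (\<forall>p\<in>fst c. transpose (g c p) = g c p \<and> (\<forall>v. v \<noteq> 0 \<longrightarrow> 0 < v \<bullet> (g c p *v v)))) \<and>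
     (\<forall>c\<in>\<A>. \<forall>c'\<in>\<A>. \<forall>p\<in>fst c \<inter> fst c'.
        g c p = transpose (jacobian c c' p) ** g c' p ** jacobian c c' p)"

text \<open>\<open>N c p v w\<close> is the vector \<open>\<Gamma>(v, w)\<close> of Christoffel symbols at \<open>p\<close> in the chart \<open>c\<close>:
  in coordinates, the covariant derivative is \<open>\<nabla>\<^sub>v Z = dZ(v) + \<Gamma>(v, Z)\<close>.\<close>
type_synonym ('m, 'n) connection = "('m, 'n) chart \<Rightarrow> 'm \<Rightarrow> real^'n \<Rightarrow> real^'n \<Rightarrow> real^'n"

definition connection_on ::
  "('m::{t2_space,second_countable_topology}, 'n::finite) chart set \<Rightarrow> 'm set \<Rightarrow> ('m, 'n) connection \<Rightarrow> bool" where
  "connection_on \<A> U N \<longleftrightarrow>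
     (\<forall>c\<in>\<A>. (\<forall>p\<in>U \<inter> fst c. bilinear (N c p)) \<and>
        (\<forall>v w. smooth_on (snd c ` (U \<inter> fst c)) (\<lambda>x. N c (chart_inv c x) v w))) \<and>
     (\<forall>c\<in>\<A>. \<forall>c'\<in>\<A>. \<forall>p\<in>U \<inter> fst c \<inter> fst c'. \<forall>v w.
        jacobian c c' p *v N c p v w =
          dir_deriv (\<lambda>x. dir_deriv (transition c c') x w) (snd c p) v
          + N c' p (jacobian c c' p *v v) (jacobian c c' p *v w))"

text \<open>The Levi-Civita connection, by the Koszul formula for constant coordinate fields:
  \<open>2 g(\<Gamma>(u, v), e\<^sub>l) = \<partial>\<^sub>u g(v, e\<^sub>l) + \<partial>\<^sub>v g(u, e\<^sub>l) - \<partial>\<^sub>l g(u, v)\<close>.\<close>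
definition levi_civita :: "('m, 'n::finite) metric \<Rightarrow> ('m, 'n) connection" where
  "levi_civita g c p u v =
     (let dg = dir_deriv (\<lambda>x. g c (chart_inv c x)) (snd c p)
      in matrix_inv (g c p) *v
         (\<chi> l. ((dg u *v v) $ l + (dg v *v u) $ l - u \<bullet> (dg (axis l 1) *v v)) / 2))"

text \<open>\<open>curvature N c p X Y Z\<close> is \<open>R\<^bsub>X,Y\<^esub>Z = \<nabla>\<^sub>X\<nabla>\<^sub>YZ - \<nabla>\<^sub>Y\<nabla>\<^sub>XZ\<close> for constant coordinate fields.\<close>
definition curvature ::
  "('m, 'n::finite) connection \<Rightarrow> ('m, 'n) chart \<Rightarrow> 'm \<Rightarrow> real^'n \<Rightarrow> real^'n \<Rightarrow> real^'n \<Rightarrow> real^'n" where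
  "curvature N c p X Y Z =
     dir_deriv (\<lambda>x. N c (chart_inv c x) Y Z) (snd c p) X
     - dir_deriv (\<lambda>x. N c (chart_inv c x) X Z) (snd c p) Y
     + N c p X (N c p Y Z) - N c p Y (N c p X Z)"

definition ricci ::
  "('m, 'n::finite) metric \<Rightarrow> ('m, 'n) chart \<Rightarrow> 'm \<Rightarrow> real^'n \<Rightarrow> real^'n \<Rightarrow> real" where
  "ricci g c p Y Z = (\<Sum>i\<in>UNIV. curvature (levi_civita g) c p (axis i 1) Y Z $ i)"

text \<open>The Einstein constant is constant on connected sets, except that on surfaces, where
  the Ricci tensor is always pointwise proportional to the metric, it may be a function.\<close>
definition einstein ::
  "('m::{t2_space,second_countable_topology}, 'n::finite) chart set \<Rightarrow> ('m, 'n) metric \<Rightarrow> bool" where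
  "einstein \<A> g \<longleftrightarrow> (\<exists>s :: 'm \<Rightarrow> real.
     (\<forall>c\<in>\<A>. \<forall>p\<in>fst c. \<forall>v w. ricci g c p v w = s p * (v \<bullet> (g c p *v w))) \<and>
     (CARD('n) \<noteq> 2 \<longrightarrow> (\<forall>S\<subseteq>manifold_of \<A>. connected S \<longrightarrow> s constant_on S)))"

text \<open>Checks that \<open>levi_civita\<close> is torsion-free and metric.\<close>

lemma inner_symmetric_matrix:
  fixes B :: "real^'k::finite^'k"
  assumes "transpose B = B"
  shows "u \<bullet> (B *v v) = v \<bullet> (B *v u)"
proof -
  have "u \<bullet> (B *v v) = (transpose B *v u) \<bullet> v"
    by (simp add: dot_lmul_matrix[symmetric] transpose_matrix_vector)
  then show ?thesis using assms by (simp add: inner_commute)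
qed

lemma riemannian_metric_dg_symmetric:
  assumes g: "riemannian_metric \<A> g" and at: "smooth_atlas \<A>" and c: "c \<in> \<A>" and p: "p \<in> fst c"
  shows "transpose (dir_deriv (\<lambda>x. g c (chart_inv c x)) (snd c p) w)
    = dir_deriv (\<lambda>x. g c (chart_inv c x)) (snd c p) w"
proof -
  let ?f = "\<lambda>x. g c (chart_inv c x)"
  let ?S = "snd c ` fst c"
  have S: "open ?S" "snd c p \<in> ?S"
    using at c p unfolding smooth_atlas_def by auto
  have "Ck_on (Suc 0) ?S ?f"
    using g c unfolding riemannian_metric_def smooth_on_def by blast
  then obtain f' where f': "\<forall>x\<in>?S. (?f has_derivative f' x) (at x)" by auto
  then have D: "(?f has_derivative f' (snd c p)) (at (snd c p))" using S(2) by blast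
  have eq: "frechet_derivative ?f (at (snd c p)) = f' (snd c p)"
    using frechet_derivative_at[OF D] by simp
  have lin: "bounded_linear (transpose :: real^'b^'b \<Rightarrow> real^'b^'b)"
    by (intro linear_conv_bounded_linear[THEN iffD1] linearI)
       (simp_all add: transpose_def vec_eq_iff)
  have "((\<lambda>x. transpose (?f x)) has_derivative (\<lambda>v. transpose (f' (snd c p) v))) (at (snd c p))"
    by (rule bounded_linear.has_derivative[OF lin D])
  then have "(?f has_derivative (\<lambda>v. transpose (f' (snd c p) v))) (at (snd c p))"
  proof (rule has_derivative_transform_within_open[OF _ S])
    fix x assume "x \<in> ?S"
    then have "chart_inv c x \<in> fst c" by (rule inv_into_into)
    then show "transpose (?f x) = ?f x" using g c unfolding riemannian_metric_def by blast
  qed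
  from has_derivative_unique[OF this D] show ?thesis unfolding eq by metis
qed

lemma levi_civita_torsion_free:
  assumes "riemannian_metric \<A> g" "smooth_atlas \<A>" "c \<in> \<A>" "p \<in> fst c"
  shows "levi_civita g c p u v = levi_civita g c p v u"
proof -
  let ?d = "dir_deriv (\<lambda>x. g c (chart_inv c x)) (snd c p)"
  have "u \<bullet> (?d w *v v) = v \<bullet> (?d w *v u)" for w
    by (rule inner_symmetric_matrix[OF riemannian_metric_dg_symmetric[OF assms]])
  then show ?thesis unfolding levi_civita_def Let_def by (simp add: add.commute)
qed

lemma levi_civita_metric:
  assumes "riemannian_metric \<A> g" "smooth_atlas \<A>" "c \<in> \<A>" "p \<in> fst c"
  shows "u \<bullet> (dir_deriv (\<lambda>x. g c (chart_inv c x)) (snd c p) w *v v)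
    = levi_civita g c p w u \<bullet> (g c p *v v) + u \<bullet> (g c p *v levi_civita g c p w v)"
proof -
  let ?d = "dir_deriv (\<lambda>x. g c (chart_inv c x)) (snd c p)"
  let ?g = "g c p"
  have sym: "u \<bullet> (?d w *v v) = v \<bullet> (?d w *v u)" for u v w
    by (rule inner_symmetric_matrix[OF riemannian_metric_dg_symmetric[OF assms]])
  have gs: "transpose ?g = ?g" and pos: "\<And>v. v \<noteq> 0 \<Longrightarrow> 0 < v \<bullet> (?g *v v)"
    using assms unfolding riemannian_metric_def by blast+
  have gsym: "u \<bullet> (?g *v v) = v \<bullet> (?g *v u)" for u v
    by (rule inner_symmetric_matrix[OF gs])
  have "\<forall>x. ?g *v x = 0 \<longrightarrow> x = 0" using pos by force
  then obtain B where "B ** ?g = mat 1" using matrix_left_invertible_ker by blast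
  then have "invertible ?g" by (rule invertible_left_inverse[THEN iffD2, OF exI])
  then have inv: "?g *v (matrix_inv ?g *v x) = x" for x
    using someI_ex[of "\<lambda>B. ?g ** B = mat 1 \<and> B ** ?g = mat 1"]
    unfolding invertible_def matrix_inv_def by (simp add: matrix_vector_mul_assoc)
  have lin: "linear ?d"
  proof -
    have "Ck_on (Suc 0) (snd c ` fst c) (\<lambda>x. g c (chart_inv c x))"
      using assms unfolding riemannian_metric_def smooth_on_def by blast
    then have "(\<lambda>x. g c (chart_inv c x)) differentiable (at (snd c p))"
      using assms(4) unfolding Ck_on.simps differentiable_def by blast
    then show ?thesis by (rule linear_frechet_derivative)
  qed
  have expand: "(\<Sum>l\<in>UNIV. z $ l * (u \<bullet> (?d (axis l 1) *v v))) = u \<bullet> (?d z *v v)" for z u v :: "real^'b"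
  proof -
    have z: "z = (\<Sum>l\<in>UNIV. z $ l *\<^sub>R axis l 1)"
      using basis_expansion[of z] by (simp add: scalar_mult_eq_scaleR)
    have "linear (\<lambda>z. u \<bullet> (?d z *v v))"
      using lin by (intro linearI)
        (simp_all add: linear_add linear_cmul matrix_vector_mult_add_rdistrib inner_add_right scaleR_matrix_vector_assoc[symmetric])
    note lin' = this
    have "u \<bullet> (?d z *v v) = u \<bullet> (?d (\<Sum>l\<in>UNIV. z $ l *\<^sub>R axis l 1) *v v)" using z by simp
    also have "\<dots> = (\<Sum>l\<in>UNIV. u \<bullet> (?d (z $ l *\<^sub>R axis l 1) *v v))"
      by (rule linear_sum[OF lin'])
    also have "\<dots> = (\<Sum>l\<in>UNIV. z $ l * (u \<bullet> (?d (axis l 1) *v v)))"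
      by (rule sum.cong[OF refl]) (use linear_cmul[OF lin'] in simp)
    finally show ?thesis by simp
  qed
  have kos: "z \<bullet> (?g *v levi_civita g c p u v)
      = (z \<bullet> (?d u *v v) + z \<bullet> (?d v *v u) - u \<bullet> (?d z *v v)) / 2" for z u v
    unfolding expand[of z u v, symmetric] levi_civita_def Let_def inv
    by (simp add: inner_vec_def sum_divide_distrib[symmetric] sum.distrib[symmetric] sum_subtractf[symmetric] algebra_simps)
  have "levi_civita g c p w u \<bullet> (?g *v v) = v \<bullet> (?g *v levi_civita g c p w u)"
    using gsym[of v "levi_civita g c p w u"] by simp
  also have "\<dots> = (v \<bullet> (?d w *v u) + v \<bullet> (?d u *v w) - w \<bullet> (?d v *v u)) / 2"
    by (rule kos)
  finally show ?thesis
    using kos[of u w v] sym[of v w u] sym[of v u w] sym[of u v w] by argo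
qed


section \<open>G-manifolds and intrinsic torsion\<close>

text \<open>A frame at \<open>p\<close> is given in a chart \<open>c\<close> by the matrix \<open>A\<close> whose columns are the components of
  the frame vectors; as an isomorphism from \<open>V = \<real>\<^sup>n\<close> to the tangent space it is \<open>v \<mapsto> A *v v\<close>, and
  \<open>G\<close> acts on frames from the right.  \<open>P c p\<close> is the fibre over \<open>p\<close> of the reduction of the
  orthonormal frame bundle.\<close>
type_synonym ('m, 'n) frames = "('m, 'n) chart \<Rightarrow> 'm \<Rightarrow> (real^'n^'n) set"

definition G_reduction ::
  "('m::{t2_space,second_countable_topology}, 'n::finite) chart set \<Rightarrow> ('m, 'n) metric \<Rightarrow>
    (real^'n^'n) set \<Rightarrow> ('m, 'n) frames \<Rightarrow> bool" where
  "G_reduction \<A> g G P \<longleftrightarrow>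
     (\<forall>c\<in>\<A>. \<forall>p\<in>fst c.
        (\<forall>A\<in>P c p. transpose A ** g c p ** A = mat 1 \<and> P c p = (\<lambda>a. A ** a) ` G) \<and>
        (\<exists>U s. open U \<and> p \<in> U \<and> U \<subseteq> fst c \<and>
           smooth_on (snd c ` U) (\<lambda>x. s (chart_inv c x)) \<and> (\<forall>q\<in>U. s q \<in> P c q))) \<and>
     (\<forall>c\<in>\<A>. \<forall>c'\<in>\<A>. \<forall>p\<in>fst c \<inter> fst c'. P c' p = (\<lambda>A. jacobian c c' p ** A) ` P c p)"

definition riemannian_G_manifold ::
  "('m::{t2_space,second_countable_topology}, 'n::finite) chart set \<Rightarrow> ('m, 'n) metric \<Rightarrow>
    (real^'n^'n) set \<Rightarrow> ('m, 'n) frames \<Rightarrow> bool" where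
  "riemannian_G_manifold \<A> g G P \<longleftrightarrow>
     smooth_atlas \<A> \<and> riemannian_metric \<A> g \<and> orthogonal_lie_subgroup G \<and> G_reduction \<A> g G P"

text \<open>The vector field \<open>Z\<close> along the curve with coordinates \<open>x\<close> in the chart \<open>c\<close> is parallel.\<close>
definition parallel_along ::
  "('m, 'n::finite) connection \<Rightarrow> ('m, 'n) chart \<Rightarrow> real set \<Rightarrow> (real \<Rightarrow> real^'n) \<Rightarrow> (real \<Rightarrow> real^'n) \<Rightarrow> bool" where
  "parallel_along N c I x Z \<longleftrightarrow> (\<forall>t\<in>I. (Z has_vector_derivative
     - N c (chart_inv c (x t)) (vector_derivative x (at t)) (Z t)) (at t))"

text \<open>A G-connection over \<open>U\<close>: parallel transport maps adapted frames to adapted frames, so that the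
  holonomy group with respect to an adapted frame lies in \<open>G\<close>.  Since every curve is a concatenation
  of curves lying in chart domains, it suffices to consider the latter.\<close>
definition G_connection_on ::
  "('m::{t2_space,second_countable_topology}, 'n::finite) chart set \<Rightarrow> ('m, 'n) frames \<Rightarrow>
    'm set \<Rightarrow> ('m, 'n) connection \<Rightarrow> bool" where
  "G_connection_on \<A> P U N \<longleftrightarrow> connection_on \<A> U N \<and>
     (\<forall>c\<in>\<A>. \<forall>a b x F. smooth_on {a<..<b} x \<and> x ` {a<..<b} \<subseteq> snd c ` (U \<inter> fst c) \<and>
        (\<forall>i. parallel_along N c {a<..<b} x (\<lambda>t. column i (F t))) \<longrightarrow>
        (\<forall>s\<in>{a<..<b}. \<forall>t\<in>{a<..<b}.
           F s \<in> P c (chart_inv c (x s)) \<longrightarrow> F t \<in> P c (chart_inv c (x t))))"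

text \<open>The difference \<open>\<eta> = \<nabla>\<^sup>g - N\<close> at \<open>p\<close>, read in the frame \<open>A\<close> as an element of \<open>V \<otimes> V \<otimes> V\<close> with
  component \<open>(i, (j, k))\<close> the \<open>j\<close>-th component of \<open>\<eta>\<^bsub>e\<^sub>i\<^esub> e\<^sub>k\<close>.\<close>
definition connection_difference ::
  "('m, 'n::finite) metric \<Rightarrow> ('m, 'n) connection \<Rightarrow> ('m, 'n) chart \<Rightarrow> 'm \<Rightarrow> real^'n^'n \<Rightarrow>
    real^('n \<times> ('n \<times> 'n))" where
  "connection_difference g N c p A = (\<chi> q. case q of (i, (j, k)) \<Rightarrow>
     (matrix_inv A *v (levi_civita g c p (column i A) (column k A) - N c p (column i A) (column k A))) $ j)"

definition perp_component ::
  "(real^'n::finite^'n) set \<Rightarrow> real^('n \<times> ('n \<times> 'n)) \<Rightarrow> real^('n \<times> ('n \<times> 'n))" where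
  "perp_component \<gg> \<eta> = (THE \<xi>. \<xi> \<in> V_tensor (lie_perp \<gg>) \<and> \<eta> - \<xi> \<in> V_tensor \<gg>)"

text \<open>The intrinsic torsion, as an equivariant function of adapted frames, takes values in \<open>W\<close>.
  It does not depend on the G-connection and is determined locally, so G-connections over arbitrary
  open subsets of the manifold are admitted; over small open sets they always exist.\<close>
definition intrinsic_torsion_in ::
  "('m::{t2_space,second_countable_topology}, 'n::finite) chart set \<Rightarrow> ('m, 'n) metric \<Rightarrow>
    (real^'n^'n) set \<Rightarrow> ('m, 'n) frames \<Rightarrow> (real^('n \<times> ('n \<times> 'n))) set \<Rightarrow> bool" where
  "intrinsic_torsion_in \<A> g G P W \<longleftrightarrow>
     (\<forall>U N. open U \<and> U \<subseteq> manifold_of \<A> \<and> G_connection_on \<A> P U N \<longrightarrow>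
        (\<forall>c\<in>\<A>. \<forall>p\<in>U \<inter> fst c. \<forall>A\<in>P c p.
           perp_component (lie_algebra G) (connection_difference g N c p A) \<in> W))"

end

theory Submission
  imports Defs
begin

text \<open>
  In a local adapted frame write the Levi-Civita connection form as \<open>\<omega> + \<xi>\<close> with \<open>\<omega>\<close> valued in the
  Lie algebra and \<open>\<xi>\<close> in its orthogonal complement.  The form \<open>\<omega>\<close> defines a G-connection, because an
  integral curve of a field of elements of the Lie algebra stays in \<open>G\<close>; so \<open>\<xi>\<close> is the intrinsic
  torsion and lies in \<open>W\<close>.  The Riemannian curvature is \<open>R + F(\<nabla>\<xi>) + Q(\<xi> \<otimes> \<xi>)\<close> with \<open>R\<close> valued
  in the Lie algebra, \<open>F\<close> and \<open>Q\<close> equivariant.  By the first Bianchi identity the Bianchi sum of \<open>R\<close> is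
  determined by the other two terms, hence so is \<open>R\<close> up to an element of \<open>\<K>(\<gg>)\<close>.  Consequently the
  trace-free Ricci tensor is the sum of equivariant images of elements of \<open>\<K>(\<gg>)\<close>, \<open>V \<otimes> W\<close> and
  \<open>S\<^sup>2W\<close>, and all three equivariant maps vanish by hypothesis.  The Einstein function is locally
  constant by the contracted second Bianchi identity, except on surfaces.
\<close>

section \<open>Matrices\<close>

text \<open>The derivative of \<xi> is taken with the G-connection, not with the Levi-Civita
  connection: the ordinary derivative of a W-valued function lies in W, and the connection term is
  an infinitesimal action of the Lie algebra, which preserves W. Hence the derivative lies in V
  \<otimes> W; the price is the torsion of the G-connection, which shows up in the quadratic term.
  Schur's lemma wants linear maps on whole modules, but the Lie algebra part R, the derivative term
  and the quadratic term satisfy the Bianchi identity only together. An equivariant partial inverse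
  \<beta> of the Bianchi map b replaces the trace-free Ricci map r by r(1 - \<beta> b). This agrees
  with r on the full curvature, where b vanishes, and it kills each of the three terms separately.
  The analytic obstacle is that G need not be closed: its manifold topology may be finer than that
  of matrices, while \<open>lie_algebra\<close> uses curves that are smooth only as curves of
  matrices. That such velocities are tangent to the charts of G has to be proved before integral
  curves can be treated, and the countability of the atlas is what makes this possible.\<close>

declare transpose_matrix_vector [simp del] vector_transpose_matrix [simp del]

lemma bounded_bilinear_matrix_mult:
  "bounded_bilinear ((**) :: real^'n::finite^'m::finite \<Rightarrow> real^'k::finite^'n \<Rightarrow> real^'k^'m)"
  unfolding bilinear_conv_bounded_bilinear[symmetric] bilinear_def
  by (auto intro!: linearI
      simp: vec_eq_iff matrix_matrix_mult_def algebra_simps sum.distrib sum_distrib_left)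

lemma bounded_bilinear_matrix_vector:
  "bounded_bilinear ((*v) :: real^'n::finite^'m::finite \<Rightarrow> real^'n \<Rightarrow> real^'m)"
  unfolding bilinear_conv_bounded_bilinear[symmetric] bilinear_def
  by (auto intro!: linearI
      simp: vec_eq_iff matrix_vector_mult_def algebra_simps sum.distrib sum_distrib_left)

lemma bounded_linear_transpose:
  "bounded_linear (transpose :: real^'n::finite^'m::finite \<Rightarrow> real^'m^'n)"
  unfolding linear_conv_bounded_linear[symmetric]
  by (auto intro!: linearI simp: vec_eq_iff transpose_def)

lemmas matrix_mult_simps =
  bounded_bilinear.add_left[OF bounded_bilinear_matrix_mult]
  bounded_bilinear.add_right[OF bounded_bilinear_matrix_mult]
  bounded_bilinear.diff_left[OF bounded_bilinear_matrix_mult]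
  bounded_bilinear.diff_right[OF bounded_bilinear_matrix_mult]
  bounded_bilinear.minus_left[OF bounded_bilinear_matrix_mult]
  bounded_bilinear.minus_right[OF bounded_bilinear_matrix_mult]
  bounded_bilinear.zero_left[OF bounded_bilinear_matrix_mult]
  bounded_bilinear.zero_right[OF bounded_bilinear_matrix_mult]
  bounded_bilinear.scaleR_left[OF bounded_bilinear_matrix_mult]
  bounded_bilinear.scaleR_right[OF bounded_bilinear_matrix_mult]

lemmas matrix_vector_simps =
  bounded_bilinear.add_left[OF bounded_bilinear_matrix_vector]
  bounded_bilinear.add_right[OF bounded_bilinear_matrix_vector]
  bounded_bilinear.diff_left[OF bounded_bilinear_matrix_vector]
  bounded_bilinear.diff_right[OF bounded_bilinear_matrix_vector]
  bounded_bilinear.minus_left[OF bounded_bilinear_matrix_vector]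
  bounded_bilinear.minus_right[OF bounded_bilinear_matrix_vector]
  bounded_bilinear.zero_left[OF bounded_bilinear_matrix_vector]
  bounded_bilinear.zero_right[OF bounded_bilinear_matrix_vector]
  bounded_bilinear.scaleR_left[OF bounded_bilinear_matrix_vector]
  bounded_bilinear.scaleR_right[OF bounded_bilinear_matrix_vector]

lemmas transpose_simps =
  linear_add[OF bounded_linear.linear[OF bounded_linear_transpose]]
  linear_diff[OF bounded_linear.linear[OF bounded_linear_transpose]]
  linear_neg[OF bounded_linear.linear[OF bounded_linear_transpose]]
  linear_cmul[OF bounded_linear.linear[OF bounded_linear_transpose]]
  linear_0[OF bounded_linear.linear[OF bounded_linear_transpose]]

lemma orthogonal_matrix_cancel:
  fixes a :: "real^'n^'n"
  assumes "orthogonal_matrix a"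
  shows "transpose a ** a = mat 1" "a ** transpose a = mat 1"
    "X ** transpose a ** a = X" "X ** a ** transpose a = X"
    "a *v (transpose a *v x) = x" "transpose a *v (a *v x) = x"
  using assms unfolding orthogonal_matrix_def
  by (simp_all add: matrix_vector_mul_assoc flip: matrix_mul_assoc)

lemma inner_transpose: "((A::real^'n^'m) *v x) \<bullet> y = x \<bullet> (transpose A *v y)"
  by (metis dot_lmul_matrix transpose_matrix_vector transpose_transpose inner_commute)

lemma vec_axis_expand: "(x::real^'n) = (\<Sum>i\<in>UNIV. x $ i *\<^sub>R axis i 1)"
  using basis_expansion[of x] by (simp add: scalar_mult_eq_scaleR)

lemma linear_axis_expand:
  fixes f :: "real^'n \<Rightarrow> 'a::real_vector"
  assumes "linear f"
  shows "f x = (\<Sum>i\<in>UNIV. x $ i *\<^sub>R f (axis i 1))"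
  by (subst (1) vec_axis_expand) (simp add: linear_sum[OF assms] linear_cmul[OF assms])

lemma linear_eq_axis:
  fixes f g :: "real^'n \<Rightarrow> 'a::real_vector"
  assumes "linear f" "linear g" "\<And>i. f (axis i 1) = g (axis i 1)"
  shows "f x = g x"
  using assms by (simp add: linear_axis_expand[of f x] linear_axis_expand[of g x])

text \<open>The tensor \<Sum> e_k \<otimes> e_k does not depend on the orthonormal basis, because
  the coefficients of the transformed sum are the entries of \<open>M ** transpose M\<close>. This
  is the origin of the invariant tensor in Schur's lemma.\<close>

lemma sum_orthogonal_basis:
  fixes B :: "real^'n \<Rightarrow> real^'n \<Rightarrow> 'a::real_vector"
  assumes M: "orthogonal_matrix M" and B: "\<And>y. linear (\<lambda>x. B x y)" "\<And>x. linear (B x)"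
  shows "(\<Sum>k\<in>UNIV. B (M *v axis k 1) (M *v axis k 1)) = (\<Sum>k\<in>UNIV. B (axis k 1) (axis k 1))"
proof -
  have comp: "(M *v axis k 1) $ l = M $ l $ k" for k l
    by (simp add: matrix_vector_mult_basis column_def)
  have "(\<Sum>k\<in>UNIV. B (M *v axis k 1) (M *v axis k 1))
     = (\<Sum>k\<in>UNIV. \<Sum>l\<in>UNIV. \<Sum>m\<in>UNIV. (M $ l $ k * M $ m $ k) *\<^sub>R B (axis l 1) (axis m 1))"
  proof (rule sum.cong[OF refl])
    fix k
    have "B (M *v axis k 1) (M *v axis k 1) = (\<Sum>l\<in>UNIV. M $ l $ k *\<^sub>R B (axis l 1) (M *v axis k 1))"
      using linear_axis_expand[OF B(1), of "M *v axis k 1" "M *v axis k 1"] by (simp only: comp)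
    also have "\<dots> = (\<Sum>l\<in>UNIV. \<Sum>m\<in>UNIV. (M $ l $ k * M $ m $ k) *\<^sub>R B (axis l 1) (axis m 1))"
      using linear_axis_expand[OF B(2), of _ "M *v axis k 1"] by (simp add: comp scaleR_sum_right)
    finally show "B (M *v axis k 1) (M *v axis k 1)
      = (\<Sum>l\<in>UNIV. \<Sum>m\<in>UNIV. (M $ l $ k * M $ m $ k) *\<^sub>R B (axis l 1) (axis m 1))" .
  qed
  also have "\<dots> = (\<Sum>l\<in>UNIV. \<Sum>m\<in>UNIV. \<Sum>k\<in>UNIV. (M $ l $ k * M $ m $ k) *\<^sub>R B (axis l 1) (axis m 1))"
    by (subst sum.swap) (intro sum.cong refl sum.swap)
  also have "\<dots> = (\<Sum>l\<in>UNIV. \<Sum>m\<in>UNIV. (if l = m then 1 else 0) *\<^sub>R B (axis l 1) (axis m 1))"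
  proof -
    have "M ** transpose M = mat 1" using M by (simp add: orthogonal_matrix_def)
    then have "(\<Sum>k\<in>UNIV. M $ l $ k * M $ m $ k) = (if l = m then 1 else 0)" for l m
      by (auto simp: vec_eq_iff matrix_matrix_mult_def transpose_def mat_def)
    then show ?thesis by (simp flip: scaleR_sum_left)
  qed
  also have "\<dots> = (\<Sum>l\<in>UNIV. B (axis l 1) (axis l 1))"
    by (simp add: if_distrib[of "\<lambda>r. r *\<^sub>R _"] cong: if_cong)
  finally show ?thesis .
qed

section \<open>Smooth maps\<close>

lemma Ck_on_cong:
  assumes "open S" "Ck_on k S f" "\<And>x. x \<in> S \<Longrightarrow> f x = g x"
  shows "Ck_on k S g"
proof (cases k)
  case 0
  then show ?thesis using assms by (simp cong: continuous_on_cong)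
next
  case (Suc m)
  then obtain f' where f': "\<forall>x\<in>S. (f has_derivative f' x) (at x)" "\<forall>v. Ck_on m S (\<lambda>x. f' x v)"
    using assms by auto
  have "(g has_derivative f' x) (at x)" if "x \<in> S" for x
    using f'(1) that assms by (meson has_derivative_transform_within_open)
  with f' Suc show ?thesis by auto
qed

lemma Ck_on_subset:
  assumes "Ck_on k S f" "T \<subseteq> S"
  shows "Ck_on k T f"
  using assms
proof (induction k arbitrary: f)
  case 0
  then show ?case using continuous_on_subset by auto
next
  case (Suc k)
  then obtain f' where "\<forall>x\<in>S. (f has_derivative f' x) (at x)" "\<forall>v. Ck_on k S (\<lambda>x. f' x v)" by auto
  with Suc show ?case unfolding Ck_on.simps by (intro exI[of _ f'] conjI) auto
qed

lemma Ck_on_Suc_imp: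
  assumes "Ck_on (Suc k) S f"
  shows "Ck_on k S f"
  using assms
proof (induction k arbitrary: f)
  case 0
  then show ?case
    by (meson Ck_on.simps continuous_at_imp_continuous_on has_derivative_continuous)
next
  case (Suc k)
  from Suc.prems obtain f' where "\<forall>x\<in>S. (f has_derivative f' x) (at x)" "\<forall>v. Ck_on (Suc k) S (\<lambda>x. f' x v)"
    unfolding Ck_on.simps(2)[of "Suc k"] by blast
  then show ?case unfolding Ck_on.simps(2)[of k] by (intro exI[of _ f'] conjI allI Suc.IH) auto
qed

lemma Ck_on_const: "Ck_on k S (\<lambda>x. c)"
proof (induction k arbitrary: c)
  case (Suc k)
  have "\<forall>x\<in>S. ((\<lambda>x. c) has_derivative (\<lambda>x v. 0) x) (at x)" by simp
  with Suc[of 0] show ?case unfolding Ck_on.simps by (intro exI[of _ "\<lambda>x v. 0"]) simp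
qed simp

lemma Ck_on_linear:
  assumes "bounded_linear f"
  shows "Ck_on k S f"
proof (cases k)
  case 0
  then show ?thesis using assms by (simp add: linear_continuous_on)
next
  case (Suc m)
  have "\<forall>x\<in>S. (f has_derivative f) (at x)"
    using assms bounded_linear_imp_has_derivative by blast
  then show ?thesis unfolding Suc Ck_on.simps
    by (intro exI[of _ "\<lambda>x. f"]) (simp add: Ck_on_const)
qed

lemma Ck_on_add:
  assumes "Ck_on k S f" "Ck_on k S g"
  shows "Ck_on k S (\<lambda>x. f x + g x)"
  using assms
proof (induction k arbitrary: f g)
  case 0
  then show ?case by (auto intro: continuous_intros)
next
  case (Suc k)
  from Suc.prems obtain f' g' where
    "\<forall>x\<in>S. (f has_derivative f' x) (at x)" "\<forall>v. Ck_on k S (\<lambda>x. f' x v)"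
    "\<forall>x\<in>S. (g has_derivative g' x) (at x)" "\<forall>v. Ck_on k S (\<lambda>x. g' x v)" by auto
  with Suc.IH show ?case unfolding Ck_on.simps
    by (intro exI[of _ "\<lambda>x v. f' x v + g' x v"]) (auto intro: has_derivative_add)
qed

lemma Ck_on_bilinear:
  assumes "bounded_bilinear B" "Ck_on k S f" "Ck_on k S g"
  shows "Ck_on k S (\<lambda>x. B (f x) (g x))"
  using assms(2,3)
proof (induction k arbitrary: f g)
  case 0
  then show ?case using bounded_bilinear.continuous_on[OF assms(1)] by auto
next
  case (Suc k)
  from Suc.prems obtain f' g' where D:
    "\<forall>x\<in>S. (f has_derivative f' x) (at x)" "\<forall>v. Ck_on k S (\<lambda>x. f' x v)"
    "\<forall>x\<in>S. (g has_derivative g' x) (at x)" "\<forall>v. Ck_on k S (\<lambda>x. g' x v)" by auto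
  have "Ck_on k S f" "Ck_on k S g" using Suc.prems Ck_on_Suc_imp by blast+
  with D Suc.IH have "\<forall>v. Ck_on k S (\<lambda>x. B (f x) (g' x v) + B (f' x v) (g x))"
    by (auto intro: Ck_on_add)
  moreover have "\<forall>x\<in>S. ((\<lambda>x. B (f x) (g x)) has_derivative (\<lambda>v. B (f x) (g' x v) + B (f' x v) (g x))) (at x)"
    using D bounded_bilinear.FDERIV[OF assms(1)] by blast
  ultimately show ?case unfolding Ck_on.simps by (intro exI[of _ "\<lambda>x v. B (f x) (g' x v) + B (f' x v) (g x)"]) auto
qed

lemma Ck_on_sum:
  assumes "\<And>i. i \<in> I \<Longrightarrow> Ck_on k S (f i)"
  shows "Ck_on k S (\<lambda>x. \<Sum>i\<in>I. f i x)"
  using assms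
  by (induction I rule: infinite_finite_induct) (auto intro: Ck_on_const Ck_on_add)

lemma Ck_on_compose:
  fixes f :: "'b::euclidean_space \<Rightarrow> 'c::real_normed_vector" and g :: "'a::euclidean_space \<Rightarrow> 'b"
  assumes "Ck_on k T f" "Ck_on k S g" "g ` S \<subseteq> T"
  shows "Ck_on k S (\<lambda>x. f (g x))"
  using assms(1,2)
proof (induction k arbitrary: f)
  case 0
  then show ?case using assms(3) continuous_on_compose2 by auto
next
  case (Suc k)
  from Suc.prems obtain f' g' where D:
    "\<forall>x\<in>T. (f has_derivative f' x) (at x)" "\<forall>v. Ck_on k T (\<lambda>x. f' x v)"
    "\<forall>x\<in>S. (g has_derivative g' x) (at x)" "\<forall>v. Ck_on k S (\<lambda>x. g' x v)" by auto
  have g: "Ck_on k S g" using Suc.prems Ck_on_Suc_imp by blast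
  \<comment> \<open>\<open>Ck_on\<close> controls derivatives in fixed directions only, whereas the
    chain rule evaluates \<open>f'\<close> in the moving direction \<open>g' x v\<close>. Expanding
    that direction in the basis leaves products of scalars with fixed-direction derivatives, to
    which the induction hypothesis applies.\<close>
  have eq: "f' (g x) (g' x v) = (\<Sum>b\<in>Basis. (g' x v \<bullet> b) *\<^sub>R f' (g x) b)" if "x \<in> S" for x v
  proof -
    have "linear (f' (g x))" using D that assms(3) has_derivative_linear by blast
    then have "f' (g x) (\<Sum>b\<in>Basis. (g' x v \<bullet> b) *\<^sub>R b) = (\<Sum>b\<in>Basis. (g' x v \<bullet> b) *\<^sub>R f' (g x) b)"
      by (simp add: linear_sum linear_cmul del: euclidean_representation)
    then show ?thesis by (simp add: euclidean_representation)
  qed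
  have "\<forall>x\<in>S. ((\<lambda>x. f (g x)) has_derivative (\<lambda>v. \<Sum>b\<in>Basis. (g' x v \<bullet> b) *\<^sub>R f' (g x) b)) (at x)"
  proof
    fix x assume x: "x \<in> S"
    have "((\<lambda>x. f (g x)) has_derivative (\<lambda>v. f' (g x) (g' x v))) (at x)"
      using D x assms(3) has_derivative_compose by blast
    then show "((\<lambda>x. f (g x)) has_derivative (\<lambda>v. \<Sum>b\<in>Basis. (g' x v \<bullet> b) *\<^sub>R f' (g x) b)) (at x)"
      using eq[OF x] by simp
  qed
  moreover have "\<forall>v. Ck_on k S (\<lambda>x. \<Sum>b\<in>Basis. (g' x v \<bullet> b) *\<^sub>R f' (g x) b)"
    using Suc.IH D(2,4) g
    by (auto intro!: Ck_on_sum Ck_on_bilinear[OF bounded_bilinear_scaleR]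
        Ck_on_bilinear[OF bounded_bilinear_inner] Ck_on_const)
  ultimately show ?case unfolding Ck_on.simps
    by (intro exI[of _ "\<lambda>x v. \<Sum>b\<in>Basis. (g' x v \<bullet> b) *\<^sub>R f' (g x) b"]) auto
qed

lemma smooth_on_cong: "open S \<Longrightarrow> smooth_on S f \<Longrightarrow> (\<And>x. x \<in> S \<Longrightarrow> f x = g x) \<Longrightarrow> smooth_on S g"
  unfolding smooth_on_def by (auto intro: Ck_on_cong)

lemma smooth_on_subset: "smooth_on S f \<Longrightarrow> T \<subseteq> S \<Longrightarrow> smooth_on T f"
  unfolding smooth_on_def by (auto intro: Ck_on_subset)

lemma smooth_on_const: "smooth_on S (\<lambda>x. c)"
  unfolding smooth_on_def by (simp add: Ck_on_const)

lemma smooth_on_linear: "bounded_linear f \<Longrightarrow> smooth_on S f"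
  unfolding smooth_on_def by (simp add: Ck_on_linear)

lemma smooth_on_add: "smooth_on S f \<Longrightarrow> smooth_on S g \<Longrightarrow> smooth_on S (\<lambda>x. f x + g x)"
  unfolding smooth_on_def by (simp add: Ck_on_add)

lemma smooth_on_bilinear:
  "bounded_bilinear B \<Longrightarrow> smooth_on S f \<Longrightarrow> smooth_on S g \<Longrightarrow> smooth_on S (\<lambda>x. B (f x) (g x))"
  unfolding smooth_on_def by (simp add: Ck_on_bilinear)

lemma smooth_on_sum:
  "(\<And>i. i \<in> I \<Longrightarrow> smooth_on S (f i)) \<Longrightarrow> smooth_on S (\<lambda>x. \<Sum>i\<in>I. f i x)"
  unfolding smooth_on_def by (intro allI Ck_on_sum) blast

lemma smooth_on_compose:
  fixes f :: "'b::euclidean_space \<Rightarrow> 'c::real_normed_vector" and g :: "'a::euclidean_space \<Rightarrow> 'b"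
  shows "smooth_on T f \<Longrightarrow> smooth_on S g \<Longrightarrow> g ` S \<subseteq> T \<Longrightarrow> smooth_on S (\<lambda>x. f (g x))"
  unfolding smooth_on_def by (rule allI, rule Ck_on_compose[of _ T]) auto

lemma smooth_on_linear_compose:
  fixes f :: "'b::euclidean_space \<Rightarrow> 'c::real_normed_vector"
  assumes "bounded_linear f" "smooth_on S g"
  shows "smooth_on S (\<lambda>x. f (g x))"
  using smooth_on_compose[OF smooth_on_linear[OF assms(1)] assms(2)] by blast

lemma smooth_on_minus:
  fixes f :: "'a::euclidean_space \<Rightarrow> 'b::euclidean_space"
  shows "smooth_on S f \<Longrightarrow> smooth_on S (\<lambda>x. - f x)"
  by (rule smooth_on_linear_compose[OF bounded_linear_minus[OF bounded_linear_ident]])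

lemma smooth_on_diff:
  fixes f :: "'a::euclidean_space \<Rightarrow> 'b::euclidean_space"
  shows "smooth_on S f \<Longrightarrow> smooth_on S g \<Longrightarrow> smooth_on S (\<lambda>x. f x - g x)"
  using smooth_on_add[OF _ smooth_on_minus] by fastforce

lemma smooth_on_continuous_on: "smooth_on S f \<Longrightarrow> continuous_on S f"
  unfolding smooth_on_def by (metis Ck_on.simps(1))

lemma smooth_on_has_derivative:
  assumes "smooth_on S f" "x \<in> S"
  shows "(f has_derivative dir_deriv f x) (at x)"
proof -
  have "Ck_on (Suc 0) S f" using assms by (simp add: smooth_on_def)
  then have "f differentiable (at x)" using assms(2) by (auto simp: differentiable_def)
  then show ?thesis by (simp add: frechet_derivative_works)
qed

lemma smooth_on_dir_deriv:
  assumes "open S" "smooth_on S f"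
  shows "smooth_on S (\<lambda>x. dir_deriv f x v)"
  unfolding smooth_on_def
proof
  fix k
  have "Ck_on (Suc k) S f" using assms by (simp add: smooth_on_def)
  then obtain f' where f': "\<forall>x\<in>S. (f has_derivative f' x) (at x)" "Ck_on k S (\<lambda>x. f' x v)" by auto
  then have "dir_deriv f x v = f' x v" if "x \<in> S" for x
    using frechet_derivative_at[of f "f' x" x] f'(1) that by simp
  with f'(2) show "Ck_on k S (\<lambda>x. dir_deriv f x v)"
    by (intro Ck_on_cong[OF assms(1) f'(2)]) simp
qed

lemma linear_Basis_expand:
  assumes "linear f"
  shows "f v = (\<Sum>b\<in>Basis. (v \<bullet> b) *\<^sub>R f b)"
proof -
  have "f (\<Sum>b\<in>Basis. (v \<bullet> b) *\<^sub>R b) = (\<Sum>b\<in>Basis. (v \<bullet> b) *\<^sub>R f b)"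
    by (simp add: linear_sum[OF assms] linear_cmul[OF assms] del: euclidean_representation)
  then show ?thesis by (simp add: euclidean_representation)
qed

section \<open>Symmetry of second derivatives, by second differences\<close>

lemma mixed_difference_estimate:
  fixes f :: "'a::euclidean_space \<Rightarrow> real"
  assumes S: "open S" "smooth_on S f" "x \<in> S" and e: "e > 0"
  shows "\<exists>d>0. \<forall>h. 0 < h \<and> h < d \<longrightarrow>
    \<bar>f (x + h *\<^sub>R u + h *\<^sub>R v) - f (x + h *\<^sub>R u) - f (x + h *\<^sub>R v) + f x
      - h * h * dir_deriv (\<lambda>y. dir_deriv f y u) x v\<bar> \<le> e * (h * h)"
proof -
  define D where "D = (\<lambda>y. dir_deriv (\<lambda>y. dir_deriv f y u) y v)"
  have sm: "smooth_on S (\<lambda>y. dir_deriv f y u)" "smooth_on S D"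
    unfolding D_def by (intro smooth_on_dir_deriv S)+
  have "isCont D x"
    using smooth_on_continuous_on[OF sm(2)] S by (simp add: continuous_on_eq_continuous_at)
  then obtain d1 where d1: "d1 > 0" "\<And>y. dist y x < d1 \<Longrightarrow> dist (D y) (D x) < e"
    unfolding continuous_at_eps_delta using e by blast
  obtain d2 where d2: "d2 > 0" "ball x d2 \<subseteq> S" using S open_contains_ball by blast
  \<comment> \<open>Points \<open>x + s *\<^sub>R u + t *\<^sub>R v\<close> with \<open>s\<close>,
    \<open>t\<close> between 0 and \<open>h\<close> are at distance at most \<open>h\<close> times
    the denominator from \<open>x\<close>; the summand 1 keeps the denominator positive.\<close>
  define d where "d = min d1 d2 / (norm u + norm v + 1)"
  have pos: "norm u + norm v + 1 > 0" by (smt (verit) norm_ge_zero)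
  have "d > 0" unfolding d_def using d1 d2 pos by simp
  moreover have "\<bar>f (x + h *\<^sub>R u + h *\<^sub>R v) - f (x + h *\<^sub>R u) - f (x + h *\<^sub>R v) + f x - h * h * D x\<bar> \<le> e * (h * h)"
    if h: "0 < h" "h < d" for h
  proof -
    have near: "dist (x + s *\<^sub>R u + t *\<^sub>R v) x < min d1 d2" if "0 \<le> s" "s \<le> h" "0 \<le> t" "t \<le> h" for s t
    proof -
      have "dist (x + s *\<^sub>R u + t *\<^sub>R v) x \<le> s * norm u + t * norm v"
        using that norm_triangle_ineq[of "s *\<^sub>R u" "t *\<^sub>R v"] by (simp add: dist_norm algebra_simps)
      also have "\<dots> \<le> h * norm u + h * norm v"
        using that by (intro add_mono mult_right_mono) auto
      also have "\<dots> \<le> h * (norm u + norm v + 1)" using h by (simp add: algebra_simps)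
      also have "\<dots> < d * (norm u + norm v + 1)" using h pos by simp
      also have "\<dots> = min d1 d2" unfolding d_def using pos by simp
      finally show ?thesis .
    qed
    have inS: "x + s *\<^sub>R u + t *\<^sub>R v \<in> S" if "0 \<le> s" "s \<le> h" "0 \<le> t" "t \<le> h" for s t
      using near[OF that] d2(2) by (auto simp: dist_commute subset_iff)
    have der: "((\<lambda>s. f (x + s *\<^sub>R u + t *\<^sub>R v)) has_real_derivative dir_deriv f (x + s *\<^sub>R u + t *\<^sub>R v) u) (at s)"
      if "0 \<le> s" "s \<le> h" "0 \<le> t" "t \<le> h" for s t
    proof -
      have "((\<lambda>s. x + s *\<^sub>R u + t *\<^sub>R v) has_vector_derivative u) (at s)"
        by (auto intro!: derivative_eq_intros)
      from vector_derivative_diff_chain_within[OF this, of f "dir_deriv f (x + s *\<^sub>R u + t *\<^sub>R v)"]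
        smooth_on_has_derivative[OF S(2) inS[OF that]]
      show ?thesis
        by (simp add: has_real_derivative_iff_has_vector_derivative o_def has_derivative_at_withinI)
    qed
    have der2: "((\<lambda>t. dir_deriv f (x + s *\<^sub>R u + t *\<^sub>R v) u) has_real_derivative D (x + s *\<^sub>R u + t *\<^sub>R v)) (at t)"
      if "0 \<le> s" "s \<le> h" "0 \<le> t" "t \<le> h" for s t
    proof -
      have "((\<lambda>t. x + s *\<^sub>R u + t *\<^sub>R v) has_vector_derivative v) (at t)"
        by (auto intro!: derivative_eq_intros)
      from vector_derivative_diff_chain_within[OF this, of "\<lambda>y. dir_deriv f y u"
          "dir_deriv (\<lambda>y. dir_deriv f y u) (x + s *\<^sub>R u + t *\<^sub>R v)"]
        smooth_on_has_derivative[OF sm(1) inS[OF that]]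
      show ?thesis unfolding D_def
        by (simp add: has_real_derivative_iff_has_vector_derivative o_def has_derivative_at_withinI)
    qed
    \<comment> \<open>The second difference is the increment of \<open>F\<close> over the interval
      from 0 to \<open>h\<close>. The mean value theorem in \<open>s\<close> and then in
      \<open>t\<close> yields the mixed derivative at one point of the parallelogram, where
      continuity of \<open>D\<close> compares it with the value at \<open>x\<close>.\<close>
    define F where "F = (\<lambda>s. f (x + s *\<^sub>R u + h *\<^sub>R v) - f (x + s *\<^sub>R u + 0 *\<^sub>R v))"
    have "\<exists>z>0. z < h \<and> F h - F 0 = (h - 0) *
        (dir_deriv f (x + z *\<^sub>R u + h *\<^sub>R v) u - dir_deriv f (x + z *\<^sub>R u + 0 *\<^sub>R v) u)"
      unfolding F_def by (rule MVT2) (use h in \<open>auto intro!: DERIV_diff der simp del: scaleR_zero_left\<close>)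
    then obtain z where z: "0 < z" "z < h" "F h - F 0 = h *
        (dir_deriv f (x + z *\<^sub>R u + h *\<^sub>R v) u - dir_deriv f (x + z *\<^sub>R u + 0 *\<^sub>R v) u)" by auto
    have "\<exists>t>0. t < h \<and> dir_deriv f (x + z *\<^sub>R u + h *\<^sub>R v) u - dir_deriv f (x + z *\<^sub>R u + 0 *\<^sub>R v) u
        = (h - 0) * D (x + z *\<^sub>R u + t *\<^sub>R v)"
      by (rule MVT2) (use h z in \<open>auto intro!: der2\<close>)
    then obtain t where t: "0 < t" "t < h" "F h - F 0 = h * (h * D (x + z *\<^sub>R u + t *\<^sub>R v))"
      using z(3) by auto
    have "dist (D (x + z *\<^sub>R u + t *\<^sub>R v)) (D x) < e"
      using d1(2) near[of z t] z t by auto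
    then have "\<bar>D (x + z *\<^sub>R u + t *\<^sub>R v) - D x\<bar> * (h * h) \<le> e * (h * h)"
      by (intro mult_right_mono) (auto simp: dist_real_def)
    moreover have "F h - F 0 - h * h * D x = (D (x + z *\<^sub>R u + t *\<^sub>R v) - D x) * (h * h)"
      unfolding t(3) by (simp add: algebra_simps)
    ultimately have "\<bar>F h - F 0 - h * h * D x\<bar> \<le> e * (h * h)"
      by (simp add: abs_mult)
    then show ?thesis unfolding F_def by (simp add: algebra_simps)
  qed
  ultimately show ?thesis unfolding D_def by blast
qed

text \<open>The second difference is symmetric in \<open>u\<close> and \<open>v\<close>, and after
  division by \<open>h * h\<close> it approximates both mixed derivatives.\<close>

lemma dir_deriv_commute_real:
  fixes f :: "'a::euclidean_space \<Rightarrow> real"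
  assumes S: "open S" "smooth_on S f" "x \<in> S"
  shows "dir_deriv (\<lambda>y. dir_deriv f y u) x v = dir_deriv (\<lambda>y. dir_deriv f y v) x u" (is "?a = ?b")
proof (rule ccontr)
  assume "?a \<noteq> ?b"
  then have e: "\<bar>?a - ?b\<bar> / 4 > 0" by simp
  \<comment> \<open>With a quarter of the gap as tolerance, the two estimates bound the gap by half
    of itself.\<close>
  let ?e = "\<bar>?a - ?b\<bar> / 4"
  obtain d1 where d1: "d1 > 0" "\<forall>h. 0 < h \<and> h < d1 \<longrightarrow>
    \<bar>f (x + h *\<^sub>R u + h *\<^sub>R v) - f (x + h *\<^sub>R u) - f (x + h *\<^sub>R v) + f x - h * h * ?a\<bar> \<le> ?e * (h * h)"
    using mixed_difference_estimate[OF S e] by blast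
  obtain d2 where d2: "d2 > 0" "\<forall>h. 0 < h \<and> h < d2 \<longrightarrow>
    \<bar>f (x + h *\<^sub>R v + h *\<^sub>R u) - f (x + h *\<^sub>R v) - f (x + h *\<^sub>R u) + f x - h * h * ?b\<bar> \<le> ?e * (h * h)"
    using mixed_difference_estimate[OF S e] by blast
  define h where "h = min d1 d2 / 2"
  define \<Delta> where "\<Delta> = f (x + h *\<^sub>R u + h *\<^sub>R v) - f (x + h *\<^sub>R u) - f (x + h *\<^sub>R v) + f x"
  have h: "0 < h" "h < d1" "h < d2" using d1(1) d2(1) by (auto simp: h_def)
  have "\<bar>\<Delta> - h * h * ?a\<bar> \<le> ?e * (h * h)" using d1(2) h unfolding \<Delta>_def by blast
  moreover have "\<bar>\<Delta> - h * h * ?b\<bar> \<le> ?e * (h * h)"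
  proof -
    have "\<Delta> = f (x + h *\<^sub>R v + h *\<^sub>R u) - f (x + h *\<^sub>R v) - f (x + h *\<^sub>R u) + f x"
      unfolding \<Delta>_def by (simp add: add_ac)
    then show ?thesis using d2(2) h by simp
  qed
  moreover have "\<bar>P - Q\<bar> \<le> 2 * E" if "\<bar>\<Delta> - P\<bar> \<le> E" "\<bar>\<Delta> - Q\<bar> \<le> E" for P Q E
    using that by linarith
  ultimately have "\<bar>h * h * ?a - h * h * ?b\<bar> \<le> 2 * (?e * (h * h))" by blast
  moreover have "\<bar>h * h * ?a - h * h * ?b\<bar> = \<bar>?a - ?b\<bar> * (h * h)"
  proof -
    have "h * h * ?a - h * h * ?b = (?a - ?b) * (h * h)" by (simp add: algebra_simps)
    then show ?thesis by (simp add: abs_mult)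
  qed
  ultimately have "\<bar>?a - ?b\<bar> * (h * h) \<le> (\<bar>?a - ?b\<bar> / 2) * (h * h)" by simp
  then have "\<bar>?a - ?b\<bar> \<le> \<bar>?a - ?b\<bar> / 2"
    by (rule mult_right_le_imp_le) (use h in simp)
  with e show False by simp
qed

lemma dir_deriv_linear_compose:
  assumes "bounded_linear L" "f differentiable (at x)"
  shows "dir_deriv (\<lambda>y. L (f y)) x v = L (dir_deriv f x v)"
proof -
  have "((\<lambda>y. L (f y)) has_derivative (\<lambda>v. L (dir_deriv f x v))) (at x)"
    using bounded_linear.has_derivative[OF assms(1) assms(2)[unfolded frechet_derivative_works]] .
  from frechet_derivative_at[OF this] show ?thesis by (rule fun_cong[symmetric])
qed

lemma smooth_on_differentiable: "smooth_on S f \<Longrightarrow> x \<in> S \<Longrightarrow> f differentiable (at x)"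
  using smooth_on_has_derivative differentiable_def by blast

lemma dir_deriv_cong:
  assumes "open S" "x \<in> S" "\<And>y. y \<in> S \<Longrightarrow> f y = g y"
  shows "dir_deriv f x = dir_deriv g x"
proof -
  have "(f has_derivative D) (at x) \<longleftrightarrow> (g has_derivative D) (at x)" for D
    using assms has_derivative_transform_within_open by metis
  then show ?thesis unfolding frechet_derivative_def by simp
qed

proposition dir_deriv_commute:
  fixes f :: "'a::euclidean_space \<Rightarrow> 'b::euclidean_space"
  assumes S: "open S" "smooth_on S f" "x \<in> S"
  shows "dir_deriv (\<lambda>y. dir_deriv f y u) x v = dir_deriv (\<lambda>y. dir_deriv f y v) x u"
proof (rule euclidean_eqI)
  fix b :: 'b assume "b \<in> Basis"
  have sm: "smooth_on S (\<lambda>y. f y \<bullet> b)"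
    by (rule smooth_on_linear_compose[OF bounded_linear_inner_left S(2)])
  have *: "dir_deriv (\<lambda>y. dir_deriv f y u) x v \<bullet> b = dir_deriv (\<lambda>y. dir_deriv (\<lambda>y. f y \<bullet> b) y u) x v" for u v
  proof -
    have "dir_deriv (\<lambda>y. dir_deriv f y u) x v \<bullet> b = dir_deriv (\<lambda>y. dir_deriv f y u \<bullet> b) x v"
      by (rule dir_deriv_linear_compose[OF bounded_linear_inner_left, symmetric])
         (rule smooth_on_differentiable[OF smooth_on_dir_deriv[OF S(1,2)] S(3)])
    also have "dir_deriv (\<lambda>y. dir_deriv f y u \<bullet> b) x = dir_deriv (\<lambda>y. dir_deriv (\<lambda>y. f y \<bullet> b) y u) x"
      by (rule dir_deriv_cong[OF S(1,3)])
         (simp add: dir_deriv_linear_compose[OF bounded_linear_inner_left smooth_on_differentiable[OF S(2)]])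
    finally show ?thesis .
  qed
  show "dir_deriv (\<lambda>y. dir_deriv f y u) x v \<bullet> b = dir_deriv (\<lambda>y. dir_deriv f y v) x u \<bullet> b"
    unfolding * by (rule dir_deriv_commute_real[OF S(1) sm S(3)])
qed

lemma dir_deriv_bilinear:
  assumes "bounded_bilinear B" "f differentiable (at x)" "g differentiable (at x)"
  shows "dir_deriv (\<lambda>y. B (f y) (g y)) x v = B (f x) (dir_deriv g x v) + B (dir_deriv f x v) (g x)"
proof -
  have "((\<lambda>y. B (f y) (g y)) has_derivative (\<lambda>v. B (f x) (dir_deriv g x v) + B (dir_deriv f x v) (g x))) (at x)"
    using bounded_bilinear.FDERIV[OF assms(1) assms(2)[unfolded frechet_derivative_works] assms(3)[unfolded frechet_derivative_works]] .
  from frechet_derivative_at[OF this] show ?thesis by (rule fun_cong[symmetric])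
qed

lemma dir_deriv_compose:
  assumes "g differentiable (at x)" "f differentiable (at (g x))"
  shows "dir_deriv (\<lambda>y. f (g y)) x v = dir_deriv f (g x) (dir_deriv g x v)"
proof -
  have "((\<lambda>y. f (g y)) has_derivative (\<lambda>v. dir_deriv f (g x) (dir_deriv g x v))) (at x)"
    using has_derivative_compose[OF assms[unfolded frechet_derivative_works]] .
  from frechet_derivative_at[OF this] show ?thesis by (rule fun_cong[symmetric])
qed

section \<open>Equivariant linear algebra\<close>

definition orth_proj :: "'a::euclidean_space set \<Rightarrow> 'a \<Rightarrow> 'a" where
  "orth_proj S x = (SOME y. y \<in> S \<and> (\<forall>z\<in>S. (x - y) \<bullet> z = 0))"

lemma orth_proj:
  assumes "subspace S"
  shows "orth_proj S x \<in> S" "z \<in> S \<Longrightarrow> (x - orth_proj S x) \<bullet> z = 0"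
proof -
  obtain y w where "y \<in> span S" "\<And>z. z \<in> span S \<Longrightarrow> orthogonal w z" "x = y + w"
    using orthogonal_subspace_decomp_exists[of S x] by metis
  then have "y \<in> S \<and> (\<forall>z\<in>S. (x - y) \<bullet> z = 0)"
    using assms by (simp add: span_eq_iff[THEN iffD2] orthogonal_def)
  then have "orth_proj S x \<in> S \<and> (\<forall>z\<in>S. (x - orth_proj S x) \<bullet> z = 0)"
    unfolding orth_proj_def by (rule someI)
  then show "orth_proj S x \<in> S" "z \<in> S \<Longrightarrow> (x - orth_proj S x) \<bullet> z = 0" by auto
qed

lemma orth_proj_unique:
  assumes "subspace S" "y \<in> S" "\<And>z. z \<in> S \<Longrightarrow> (x - y) \<bullet> z = 0"
  shows "orth_proj S x = y"
proof -
  define d where "d = orth_proj S x - y"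
  have d: "d \<in> S" unfolding d_def using assms orth_proj[OF assms(1)] by (simp add: subspace_diff)
  have "d \<bullet> d = (x - y) \<bullet> d - (x - orth_proj S x) \<bullet> d"
    unfolding d_def by (simp add: inner_diff_left)
  also have "\<dots> = 0" using d assms(3) orth_proj[OF assms(1)] by simp
  finally show ?thesis by (simp add: d_def)
qed

lemma orth_proj_id: "subspace S \<Longrightarrow> x \<in> S \<Longrightarrow> orth_proj S x = x"
  by (rule orth_proj_unique) auto

lemma linear_orth_proj:
  assumes "subspace S"
  shows "linear (orth_proj S)"
proof (rule linearI)
  note P = orth_proj[OF assms]
  fix x y :: 'a and r :: real
  show "orth_proj S (x + y) = orth_proj S x + orth_proj S y"
  proof (rule orth_proj_unique[OF assms])
    show "orth_proj S x + orth_proj S y \<in> S" by (simp add: P assms subspace_add)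
    show "(x + y - (orth_proj S x + orth_proj S y)) \<bullet> z = 0" if "z \<in> S" for z
      using P(2)[OF that, of x] P(2)[OF that, of y] by (simp add: algebra_simps)
  qed
  show "orth_proj S (r *\<^sub>R x) = r *\<^sub>R orth_proj S x"
  proof (rule orth_proj_unique[OF assms])
    show "r *\<^sub>R orth_proj S x \<in> S" by (simp add: P assms subspace_scale)
    show "(r *\<^sub>R x - r *\<^sub>R orth_proj S x) \<bullet> z = 0" if "z \<in> S" for z
      using P(2)[OF that, of x] by (simp flip: scaleR_diff_right)
  qed
qed

lemma orth_proj_inner:
  assumes "subspace S" "z \<in> S"
  shows "z \<bullet> orth_proj S x = z \<bullet> x"
  using orth_proj(2)[OF assms, of x] by (simp add: inner_diff_left inner_commute[of z])

text \<open>Transposes play the role of inverses: the last two clauses allow \<open>\<rho> a\<close>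
  to be moved across an inner product without leaving the representation, so that complements of
  invariant subspaces are invariant.\<close>

definition orth_rep :: "(real^'n^'n) set \<Rightarrow> (real^'n^'n \<Rightarrow> real^'i^'i) \<Rightarrow> bool" where
  "orth_rep G \<rho> \<longleftrightarrow>
     (\<forall>a\<in>G. orthogonal_matrix (\<rho> a) \<and> transpose a \<in> G \<and> \<rho> (transpose a) = transpose (\<rho> a))"

lemma orth_rep_std:
  assumes "\<And>a. a \<in> G \<Longrightarrow> orthogonal_matrix a" "\<And>a. a \<in> G \<Longrightarrow> transpose a \<in> G"
  shows "orth_rep G std_rep"
  using assms by (simp add: orth_rep_def std_rep_def)

lemma sum_UNIV_prod:
  "(\<Sum>p\<in>(UNIV :: ('i::finite \<times> 'j::finite) set). f p) = (\<Sum>i\<in>UNIV. \<Sum>j\<in>UNIV. f (i, j))"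
  by (simp add: sum.cartesian_product)

lemma rep_tensor_tensor:
  fixes \<rho> :: "'g \<Rightarrow> real^'i::finite^'i" and \<sigma> :: "'g \<Rightarrow> real^'j::finite^'j"
  shows "(\<rho> \<otimes>\<^sub>R \<sigma>) a *v tensor x y = tensor (\<rho> a *v x) (\<sigma> a *v y)"
  by (simp add: vec_eq_iff tensor_def rep_tensor_def matrix_vector_mult_def sum_UNIV_prod
      sum_product algebra_simps)

lemma orth_rep_tensor:
  assumes "orth_rep G \<rho>" "orth_rep G \<sigma>"
  shows "orth_rep G (\<rho> \<otimes>\<^sub>R \<sigma>)"
  unfolding orth_rep_def
proof (intro ballI conjI)
  fix a assume a: "a \<in> G"
  have "(transpose (\<rho> a) ** \<rho> a) $ i $ k = (mat 1 :: real^_^_) $ i $ k"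
       "(transpose (\<sigma> a) ** \<sigma> a) $ j $ l = (mat 1 :: real^_^_) $ j $ l" for i k j l
    using assms a by (simp_all add: orth_rep_def orthogonal_matrix)
  then have d: "(\<Sum>m\<in>UNIV. \<rho> a $ m $ i * \<rho> a $ m $ k) = (if i = k then 1 else 0)"
       "(\<Sum>m\<in>UNIV. \<sigma> a $ m $ j * \<sigma> a $ m $ l) = (if j = l then 1 else 0)" for i k j l
    by (simp_all add: matrix_matrix_mult_def transpose_def mat_def)
  have "(\<Sum>m\<in>UNIV. \<Sum>m'\<in>UNIV. \<rho> a $ m $ i * \<sigma> a $ m' $ j * (\<rho> a $ m $ k * \<sigma> a $ m' $ l))
     = (\<Sum>m\<in>UNIV. \<rho> a $ m $ i * \<rho> a $ m $ k) * (\<Sum>m\<in>UNIV. \<sigma> a $ m $ j * \<sigma> a $ m $ l)" for i j k l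
    by (simp add: sum_product algebra_simps)
  then show "orthogonal_matrix ((\<rho> \<otimes>\<^sub>R \<sigma>) a)"
    unfolding orthogonal_matrix
    by (auto simp: vec_eq_iff matrix_matrix_mult_def transpose_def mat_def rep_tensor_def sum_UNIV_prod d)
  show "transpose a \<in> G" using assms a by (simp add: orth_rep_def)
  have "\<rho> (transpose a) = transpose (\<rho> a)" "\<sigma> (transpose a) = transpose (\<sigma> a)"
    using assms a by (simp_all add: orth_rep_def)
  then show "(\<rho> \<otimes>\<^sub>R \<sigma>) (transpose a) = transpose ((\<rho> \<otimes>\<^sub>R \<sigma>) a)"
    by (simp add: rep_tensor_def transpose_def vec_eq_iff)
qed

text \<open>The residual \<open>x - orth_proj S x\<close> stays orthogonal to \<open>S\<close> under
  \<open>\<rho> a\<close>, because the adjoint of \<open>\<rho> a\<close> is again the action of a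
  group element and so preserves \<open>S\<close>.\<close>

lemma orth_proj_equivariant:
  assumes "orth_rep G \<rho>" "subspace S" "\<And>a x. a \<in> G \<Longrightarrow> x \<in> S \<Longrightarrow> \<rho> a *v x \<in> S" "a \<in> G"
  shows "orth_proj S (\<rho> a *v x) = \<rho> a *v orth_proj S x"
proof (rule orth_proj_unique[OF assms(2)])
  show "\<rho> a *v orth_proj S x \<in> S" using assms orth_proj by blast
  fix z assume z: "z \<in> S"
  have "transpose (\<rho> a) *v z \<in> S"
    using assms(1,3,4) z unfolding orth_rep_def by metis
  then have "(x - orth_proj S x) \<bullet> (transpose (\<rho> a) *v z) = 0" using orth_proj[OF assms(2)] by blast
  then show "(\<rho> a *v x - \<rho> a *v orth_proj S x) \<bullet> z = 0"
    by (simp add: inner_transpose flip: matrix_vector_mult_diff_distrib)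
qed

lemma bilinear_tensor: "bilinear tensor"
  unfolding bilinear_def by (auto intro!: linearI simp: vec_eq_iff tensor_def algebra_simps)

lemma linear_tensor_left: "linear (\<lambda>x. tensor x y)" and linear_tensor_right: "linear (tensor x)"
  using bilinear_tensor by (auto simp: bilinear_def)

text \<open>Schur's lemma in the form used here: an equivariant map from \<open>S\<close> to \<open>T\<close> is an invariant
  element of \<open>S \<otimes> T\<close>, because orthogonal representations are self-dual.\<close>
proposition equivariant_eq_zero:
  fixes f :: "real^'i::finite \<Rightarrow> real^'j::finite"
  assumes \<rho>: "orth_rep G \<rho>" and S: "subspace S" "\<And>a x. a \<in> G \<Longrightarrow> x \<in> S \<Longrightarrow> \<rho> a *v x \<in> S"
    and f: "linear f" "\<And>x. x \<in> S \<Longrightarrow> f x \<in> T"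
    and eq: "\<And>a x. a \<in> G \<Longrightarrow> x \<in> S \<Longrightarrow> f (\<rho> a *v x) = \<sigma> a *v f x"
    and inv: "invariants G (\<rho> \<otimes>\<^sub>R \<sigma>) (S \<otimes>\<^sub>S T) = {0}" and x: "x \<in> S"
  shows "f x = 0"
proof -
  let ?P = "orth_proj S"
  note P = orth_proj[OF S(1)] linear_orth_proj[OF S(1)]
  \<comment> \<open>Precomposing with the projection puts the tensor into
    \<open>S \<otimes>\<^sub>S T\<close>, and it makes the equivariance of \<open>f\<close>, assumed
    on \<open>S\<close> only, applicable to every basis vector.\<close>
  define B where "B = (\<lambda>x y. tensor (?P x) (f (?P y)))"
  define t where "t = (\<Sum>k\<in>UNIV. B (axis k 1) (axis k 1))"
  have B: "linear (\<lambda>x. B x y)" "linear (B x)" for x y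
    unfolding B_def
    by (rule linearI; simp only: linear_add[OF P(3)] linear_cmul[OF P(3)] linear_add[OF f(1)]
        linear_cmul[OF f(1)] linear_add[OF linear_tensor_left] linear_cmul[OF linear_tensor_left]
        linear_add[OF linear_tensor_right] linear_cmul[OF linear_tensor_right])+
  have "t \<in> invariants G (\<rho> \<otimes>\<^sub>R \<sigma>) (S \<otimes>\<^sub>S T)"
    unfolding invariants_def
  proof (intro CollectI conjI ballI)
    show "t \<in> S \<otimes>\<^sub>S T" unfolding t_def B_def tensor_space_def
      by (intro span_sum span_base) (use P(1) f(2) in blast)
    fix a assume a: "a \<in> G"
    have "(\<rho> \<otimes>\<^sub>R \<sigma>) a *v t = (\<Sum>k\<in>UNIV. (\<rho> \<otimes>\<^sub>R \<sigma>) a *v B (axis k 1) (axis k 1))"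
      unfolding t_def by (simp add: linear_sum)
    also have "\<dots> = (\<Sum>k\<in>UNIV. B (\<rho> a *v axis k 1) (\<rho> a *v axis k 1))"
      by (simp add: B_def rep_tensor_tensor orth_proj_equivariant[OF \<rho> S a] eq[OF a P(1)])
    also have "\<dots> = t" unfolding t_def
      by (rule sum_orthogonal_basis[OF _ B]) (use \<rho> a in \<open>simp add: orth_rep_def\<close>)
    finally show "(\<rho> \<otimes>\<^sub>R \<sigma>) a *v t = t" .
  qed
  then have t0: "t = 0" using inv by blast
  \<comment> \<open>The map is recovered from its tensor by contraction with \<open>x\<close>: for
    \<open>x\<close> in \<open>S\<close> the products \<open>x \<bullet> ?P (axis k 1)\<close> are
    just the coordinates of \<open>x\<close>.\<close>
  have "f x $ j = 0" for j
  proof -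
    have "0 = (\<Sum>i\<in>UNIV. x $ i * t $ (i, j))" by (simp add: t0)
    also have "\<dots> = (\<Sum>i\<in>UNIV. \<Sum>k\<in>UNIV. x $ i * ?P (axis k 1) $ i * f (?P (axis k 1)) $ j)"
      by (simp add: t_def B_def tensor_def sum_distrib_left mult.assoc)
    also have "\<dots> = (\<Sum>k\<in>UNIV. (x \<bullet> ?P (axis k 1)) * f (?P (axis k 1)) $ j)"
      by (subst sum.swap) (simp add: inner_vec_def sum_distrib_right)
    also have "\<dots> = (\<Sum>k\<in>UNIV. x $ k * f (?P (axis k 1)) $ j)"
      using orth_proj_inner[OF S(1) x] by (simp add: cart_eq_inner_axis)
    also have "\<dots> = (\<Sum>k\<in>UNIV. x $ k *\<^sub>R f (?P (axis k 1))) $ j" by simp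
    also have "\<dots> = f (?P x) $ j"
      using linear_axis_expand[of "\<lambda>x. f (?P x)" x] linear_compose[OF P(3) f(1)] by (simp add: o_def)
    finally show ?thesis using orth_proj_id[OF S(1) x] by simp
  qed
  then show ?thesis by (simp add: vec_eq_iff)
qed

text \<open>The complement \<open>D\<close> of the kernel of \<open>b\<close> in \<open>Y\<close> is
  invariant and is mapped bijectively onto \<open>b\<close> Y\<open>. The map \<beta> inverts this
  bijection after projecting orthogonally to\<close>b \<open>Y\<close>; every ingredient commutes
  with \<open>G\<close>, hence so does \<beta>.\<close>

lemma equivariant_section:
  fixes b :: "real^'i::finite \<Rightarrow> real^'j::finite"
  assumes \<rho>: "orth_rep G \<rho>" and \<sigma>: "orth_rep G \<sigma>"
    and Y: "subspace Y" "\<And>a x. a \<in> G \<Longrightarrow> x \<in> Y \<Longrightarrow> \<rho> a *v x \<in> Y"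
    and b: "linear b" "\<And>a x. a \<in> G \<Longrightarrow> b (\<rho> a *v x) = \<sigma> a *v b x"
  obtains \<beta> where "linear \<beta>" "\<And>z. \<beta> z \<in> Y" "\<And>y. y \<in> Y \<Longrightarrow> b (\<beta> (b y)) = b y"
    "\<And>a z. a \<in> G \<Longrightarrow> \<beta> (\<sigma> a *v z) = \<rho> a *v \<beta> z"
proof -
  define K where "K = {y\<in>Y. b y = 0}"
  define D where "D = {y\<in>Y. \<forall>k\<in>K. y \<bullet> k = 0}"
  let ?Q = "orth_proj (b ` Y)"
  have K: "subspace K" unfolding K_def using Y(1) b(1)
    by (auto simp: subspace_def linear_0 linear_add linear_cmul)
  have D: "subspace D" unfolding D_def using Y(1)
    by (auto simp: subspace_def inner_add_left)
  have bY: "subspace (b ` Y)" using linear_subspace_image[OF b(1) Y(1)] .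
  have bYG: "\<sigma> a *v z \<in> b ` Y" if az: "a \<in> G" "z \<in> b ` Y" for a z
  proof -
    obtain y where "y \<in> Y" "z = b y" using az by blast
    then have "\<sigma> a *v z = b (\<rho> a *v y)" "\<rho> a *v y \<in> Y" using az b(2) Y(2) by simp_all
    then show ?thesis by simp
  qed
  have DG: "\<rho> a *v y \<in> D" if a: "a \<in> G" and y: "y \<in> D" for a y
    unfolding D_def
  proof (intro CollectI conjI ballI)
    show "\<rho> a *v y \<in> Y" using y Y(2)[OF a] by (simp add: D_def)
    fix k assume k: "k \<in> K"
    have a': "transpose a \<in> G" "\<rho> (transpose a) = transpose (\<rho> a)" using \<rho> a by (auto simp: orth_rep_def)
    have "transpose (\<rho> a) *v k \<in> Y" "b (transpose (\<rho> a) *v k) = 0"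
      using k Y(2)[OF a'(1), of k] b(2)[OF a'(1), of k] unfolding K_def a'(2) by auto
    then have "transpose (\<rho> a) *v k \<in> K" by (simp add: K_def)
    then show "(\<rho> a *v y) \<bullet> k = 0" using y by (simp add: D_def inner_transpose)
  qed
  have ex: "\<exists>y\<in>D. b y = z" if z: "z \<in> b ` Y" for z
  proof -
    obtain y where y: "y \<in> Y" "z = b y" using z by blast
    have pK: "orth_proj K y \<in> Y" "b (orth_proj K y) = 0"
      using orth_proj(1)[OF K, of y] by (auto simp: K_def)
    have "y - orth_proj K y \<in> D"
      unfolding D_def using y pK orth_proj(2)[OF K, of _ y] Y(1) by (simp add: subspace_diff)
    moreover have "b (y - orth_proj K y) = z"
      using pK y b(1) by (simp add: linear_diff)
    ultimately show ?thesis by blast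
  qed
  have uniq: "y = y'" if y: "y \<in> D" "y' \<in> D" "b y = b y'" for y y'
  proof -
    have "y - y' \<in> D" using D y subspace_diff by blast
    moreover from this have "y - y' \<in> K" using y b(1) by (simp add: K_def D_def linear_diff)
    ultimately have "(y - y') \<bullet> (y - y') = 0" by (simp add: D_def)
    then show ?thesis by simp
  qed
  define \<beta> where "\<beta> = (\<lambda>z. SOME y. y \<in> D \<and> b y = ?Q z)"
  have \<beta>: "\<beta> z \<in> D \<and> b (\<beta> z) = ?Q z" for z
    unfolding \<beta>_def by (rule someI_ex) (use ex[OF orth_proj(1)[OF bY]] in blast)
  note linQ = linear_orth_proj[OF bY]
  show ?thesis
  proof
    show "linear \<beta>"
    proof (rule linearI)
      show "\<beta> (x + y) = \<beta> x + \<beta> y" for x y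
        by (rule uniq) (use \<beta> D b(1) linQ in \<open>simp_all add: subspace_add linear_add\<close>)
      show "\<beta> (r *\<^sub>R x) = r *\<^sub>R \<beta> x" for r x
        by (rule uniq) (use \<beta> D b(1) linQ in \<open>simp_all add: subspace_scale linear_cmul\<close>)
    qed
    show "\<beta> z \<in> Y" for z using \<beta>[of z] by (simp add: D_def)
    show "b (\<beta> (b y)) = b y" if "y \<in> Y" for y
      using \<beta>[of "b y"] orth_proj_id[OF bY, of "b y"] that by simp
    show "\<beta> (\<sigma> a *v z) = \<rho> a *v \<beta> z" if a: "a \<in> G" for a z
      by (rule uniq) (use \<beta> DG[OF a] b(2)[OF a] orth_proj_equivariant[OF \<sigma> bY bYG a] in simp_all)
  qed
qed

text \<open>The representation-theoretic core: \<open>y\<close> is determined by \<open>F x\<close> and \<open>Q q\<close> up to the kernel of \<open>b\<close>,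
  so an equivariant map into \<open>T\<close> sees only the three modules without a common constituent with \<open>T\<close>.\<close>
proposition equivariant_vanishing:
  fixes r :: "real^'c::finite \<Rightarrow> real^'s::finite" and b :: "real^'c \<Rightarrow> real^'c"
    and F :: "real^'x::finite \<Rightarrow> real^'c" and Q :: "real^'q::finite \<Rightarrow> real^'c"
  assumes \<tau>: "orth_rep G \<tau>" and \<rho>1: "orth_rep G \<rho>\<^sub>1" and \<rho>2: "orth_rep G \<rho>\<^sub>2"
    and r: "linear r" "\<And>z. r z \<in> T" "\<And>a z. a \<in> G \<Longrightarrow> r (\<tau> a *v z) = \<sigma> a *v r z"
    and b: "linear b" "\<And>a z. a \<in> G \<Longrightarrow> b (\<tau> a *v z) = \<tau> a *v b z"
    and F: "linear F" "\<And>a z. a \<in> G \<Longrightarrow> F (\<rho>\<^sub>1 a *v z) = \<tau> a *v F z"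
    and Q: "linear Q" "\<And>a z. a \<in> G \<Longrightarrow> Q (\<rho>\<^sub>2 a *v z) = \<tau> a *v Q z"
    and Y: "subspace Y" "\<And>a x. a \<in> G \<Longrightarrow> x \<in> Y \<Longrightarrow> \<tau> a *v x \<in> Y"
    and S1: "subspace S\<^sub>1" "\<And>a x. a \<in> G \<Longrightarrow> x \<in> S\<^sub>1 \<Longrightarrow> \<rho>\<^sub>1 a *v x \<in> S\<^sub>1"
    and S2: "subspace S\<^sub>2" "\<And>a x. a \<in> G \<Longrightarrow> x \<in> S\<^sub>2 \<Longrightarrow> \<rho>\<^sub>2 a *v x \<in> S\<^sub>2"
    and inv: "invariants G (\<tau> \<otimes>\<^sub>R \<sigma>) ({y\<in>Y. b y = 0} \<otimes>\<^sub>S T) = {0}"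
      "invariants G (\<rho>\<^sub>1 \<otimes>\<^sub>R \<sigma>) (S\<^sub>1 \<otimes>\<^sub>S T) = {0}" "invariants G (\<rho>\<^sub>2 \<otimes>\<^sub>R \<sigma>) (S\<^sub>2 \<otimes>\<^sub>S T) = {0}"
    and mem: "y \<in> Y" "x \<in> S\<^sub>1" "q \<in> S\<^sub>2" and bz: "b (y + F x + Q q) = 0"
  shows "r (y + F x + Q q) = 0"
proof -
  obtain \<beta> where \<beta>: "linear \<beta>" "\<And>z. \<beta> z \<in> Y" "\<And>y. y \<in> Y \<Longrightarrow> b (\<beta> (b y)) = b y"
    "\<And>a z. a \<in> G \<Longrightarrow> \<beta> (\<tau> a *v z) = \<tau> a *v \<beta> z"
    using equivariant_section[OF \<tau> \<tau> Y b] by metis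
  let ?K = "{y\<in>Y. b y = 0}"
  have rK: "r k = 0" if "k \<in> ?K" for k
  proof (rule equivariant_eq_zero[OF \<tau> _ _ r(1,2,3) inv(1) that])
    show "subspace ?K" using Y(1) b(1) by (auto simp: subspace_def linear_0 linear_add linear_cmul)
    show "\<tau> a *v x \<in> ?K" if "a \<in> G" "x \<in> ?K" for a x using that Y(2) b(2) by simp
  qed
  \<comment> \<open>The correction by \<open>\<beta> (b z)\<close> changes nothing where
    \<open>b\<close> vanishes, in particular on the whole sum. For \<open>y\<close> in
    \<open>Y\<close> it moves \<open>y\<close> into the kernel of \<open>b\<close>, where
    \<open>r\<close> is already known to be zero. On the images of \<open>F\<close> and
    \<open>Q\<close> the corrected map is still equivariant, so Schur's lemma applies to each of
    them alone.\<close>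
  define f where "f = (\<lambda>z. r (z - \<beta> (b z)))"
  have linf: "linear f" unfolding f_def
    by (intro linearI)
      (simp_all add: linear_add[OF r(1)] linear_add[OF b(1)] linear_add[OF \<beta>(1)] linear_diff[OF r(1)]
        linear_cmul[OF r(1)] linear_cmul[OF b(1)] linear_cmul[OF \<beta>(1)] algebra_simps)
  have eqf: "f (\<tau> a *v z) = \<sigma> a *v f z" if "a \<in> G" for a z
    unfolding f_def using that r(3) b(2) \<beta>(4) by (simp flip: matrix_vector_mult_diff_distrib)
  have "f y = 0" unfolding f_def
    by (rule rK) (use mem \<beta> Y(1) b(1) in \<open>simp add: subspace_diff linear_diff\<close>)
  moreover have "f (F x) = 0"
    by (rule equivariant_eq_zero[where f="\<lambda>x. f (F x)", OF \<rho>1 S1(1) _ _ _ _ inv(2) mem(2)])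
      (use linear_compose[OF F(1) linf] eqf F(2) r(2) S1(2) in \<open>simp_all add: o_def f_def\<close>)
  moreover have "f (Q q) = 0"
    by (rule equivariant_eq_zero[where f="\<lambda>x. f (Q x)", OF \<rho>2 S2(1) _ _ _ _ inv(3) mem(3)])
      (use linear_compose[OF Q(1) linf] eqf Q(2) r(2) S2(2) in \<open>simp_all add: o_def f_def\<close>)
  ultimately have "f (y + F x + Q q) = 0" by (simp add: linear_add[OF linf])
  then show ?thesis using bz linear_0[OF \<beta>(1)] by (simp add: f_def)
qed

section \<open>Curvature tensors and intrinsic torsion as multilinear maps\<close>

definition contract :: "real^('i::finite \<times> 'j::finite) \<Rightarrow> real^'i \<Rightarrow> real^'j" where
  "contract T u = (\<chi> j. \<Sum>i\<in>UNIV. u $ i * T $ (i, j))"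

definition unmat :: "real^('n::finite \<times> 'n) \<Rightarrow> real^'n^'n" where
  "unmat T = (\<chi> j k. T $ (j, k))"

lemma bilinear_contract: "bilinear contract"
  unfolding bilinear_def
  by (auto intro!: linearI simp: vec_eq_iff contract_def algebra_simps sum.distrib sum_distrib_left)

lemmas contract_simps =
  bilinear_ladd[OF bilinear_contract] bilinear_radd[OF bilinear_contract]
  bilinear_lsub[OF bilinear_contract] bilinear_rsub[OF bilinear_contract]
  bilinear_lmul[OF bilinear_contract] bilinear_rmul[OF bilinear_contract]
  bilinear_lneg[OF bilinear_contract] bilinear_rneg[OF bilinear_contract]
  bilinear_lzero[OF bilinear_contract] bilinear_rzero[OF bilinear_contract]

lemma linear_unmat: "linear unmat"
  by (auto intro!: linearI simp: vec_eq_iff unmat_def)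

lemmas unmat_simps = linear_add[OF linear_unmat] linear_diff[OF linear_unmat]
  linear_cmul[OF linear_unmat] linear_neg[OF linear_unmat] linear_0[OF linear_unmat]

lemma unmat_mat_tensor [simp]: "unmat (mat_tensor A) = A"
  and mat_tensor_unmat [simp]: "mat_tensor (unmat T) = T"
  by (simp_all add: vec_eq_iff unmat_def mat_tensor_def)

lemma contract_axis: "contract T (axis i 1) = (\<chi> j. T $ (i, j))"
  by (simp add: contract_def axis_def vec_eq_iff if_distrib[of "\<lambda>r. r * _"] cong: if_cong)

lemma contract_tensor: "contract (tensor x y) u = (x \<bullet> u) *\<^sub>R y"
  by (simp add: contract_def tensor_def vec_eq_iff inner_vec_def sum_distrib_left mult_ac)

lemma contract_rep:
  "contract ((\<rho> \<otimes>\<^sub>R \<sigma>) a *v T) u = \<sigma> a *v contract T (transpose (\<rho> a) *v u)"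
proof -
  have "contract ((\<rho> \<otimes>\<^sub>R \<sigma>) a *v T) u $ j
     = (\<sigma> a *v contract T (transpose (\<rho> a) *v u)) $ j" for j
  proof -
    have "contract ((\<rho> \<otimes>\<^sub>R \<sigma>) a *v T) u $ j
       = (\<Sum>i\<in>UNIV. \<Sum>k\<in>UNIV. \<Sum>l\<in>UNIV. u $ i * \<rho> a $ i $ k * \<sigma> a $ j $ l * T $ (k, l))"
      by (simp add: contract_def matrix_vector_mult_def rep_tensor_def sum_UNIV_prod sum_distrib_left mult.assoc)
    also have "\<dots> = (\<Sum>k\<in>UNIV. \<Sum>l\<in>UNIV. \<Sum>i\<in>UNIV. u $ i * \<rho> a $ i $ k * \<sigma> a $ j $ l * T $ (k, l))"
      by (subst sum.swap) (intro sum.cong refl sum.swap)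
    also have "\<dots> = (\<Sum>l\<in>UNIV. \<Sum>k\<in>UNIV. \<Sum>i\<in>UNIV. u $ i * \<rho> a $ i $ k * \<sigma> a $ j $ l * T $ (k, l))"
      by (rule sum.swap)
    also have "\<dots> = (\<sigma> a *v contract T (transpose (\<rho> a) *v u)) $ j"
      by (simp add: contract_def matrix_vector_mult_def transpose_def sum_distrib_left sum_distrib_right algebra_simps)
    finally show ?thesis .
  qed
  then show ?thesis by (simp add: vec_eq_iff)
qed

lemma unmat_rep: "unmat ((std_rep \<otimes>\<^sub>R std_rep) a *v T) = a ** unmat T ** transpose a"
proof -
  have "unmat ((std_rep \<otimes>\<^sub>R std_rep) a *v T) $ i $ j = (a ** unmat T ** transpose a) $ i $ j" for i j
    by (simp add: unmat_def matrix_vector_mult_def matrix_matrix_mult_def rep_tensor_def std_rep_def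
        transpose_def sum_UNIV_prod sum_distrib_right) (subst sum.swap, simp add: mult_ac)
  then show ?thesis by (simp add: vec_eq_iff)
qed

lemma contract_in:
  assumes "subspace T'" "T \<in> S \<otimes>\<^sub>S T'"
  shows "contract T u \<in> T'"
  using assms(2) unfolding tensor_space_def
proof (induction rule: span_induct_alt)
  case base
  then show ?case using assms by (simp add: contract_simps subspace_0)
next
  case (step c x y)
  then show ?case using assms(1)
    by (auto simp: contract_simps contract_tensor intro!: subspace_add subspace_scale)
qed

lemma tensor_sum_contract: "T = (\<Sum>i\<in>UNIV. tensor (axis i 1) (contract T (axis i 1)))"
  by (simp add: vec_eq_iff contract_axis tensor_def)
    (simp add: axis_def if_distrib[of "\<lambda>r. r * _"] cong: if_cong)

lemma in_tensor_spaceI: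
  assumes "\<And>i. contract T (axis i 1) \<in> T'"
  shows "T \<in> UNIV \<otimes>\<^sub>S T'"
  by (subst tensor_sum_contract[of T], unfold tensor_space_def) (intro span_sum span_base, use assms in blast)

lemma subspace_tensor_space: "subspace (S \<otimes>\<^sub>S T)"
  by (simp add: tensor_space_def)

lemma tensor_space_rep:
  assumes "\<And>x. x \<in> S \<Longrightarrow> \<rho> a *v x \<in> S" "\<And>x. x \<in> T \<Longrightarrow> \<sigma> a *v x \<in> T" "z \<in> S \<otimes>\<^sub>S T"
  shows "(\<rho> \<otimes>\<^sub>R \<sigma>) a *v z \<in> S \<otimes>\<^sub>S T"
  using assms(3) unfolding tensor_space_def
proof (induction rule: span_induct_alt)
  case base
  then show ?case by (simp add: span_zero)
next
  case (step c x y)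
  then obtain u v where "x = tensor u v" "u \<in> S" "v \<in> T" by auto
  then have "(\<rho> \<otimes>\<^sub>R \<sigma>) a *v x = tensor (\<rho> a *v u) (\<sigma> a *v v)" "\<rho> a *v u \<in> S" "\<sigma> a *v v \<in> T"
    using assms(1,2) by (simp_all add: rep_tensor_tensor)
  then have "(\<rho> \<otimes>\<^sub>R \<sigma>) a *v x \<in> {tensor x y |x y. x \<in> S \<and> y \<in> T}" by auto
  with step show ?case
    by (simp add: matrix_vector_right_distrib matrix_vector_mult_scaleR span_add span_scale span_base)
qed

lemma tensor_axis: "tensor (axis i 1) (axis j 1) = axis (i, j) (1::real)"
  by (auto simp: vec_eq_iff tensor_def axis_def)

lemma linear_eq_tensor:
  fixes f g :: "real^('i::finite \<times> 'j::finite) \<Rightarrow> 'a::real_vector"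
  assumes "linear f" "linear g" "\<And>x y. f (tensor x y) = g (tensor x y)"
  shows "f z = g z"
proof (rule linear_eq_axis[OF assms(1,2)])
  fix p :: "'i \<times> 'j"
  show "f (axis p 1) = g (axis p 1)"
    using assms(3)[of "axis (fst p) 1" "axis (snd p) 1"] by (simp add: tensor_axis)
qed

section \<open>Tensors as matrix-valued linear and bilinear maps\<close>

definition torsion_map :: "real^('n::finite \<times> ('n \<times> 'n)) \<Rightarrow> real^'n \<Rightarrow> real^'n^'n" where
  "torsion_map x u = unmat (contract x u)"

definition curvature_map ::
  "real^(('n::finite \<times> 'n) \<times> ('n \<times> 'n)) \<Rightarrow> real^'n \<Rightarrow> real^'n \<Rightarrow> real^'n^'n" where
  "curvature_map R u v = unmat (contract R (tensor u v))"

definition torsion_tensor :: "(real^'n \<Rightarrow> real^'n^'n) \<Rightarrow> real^('n::finite \<times> ('n \<times> 'n))" where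
  "torsion_tensor f = (\<chi> p. f (axis (fst p) 1) $ fst (snd p) $ snd (snd p))"

definition curvature_tensor ::
  "(real^'n \<Rightarrow> real^'n \<Rightarrow> real^'n^'n) \<Rightarrow> real^(('n::finite \<times> 'n) \<times> ('n \<times> 'n))" where
  "curvature_tensor f =
     (\<chi> p. f (axis (fst (fst p)) 1) (axis (snd (fst p)) 1) $ fst (snd p) $ snd (snd p))"

lemmas multilinear_simps = contract_simps unmat_simps matrix_mult_simps matrix_vector_simps
  bilinear_ladd[OF bilinear_tensor] bilinear_radd[OF bilinear_tensor]
  bilinear_lmul[OF bilinear_tensor] bilinear_rmul[OF bilinear_tensor]
  bilinear_lsub[OF bilinear_tensor] bilinear_rsub[OF bilinear_tensor]

lemma bilinear_torsion_map: "bilinear torsion_map"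
  unfolding bilinear_def torsion_map_def by (auto intro!: linearI simp: multilinear_simps)

lemma linear_curvature_map: "linear (\<lambda>R. curvature_map R u v)"
  and bilinear_curvature_map: "bilinear (curvature_map R)"
  unfolding bilinear_def curvature_map_def by (auto intro!: linearI simp: multilinear_simps)

lemmas torsion_map_simps =
  bilinear_ladd[OF bilinear_torsion_map] bilinear_radd[OF bilinear_torsion_map]
  bilinear_lsub[OF bilinear_torsion_map] bilinear_rsub[OF bilinear_torsion_map]
  bilinear_lmul[OF bilinear_torsion_map] bilinear_rmul[OF bilinear_torsion_map]

lemmas curvature_map_simps =
  linear_add[OF linear_curvature_map] linear_diff[OF linear_curvature_map]
  linear_cmul[OF linear_curvature_map]
  bilinear_ladd[OF bilinear_curvature_map] bilinear_radd[OF bilinear_curvature_map]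
  bilinear_lsub[OF bilinear_curvature_map] bilinear_rsub[OF bilinear_curvature_map]
  bilinear_lmul[OF bilinear_curvature_map] bilinear_rmul[OF bilinear_curvature_map]

lemma torsion_map_axis: "torsion_map x (axis i 1) $ j $ k = x $ (i, (j, k))"
  by (simp add: torsion_map_def contract_axis unmat_def)

lemma curvature_map_axis:
  "curvature_map R (axis i 1) (axis j 1) $ k $ l = R $ ((i, j), (k, l))"
  by (simp add: curvature_map_def tensor_axis contract_axis unmat_def)

lemma torsion_map_tensor:
  assumes "linear f"
  shows "torsion_map (torsion_tensor f) u = f u"
proof (rule linear_eq_axis[OF _ assms])
  show "linear (torsion_map (torsion_tensor f))" using bilinear_torsion_map by (auto simp: bilinear_def)
qed (simp add: vec_eq_iff torsion_map_axis torsion_tensor_def)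

lemma curvature_map_tensor:
  assumes "bilinear f"
  shows "curvature_map (curvature_tensor f) u v = f u v"
proof -
  have lin: "linear (f x)" "linear (\<lambda>x. f x y)"
    "linear (curvature_map R x)" "linear (\<lambda>x. curvature_map R x y)" for x y R
    using assms bilinear_curvature_map by (auto simp: bilinear_def)
  have "curvature_map (curvature_tensor f) (axis i 1) (axis j 1) = f (axis i 1) (axis j 1)" for i j
    by (simp add: vec_eq_iff curvature_map_axis curvature_tensor_def)
  from linear_eq_axis[OF lin(3,1) this]
  have "curvature_map (curvature_tensor f) (axis i 1) v = f (axis i 1) v" for i .
  from linear_eq_axis[OF lin(4,2) this] show ?thesis .
qed

lemma torsion_map_eqI:
  assumes "\<And>u. torsion_map x u = torsion_map y u"
  shows "x = y"
  using torsion_map_axis[of x] torsion_map_axis[of y] assms by (auto simp: vec_eq_iff)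

lemma curvature_map_eqI:
  assumes "\<And>u v. curvature_map R u v = curvature_map S u v"
  shows "R = S"
proof -
  have "R $ ((i, j), (k, l)) = S $ ((i, j), (k, l))" for i j k l
    using assms[of "axis i 1" "axis j 1"] by (metis curvature_map_axis)
  then show ?thesis by (auto simp: vec_eq_iff)
qed

lemma torsion_tensor_sum: "torsion_tensor f = (\<Sum>i\<in>UNIV. tensor (axis i 1) (mat_tensor (f (axis i 1))))"
  by (simp add: vec_eq_iff torsion_tensor_def tensor_def mat_tensor_def)
    (simp add: axis_def if_distrib[of "\<lambda>r. r * _"] cong: if_cong)

lemma torsion_map_rep:
  "torsion_map ((std_rep \<otimes>\<^sub>R (std_rep \<otimes>\<^sub>R std_rep)) a *v x) u
    = a ** torsion_map x (transpose a *v u) ** transpose a"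
  unfolding torsion_map_def contract_rep unmat_rep by (simp add: std_rep_def)

lemma transpose_rep_tensor: "transpose ((\<rho> \<otimes>\<^sub>R \<sigma>) a) = ((\<lambda>a. transpose (\<rho> a)) \<otimes>\<^sub>R (\<lambda>a. transpose (\<sigma> a))) a"
  by (simp add: rep_tensor_def transpose_def vec_eq_iff)

lemma curvature_map_rep:
  "curvature_map (((std_rep \<otimes>\<^sub>R std_rep) \<otimes>\<^sub>R (std_rep \<otimes>\<^sub>R std_rep)) a *v R) u v
    = a ** curvature_map R (transpose a *v u) (transpose a *v v) ** transpose a"
  unfolding curvature_map_def contract_rep unmat_rep
  by (simp add: transpose_rep_tensor rep_tensor_tensor std_rep_def)

lemma subspace_mat_tensor_image: "subspace \<hh> \<Longrightarrow> subspace (mat_tensor ` \<hh>)"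
  by (rule linear_subspace_image) (auto intro!: linearI simp: vec_eq_iff mat_tensor_def)

lemma V_tensor_iff:
  assumes "subspace \<hh>"
  shows "x \<in> V_tensor \<hh> \<longleftrightarrow> (\<forall>u. torsion_map x u \<in> \<hh>)"
proof
  assume "x \<in> V_tensor \<hh>"
  then have "contract x u \<in> mat_tensor ` \<hh>" for u
    unfolding V_tensor_def using contract_in[OF subspace_mat_tensor_image[OF assms]] by blast
  then show "\<forall>u. torsion_map x u \<in> \<hh>" unfolding torsion_map_def by (metis imageE unmat_mat_tensor)
next
  assume "\<forall>u. torsion_map x u \<in> \<hh>"
  then have "contract x u \<in> mat_tensor ` \<hh>" for u
    unfolding torsion_map_def by (metis image_eqI mat_tensor_unmat)
  then show "x \<in> V_tensor \<hh>" unfolding V_tensor_def by (rule in_tensor_spaceI)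
qed

lemma Lambda2_iff: "x \<in> Lambda2 \<longleftrightarrow> transpose (unmat x) = - unmat x"
  unfolding Lambda2_def unmat_def transpose_def vec_eq_iff mem_Collect_eq
  by (simp only: vec_lambda_beta uminus_vec_def) blast

lemma Lambda2_rep:
  assumes "x \<in> Lambda2"
  shows "(std_rep \<otimes>\<^sub>R std_rep) a *v x \<in> Lambda2"
  using assms
  by (simp add: Lambda2_iff unmat_rep matrix_transpose_mul matrix_mult_simps matrix_mul_assoc[symmetric])

lemma Lambda2_tensor_iff:
  assumes "subspace \<hh>"
  shows "R \<in> Lambda2 \<otimes>\<^sub>S (mat_tensor ` \<hh>)
    \<longleftrightarrow> (\<forall>u v. curvature_map R u v \<in> \<hh> \<and> curvature_map R u v = - curvature_map R v u)"
proof
  assume R: "R \<in> Lambda2 \<otimes>\<^sub>S (mat_tensor ` \<hh>)"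
  then have "contract R z \<in> mat_tensor ` \<hh>" for z
    using contract_in[OF subspace_mat_tensor_image[OF assms]] by blast
  moreover have "contract R (tensor u v) = - contract R (tensor v u)" for u v
    using R unfolding tensor_space_def
  proof (induction rule: span_induct_alt)
    case base
    then show ?case by (simp add: contract_simps)
  next
    case (step c x y)
    then obtain l m where x: "x = tensor l m" "l \<in> Lambda2" by blast
    have "l \<bullet> tensor u v = (\<Sum>i\<in>UNIV. \<Sum>j\<in>UNIV. l $ (i, j) * (u $ i * v $ j))"
      by (simp add: inner_vec_def sum_UNIV_prod tensor_def)
    also have "\<dots> = (\<Sum>j\<in>UNIV. \<Sum>i\<in>UNIV. - l $ (j, i) * (u $ i * v $ j))"
      by (subst sum.swap, intro sum.cong refl) (use x(2) in \<open>metis (mono_tags, lifting) Lambda2_def mem_Collect_eq\<close>)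
    also have "\<dots> = - (l \<bullet> tensor v u)"
      by (simp add: inner_vec_def sum_UNIV_prod tensor_def sum_negf mult.commute)
    finally show ?case using step by (simp add: x contract_simps contract_tensor)
  qed
  ultimately show "\<forall>u v. curvature_map R u v \<in> \<hh> \<and> curvature_map R u v = - curvature_map R v u"
    unfolding curvature_map_def by (metis imageE unmat_mat_tensor unmat_simps(4))
next
  assume R: "\<forall>u v. curvature_map R u v \<in> \<hh> \<and> curvature_map R u v = - curvature_map R v u"
  let ?e = "\<lambda>i j. axis (i, j) 1 :: real^('a \<times> 'a)"
  let ?c = "\<lambda>i j. contract R (?e i j)"
  have c: "?c i j \<in> mat_tensor ` \<hh>" "?c i j = - ?c j i" for i j
    using R[rule_format, of "axis i 1" "axis j 1"] unfolding curvature_map_def tensor_axis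
    by (metis image_eqI mat_tensor_unmat) (metis mat_tensor_unmat unmat_simps(4) R curvature_map_def tensor_axis)
  have e1: "R = (\<Sum>i\<in>UNIV. \<Sum>j\<in>UNIV. tensor (?e i j) (?c i j))"
    by (subst tensor_sum_contract[of R]) (simp add: sum_UNIV_prod)
  have e2: "(\<Sum>i\<in>UNIV. \<Sum>j\<in>UNIV. tensor (?e i j) (?c i j)) = (\<Sum>i\<in>UNIV. \<Sum>j\<in>UNIV. - tensor (?e j i) (?c i j))"
    by (subst sum.swap, intro sum.cong refl) (metis c(2) linear_neg[OF linear_tensor_right])
  \<comment> \<open>One copy of \<open>R\<close> is expanded with the indices \<open>i\<close>,
    \<open>j\<close> exchanged. By antisymmetry of the coefficients the two expansions combine to
    the elements \<open>?e i j - ?e j i\<close> of \<open>Lambda2\<close>.\<close>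
  have "R = (1/2) *\<^sub>R (R + R)" by (simp flip: scaleR_2)
  also have "R + R = (\<Sum>i\<in>UNIV. \<Sum>j\<in>UNIV. tensor (?e i j) (?c i j))
      + (\<Sum>i\<in>UNIV. \<Sum>j\<in>UNIV. - tensor (?e j i) (?c i j))"
    by (rule arg_cong2[where f="(+)", OF e1 trans[OF e1 e2]])
  also have "\<dots> = (\<Sum>i\<in>UNIV. \<Sum>j\<in>UNIV. tensor (?e i j - ?e j i) (?c i j))"
    by (simp add: linear_diff[OF linear_tensor_left] sum_subtractf sum_negf)
  finally have Req: "R = (\<Sum>i\<in>UNIV. \<Sum>j\<in>UNIV. (1/2) *\<^sub>R tensor (?e i j - ?e j i) (?c i j))"
    unfolding scaleR_sum_right .
  have "?e i j - ?e j i \<in> Lambda2" for i j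
    unfolding Lambda2_def mem_Collect_eq axis_def by (intro allI) (simp add: conj_commute)
  then have "(\<Sum>i\<in>UNIV. \<Sum>j\<in>UNIV. (1/2) *\<^sub>R tensor (?e i j - ?e j i) (?c i j)) \<in> Lambda2 \<otimes>\<^sub>S (mat_tensor ` \<hh>)" (is "?S \<in> _")
    unfolding tensor_space_def using c(1) by (intro span_sum span_scale span_base) blast
  then show "R \<in> Lambda2 \<otimes>\<^sub>S (mat_tensor ` \<hh>)" by (rule ssubst[OF Req, where P="\<lambda>z. z \<in> _"])
qed

text \<open>With \<open>contract X u\<close> as the covariant derivative of \<xi> in direction
  \<open>u\<close>, this is its antisymmetrization, the part of the curvature that is linear in the
  derivative. It is the equivariant map F of the overview.\<close>

definition skew_part :: "real^('n::finite \<times> ('n \<times> ('n \<times> 'n))) \<Rightarrow> real^(('n \<times> 'n) \<times> ('n \<times> 'n))" where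
  "skew_part X = curvature_tensor
     (\<lambda>u v. torsion_map (contract X u) v - torsion_map (contract X v) u)"

text \<open>For \<open>x = y\<close> these are the terms of second order in \<xi> when the
  connection form is a Lie algebra part plus \<xi>: the commutator, and \<xi> applied to the
  contribution of \<xi> to the bracket of the frame fields. The form is polarized so that it is
  linear in \<open>x\<close> and in \<open>y\<close>.\<close>

definition quadratic ::
  "real^('n::finite \<times> ('n \<times> 'n)) \<Rightarrow> real^('n \<times> ('n \<times> 'n)) \<Rightarrow> real^'n \<Rightarrow> real^'n \<Rightarrow> real^'n^'n" where
  "quadratic x y u v = torsion_map x u ** torsion_map y v - torsion_map x v ** torsion_map y u
     - torsion_map y (torsion_map x u *v v - torsion_map x v *v u)"

text \<open>The linear extension of \<open>quadratic\<close> to the tensor square, so that Schur's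
  lemma for linear maps can be applied to S^2 W at the element \<open>tensor \<xi> \<xi>\<close>. It
  is the map Q of the overview.\<close>

definition quadratic_part ::
  "real^(('n::finite \<times> ('n \<times> 'n)) \<times> ('n \<times> ('n \<times> 'n))) \<Rightarrow> real^(('n \<times> 'n) \<times> ('n \<times> 'n))" where
  "quadratic_part q =
     (\<Sum>i\<in>UNIV. \<Sum>j\<in>UNIV. q $ (i, j) *\<^sub>R curvature_tensor (quadratic (axis i 1) (axis j 1)))"

text \<open>The entries are those of \<open>bianchi_map\<close>, rearranged so that the values lie
  in the same representation as the curvature tensors; \<open>equivariant_vanishing\<close> asks for
  an endomorphism.\<close>

definition bianchi_sum :: "real^(('n::finite \<times> 'n) \<times> ('n \<times> 'n)) \<Rightarrow> real^(('n \<times> 'n) \<times> ('n \<times> 'n))" where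
  "bianchi_sum R = curvature_tensor (\<lambda>u v. matrix (\<lambda>z.
     curvature_map R u v *v z + curvature_map R v z *v u + curvature_map R z u *v v))"

definition ricci_matrix :: "real^(('n::finite \<times> 'n) \<times> ('n \<times> 'n)) \<Rightarrow> real^'n^'n" where
  "ricci_matrix R = (\<chi> j k. trace (matrix (\<lambda>m. curvature_map R m (axis j 1) *v axis k 1)))"

text \<open>Symmetrization is built in because the contraction of an arbitrary tensor is not
  symmetric, while the equivariant map to which Schur's lemma is applied must take all its values in
  \<open>Sym2_0\<close>.\<close>

definition sym_tracefree :: "real^'n::finite^'n \<Rightarrow> real^'n^'n" where
  "sym_tracefree M = (1/2) *\<^sub>R (M + transpose M) - (trace M / CARD('n)) *\<^sub>R mat 1"

lemma bilinear_skew_part: "bilinear (\<lambda>u v. torsion_map (contract X u) v - torsion_map (contract X v) u)"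
  unfolding bilinear_def by (auto intro!: linearI simp: torsion_map_simps contract_simps algebra_simps)

lemma bilinear_quadratic: "bilinear (quadratic x y)"
  unfolding bilinear_def quadratic_def
  by (auto intro!: linearI simp: torsion_map_simps multilinear_simps algebra_simps)

lemma curvature_map_skew_part:
  "curvature_map (skew_part X) u v = torsion_map (contract X u) v - torsion_map (contract X v) u"
  unfolding skew_part_def by (rule curvature_map_tensor[OF bilinear_skew_part])

lemma linear_skew_part: "linear skew_part"
  by (rule linearI; rule curvature_map_eqI)
    (simp_all add: curvature_map_skew_part curvature_map_simps contract_simps torsion_map_simps algebra_simps)

lemma skew_part_rep:
  "skew_part ((std_rep \<otimes>\<^sub>R (std_rep \<otimes>\<^sub>R (std_rep \<otimes>\<^sub>R std_rep))) a *v X)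
    = ((std_rep \<otimes>\<^sub>R std_rep) \<otimes>\<^sub>R (std_rep \<otimes>\<^sub>R std_rep)) a *v skew_part X"
  by (rule curvature_map_eqI)
    (simp add: curvature_map_skew_part curvature_map_rep contract_rep torsion_map_rep matrix_mult_simps std_rep_def)

lemma linear_quadratic_part: "linear quadratic_part"
  by (auto intro!: linearI simp: quadratic_part_def sum.distrib scaleR_sum_right algebra_simps)

lemma quadratic_part_tensor:
  fixes x y :: "real^('n::finite \<times> ('n \<times> 'n))"
  shows "quadratic_part (tensor x y) = curvature_tensor (quadratic x y)"
proof -
  have lin: "linear (\<lambda>x. curvature_tensor (quadratic x y))" "linear (\<lambda>y. curvature_tensor (quadratic x y))"
    for x y :: "real^('n \<times> ('n \<times> 'n))"
    by (auto intro!: linearI simp: vec_eq_iff curvature_tensor_def quadratic_def torsion_map_simps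
        multilinear_simps algebra_simps)
  have lin': "linear (\<lambda>x. quadratic_part (tensor x y))" "linear (\<lambda>y. quadratic_part (tensor x y))"
    for x y :: "real^('n \<times> ('n \<times> 'n))"
    using linear_compose[OF linear_tensor_left linear_quadratic_part]
      linear_compose[OF linear_tensor_right linear_quadratic_part] by (simp_all add: o_def)
  have "quadratic_part (tensor (axis i 1) (axis j 1)) = curvature_tensor (quadratic (axis i 1) (axis j 1))"
    for i j :: "'n \<times> ('n \<times> 'n)"
  proof -
    have "quadratic_part (tensor (axis i 1) (axis j 1))
      = (\<Sum>i'\<in>UNIV. if i' = i then (\<Sum>j'\<in>UNIV. if j' = j then
          curvature_tensor (quadratic (axis i' 1) (axis j' 1)) else 0) else 0)"
      unfolding quadratic_part_def
      by (rule sum.cong[OF refl]) (simp add: tensor_def axis_def[of i] axis_def[of j] if_distrib[of "\<lambda>r. r *\<^sub>R _"] cong: if_cong)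
    also have "\<dots> = curvature_tensor (quadratic (axis i 1) (axis j 1))" by simp
    finally show ?thesis .
  qed
  from linear_eq_axis[OF lin'(1) lin(1) this]
  have "quadratic_part (tensor x (axis j 1)) = curvature_tensor (quadratic x (axis j 1))" for j .
  from linear_eq_axis[OF lin'(2) lin(2) this] show ?thesis .
qed

lemma quadratic_part_rep:
  assumes "orthogonal_matrix a"
  shows "quadratic_part (((std_rep \<otimes>\<^sub>R (std_rep \<otimes>\<^sub>R std_rep)) \<otimes>\<^sub>R (std_rep \<otimes>\<^sub>R (std_rep \<otimes>\<^sub>R std_rep))) a *v q)
    = ((std_rep \<otimes>\<^sub>R std_rep) \<otimes>\<^sub>R (std_rep \<otimes>\<^sub>R std_rep)) a *v quadratic_part q" (is "?l q = ?r q")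
proof (rule linear_eq_tensor[where f="?l" and g="?r"])
  show "linear ?l" "linear ?r"
    using linear_compose[OF matrix_vector_mul_linear linear_quadratic_part]
      linear_compose[OF linear_quadratic_part matrix_vector_mul_linear] by (simp_all add: o_def)
  note c = orthogonal_matrix_cancel[OF assms]
  fix x y
  show "?l (tensor x y) = ?r (tensor x y)"
    by (rule curvature_map_eqI)
      (simp add: quadratic_part_tensor rep_tensor_tensor curvature_map_rep
        curvature_map_tensor[OF bilinear_quadratic] quadratic_def torsion_map_rep matrix_mult_simps
        matrix_mul_assoc c matrix_vector_mult_diff_distrib flip: matrix_vector_mul_assoc)
qed

lemma matrix_linear:
  fixes f :: "real^'n \<Rightarrow> real^'m"
  shows "linear f \<Longrightarrow> matrix f *v x = f x"
  by (rule matrix_works) (simp add: linear_matrix_vector_mul_eq)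

lemma curvature_map_bianchi_sum:
  "curvature_map (bianchi_sum R) u v *v z =
     curvature_map R u v *v z + curvature_map R v z *v u + curvature_map R z u *v v"
proof -
  let ?f = "\<lambda>u v z. curvature_map R u v *v z + curvature_map R v z *v u + curvature_map R z u *v v"
  have lin: "linear (?f u v)" for u v
    by (auto intro!: linearI simp: curvature_map_simps multilinear_simps algebra_simps)
  have "bilinear (\<lambda>u v. matrix (?f u v))"
    unfolding bilinear_def
    by (intro conjI allI linearI; unfold matrix_eq; simp only: matrix_vector_mult_add_rdistrib scaleR_matrix_vector_assoc[symmetric] matrix_linear[OF lin];
        simp add: matrix_vector_simps curvature_map_simps algebra_simps)
  from curvature_map_tensor[OF this] show ?thesis
    by (simp add: bianchi_sum_def matrix_linear[OF lin])
qed

lemma linear_bianchi_sum: "linear bianchi_sum"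
  by (rule linearI; rule curvature_map_eqI)
    (simp_all add: matrix_eq curvature_map_bianchi_sum curvature_map_simps matrix_vector_simps algebra_simps)

lemma bianchi_sum_rep:
  assumes "orthogonal_matrix a"
  shows "bianchi_sum (((std_rep \<otimes>\<^sub>R std_rep) \<otimes>\<^sub>R (std_rep \<otimes>\<^sub>R std_rep)) a *v R)
    = ((std_rep \<otimes>\<^sub>R std_rep) \<otimes>\<^sub>R (std_rep \<otimes>\<^sub>R std_rep)) a *v bianchi_sum R"
proof (rule curvature_map_eqI)
  fix u v
  show "curvature_map (bianchi_sum (((std_rep \<otimes>\<^sub>R std_rep) \<otimes>\<^sub>R (std_rep \<otimes>\<^sub>R std_rep)) a *v R)) u v
    = curvature_map (((std_rep \<otimes>\<^sub>R std_rep) \<otimes>\<^sub>R (std_rep \<otimes>\<^sub>R std_rep)) a *v bianchi_sum R) u v"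
    unfolding matrix_eq
    by (simp add: curvature_map_bianchi_sum curvature_map_rep matrix_vector_simps flip: matrix_vector_mul_assoc)
qed

lemma bianchi_map_eq_0_iff: "bianchi_map R = 0 \<longleftrightarrow> bianchi_sum R = 0"
proof -
  have "bianchi_sum R $ ((x, y), (j, z)) = bianchi_map R $ ((x, y, z), j)" for x y z j
  proof -
    have "bianchi_sum R $ ((x, y), (j, z)) = (curvature_map (bianchi_sum R) (axis x 1) (axis y 1) *v axis z 1) $ j"
      by (simp only: matrix_vector_mult_basis) (simp add: column_def curvature_map_axis)
    also have "\<dots> = bianchi_map R $ ((x, y, z), j)"
      unfolding curvature_map_bianchi_sum unfolding matrix_vector_mult_basis
      by (simp add: column_def curvature_map_axis bianchi_map_def)
    finally show ?thesis .
  qed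
  then show ?thesis by (auto simp: vec_eq_iff)
qed

lemma matrix_eq_inner:
  fixes A B :: "real^'n^'m"
  assumes "\<And>b c. b \<bullet> (A *v c) = b \<bullet> (B *v c)"
  shows "A = B"
  using assms vector_eq_rdot by (auto simp: matrix_eq inner_commute) (metis inner_commute vector_eq_rdot)

section \<open>The Ricci contraction and its equivariance\<close>

lemma trace_linear: "linear (trace :: real^'n^'n \<Rightarrow> real)"
  by (auto intro!: linearI simp: trace_def sum.distrib sum_distrib_left)

lemma linear_curvature_first: "linear (\<lambda>m. curvature_map R m b *v c)"
  by (auto intro!: linearI simp: curvature_map_simps matrix_vector_simps)

lemma ricci_matrix_inner:
  "b \<bullet> (ricci_matrix R *v c) = trace (matrix (\<lambda>m. curvature_map R m b *v c))"
proof -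
  let ?r = "\<lambda>b c. trace (matrix (\<lambda>m. curvature_map R m b *v c))"
  have lin: "linear (?r b)" "linear (\<lambda>b. ?r b c)" for b c
    by (auto intro!: linearI simp: trace_def matrix_def curvature_map_simps matrix_vector_simps
        sum.distrib sum_distrib_left)
  have lin': "linear (\<lambda>c. b \<bullet> (ricci_matrix R *v c))" "linear (\<lambda>b. b \<bullet> (ricci_matrix R *v c))" for b c
    by (auto intro!: linearI simp: matrix_vector_simps inner_add inner_commute)
  have "axis j 1 \<bullet> (ricci_matrix R *v axis k 1) = ?r (axis j 1) (axis k 1)" for j k
    by (simp add: inner_axis' matrix_vector_mult_basis column_def ricci_matrix_def)
  from linear_eq_axis[OF lin'(1) lin(1) this]
  have "axis j 1 \<bullet> (ricci_matrix R *v c) = ?r (axis j 1) c" for j .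
  from linear_eq_axis[OF lin'(2) lin(2) this] show ?thesis .
qed

lemma linear_ricci_matrix: "linear ricci_matrix"
  by (auto intro!: linearI simp: vec_eq_iff ricci_matrix_def trace_def matrix_def curvature_map_simps
      matrix_vector_simps sum.distrib sum_distrib_left)

lemma ricci_matrix_rep:
  assumes "orthogonal_matrix a"
  shows "ricci_matrix (((std_rep \<otimes>\<^sub>R std_rep) \<otimes>\<^sub>R (std_rep \<otimes>\<^sub>R std_rep)) a *v R) = a ** ricci_matrix R ** transpose a"
proof (rule matrix_eq_inner)
  fix b c
  let ?M = "matrix (\<lambda>m. curvature_map R m (transpose a *v b) *v (transpose a *v c))"
  have "matrix (\<lambda>m. curvature_map (((std_rep \<otimes>\<^sub>R std_rep) \<otimes>\<^sub>R (std_rep \<otimes>\<^sub>R std_rep)) a *v R) m b *v c)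
      = a ** (?M ** transpose a)"
    unfolding matrix_eq matrix_vector_mul_assoc[symmetric] matrix_linear[OF linear_curvature_first]
    by (simp add: curvature_map_rep flip: matrix_vector_mul_assoc)
  then have "b \<bullet> (ricci_matrix (((std_rep \<otimes>\<^sub>R std_rep) \<otimes>\<^sub>R (std_rep \<otimes>\<^sub>R std_rep)) a *v R) *v c) = trace (a ** (?M ** transpose a))"
    by (simp add: ricci_matrix_inner)
  also have "\<dots> = trace ?M"
    by (subst trace_mul_sym) (simp add: orthogonal_matrix_cancel[OF assms])
  also have "\<dots> = (transpose a *v b) \<bullet> (ricci_matrix R *v (transpose a *v c))"
    by (simp add: ricci_matrix_inner)
  also have "\<dots> = b \<bullet> ((a ** ricci_matrix R ** transpose a) *v c)"
    by (simp add: inner_transpose flip: matrix_vector_mul_assoc)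
  finally show "b \<bullet> (ricci_matrix (((std_rep \<otimes>\<^sub>R std_rep) \<otimes>\<^sub>R (std_rep \<otimes>\<^sub>R std_rep)) a *v R) *v c)
    = b \<bullet> ((a ** ricci_matrix R ** transpose a) *v c)" .
qed

lemma linear_sym_tracefree: "linear sym_tracefree"
  by (rule linearI)
    (simp_all add: sym_tracefree_def transpose_simps linear_add[OF trace_linear] linear_cmul[OF trace_linear]
      algebra_simps add_divide_distrib)

lemma sym_tracefree_conjugate:
  assumes "orthogonal_matrix a"
  shows "sym_tracefree (a ** M ** transpose a) = a ** sym_tracefree M ** transpose a"
proof -
  have "trace (a ** M ** transpose a) = trace M"
    by (subst trace_mul_sym) (simp add: orthogonal_matrix_cancel[OF assms] matrix_mul_assoc)
  then show ?thesis
    by (simp add: sym_tracefree_def matrix_mult_simps matrix_transpose_mul matrix_mul_assoc[symmetric]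
        orthogonal_matrix_cancel(2)[OF assms])
qed

lemma mat_tensor_sym_tracefree: "mat_tensor (sym_tracefree M) \<in> Sym2_0"
  unfolding Sym2_0_def
  by (auto simp: mat_tensor_def sym_tracefree_def transpose_def mat_def trace_def sum_subtractf
      sum_divide_distrib[symmetric] sum.distrib add.commute)

lemma linear_mat_tensor: "linear mat_tensor"
  by (auto intro!: linearI simp: vec_eq_iff mat_tensor_def)

lemma mat_tensor_conjugate: "mat_tensor (a ** M ** transpose a) = (std_rep \<otimes>\<^sub>R std_rep) a *v mat_tensor M"
  using unmat_rep[of a "mat_tensor M"] by (metis mat_tensor_unmat unmat_mat_tensor)

lemma Sym2_rep:
  assumes "\<And>x. x \<in> S \<Longrightarrow> \<rho> a *v x \<in> S" "z \<in> Sym2 S"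
  shows "(\<rho> \<otimes>\<^sub>R \<rho>) a *v z \<in> Sym2 S"
proof -
  have sym: "z $ (i, j) = z $ (j, i)" for i j using assms(2) by (simp add: Sym2_def)
  have "((\<rho> \<otimes>\<^sub>R \<rho>) a *v z) $ (i, j) = ((\<rho> \<otimes>\<^sub>R \<rho>) a *v z) $ (j, i)" for i j
  proof -
    have "((\<rho> \<otimes>\<^sub>R \<rho>) a *v z) $ (i, j) = (\<Sum>k\<in>UNIV. \<Sum>l\<in>UNIV. \<rho> a $ i $ k * \<rho> a $ j $ l * z $ (k, l))"
      by (simp add: matrix_vector_mult_def rep_tensor_def sum_UNIV_prod)
    also have "\<dots> = (\<Sum>l\<in>UNIV. \<Sum>k\<in>UNIV. \<rho> a $ j $ l * \<rho> a $ i $ k * z $ (l, k))"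
      by (subst sum.swap) (intro sum.cong refl, metis sym mult.commute)
    also have "\<dots> = ((\<rho> \<otimes>\<^sub>R \<rho>) a *v z) $ (j, i)"
      by (simp add: matrix_vector_mult_def rep_tensor_def sum_UNIV_prod)
    finally show ?thesis .
  qed
  moreover have "(\<rho> \<otimes>\<^sub>R \<rho>) a *v z \<in> S \<otimes>\<^sub>S S"
    by (rule tensor_space_rep) (use assms in \<open>auto simp: Sym2_def\<close>)
  ultimately show ?thesis by (simp add: Sym2_def)
qed

lemma subspace_Sym2: "subspace (Sym2 S)"
  using subspace_tensor_space[of S S] by (auto simp: Sym2_def subspace_def)

lemma tensor_in_Sym2: "x \<in> S \<Longrightarrow> tensor x x \<in> Sym2 S"
  by (auto simp: Sym2_def tensor_space_def tensor_def intro!: span_base)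

text \<open>The purely algebraic form of the theorem at one point. The tensor of \<open>K\<close>
  lies in the kernel of the Bianchi sum, so \<open>equivariant_vanishing\<close> kills the
  trace-free symmetric part of its Ricci contraction; as that contraction is symmetric, only a
  multiple of the identity remains.\<close>

proposition ricci_of_decomposition:
  fixes G :: "(real^'n::finite^'n) set" and \<gg> :: "(real^'n^'n) set"
  assumes G: "\<And>a. a \<in> G \<Longrightarrow> orthogonal_matrix a" "\<And>a. a \<in> G \<Longrightarrow> transpose a \<in> G"
    and \<gg>: "subspace \<gg>" "\<And>a A. a \<in> G \<Longrightarrow> A \<in> \<gg> \<Longrightarrow> a ** A ** transpose a \<in> \<gg>"
    and W: "subspace W" "\<And>a x. a \<in> G \<Longrightarrow> x \<in> W \<Longrightarrow> (std_rep \<otimes>\<^sub>R (std_rep \<otimes>\<^sub>R std_rep)) a *v x \<in> W"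
    and inv: "invariants G ((std_rep \<otimes>\<^sub>R (std_rep \<otimes>\<^sub>R (std_rep \<otimes>\<^sub>R std_rep))) \<otimes>\<^sub>R (std_rep \<otimes>\<^sub>R std_rep))
           ((UNIV \<otimes>\<^sub>S W) \<otimes>\<^sub>S Sym2_0) = {0}"
      "invariants G (((std_rep \<otimes>\<^sub>R (std_rep \<otimes>\<^sub>R std_rep)) \<otimes>\<^sub>R (std_rep \<otimes>\<^sub>R (std_rep \<otimes>\<^sub>R std_rep)))
             \<otimes>\<^sub>R (std_rep \<otimes>\<^sub>R std_rep)) (Sym2 W \<otimes>\<^sub>S Sym2_0) = {0}"
      "invariants G (((std_rep \<otimes>\<^sub>R std_rep) \<otimes>\<^sub>R (std_rep \<otimes>\<^sub>R std_rep)) \<otimes>\<^sub>R (std_rep \<otimes>\<^sub>R std_rep))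
           (curvature_space \<gg> \<otimes>\<^sub>S Sym2_0) = {0}"
    and K: "bilinear K" "\<And>u v. transpose (K u v) = - K u v"
      "\<And>u v w. K u v *v w + K v w *v u + K w u *v v = 0"
    and R: "bilinear R" "\<And>u v. R u v \<in> \<gg>" "\<And>u v. R u v = - R v u"
    and \<xi>: "\<xi> \<in> W" and X: "X \<in> UNIV \<otimes>\<^sub>S W"
    and decomp: "\<And>u v. K u v = R u v + (torsion_map (contract X u) v - torsion_map (contract X v) u)
       + quadratic \<xi> \<xi> u v"
  shows "\<exists>s. \<forall>b c. trace (matrix (\<lambda>m. K m b *v c)) = s * (b \<bullet> c)"
proof -
  let ?\<tau> = "(std_rep \<otimes>\<^sub>R std_rep) \<otimes>\<^sub>R (std_rep \<otimes>\<^sub>R std_rep) :: real^'n^'n \<Rightarrow> _"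
  let ?Y = "Lambda2 \<otimes>\<^sub>S (mat_tensor ` \<gg>)"
  define r where "r = (\<lambda>T :: real^(('n \<times> 'n) \<times> ('n \<times> 'n)). mat_tensor (sym_tracefree (ricci_matrix T)))"
  define T where "T = curvature_tensor R + skew_part X + quadratic_part (tensor \<xi> \<xi>)"
  have std: "orth_rep G std_rep" by (rule orth_rep_std) (use G in auto)
  have TK: "curvature_map T u v = K u v" for u v
    by (simp add: T_def curvature_map_simps curvature_map_tensor[OF R(1)] curvature_map_skew_part
        quadratic_part_tensor curvature_map_tensor[OF bilinear_quadratic] decomp)
  have linr: "linear r" unfolding r_def
    using linear_compose[OF linear_compose[OF linear_ricci_matrix linear_sym_tracefree] linear_mat_tensor]
    by (simp add: o_def)
  have "r T = 0" unfolding T_def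
  proof (rule equivariant_vanishing[where b=bianchi_sum and Y="?Y" and S\<^sub>1="UNIV \<otimes>\<^sub>S W" and S\<^sub>2="Sym2 W"
        and T=Sym2_0 and \<sigma>="std_rep \<otimes>\<^sub>R std_rep" and \<tau>="?\<tau>"
        and \<rho>\<^sub>1="std_rep \<otimes>\<^sub>R (std_rep \<otimes>\<^sub>R (std_rep \<otimes>\<^sub>R std_rep))"
        and \<rho>\<^sub>2="(std_rep \<otimes>\<^sub>R (std_rep \<otimes>\<^sub>R std_rep)) \<otimes>\<^sub>R (std_rep \<otimes>\<^sub>R (std_rep \<otimes>\<^sub>R std_rep))"])
    show "r (?\<tau> a *v z) = (std_rep \<otimes>\<^sub>R std_rep) a *v r z" if "a \<in> G" for a z
      by (simp add: r_def ricci_matrix_rep[OF G(1)[OF that]] sym_tracefree_conjugate[OF G(1)[OF that]] mat_tensor_conjugate)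
    show "?\<tau> a *v x \<in> ?Y" if "a \<in> G" "x \<in> ?Y" for a x
    proof (rule tensor_space_rep[OF _ _ that(2)])
      show "(std_rep \<otimes>\<^sub>R std_rep) a *v x \<in> Lambda2" if "x \<in> Lambda2" for x
        using that by (rule Lambda2_rep)
      show "(std_rep \<otimes>\<^sub>R std_rep) a *v x \<in> mat_tensor ` \<gg>" if "x \<in> mat_tensor ` \<gg>" for x
        using that \<gg>(2)[OF \<open>a \<in> G\<close>] by (auto simp flip: mat_tensor_conjugate)
    qed
    show "(std_rep \<otimes>\<^sub>R (std_rep \<otimes>\<^sub>R (std_rep \<otimes>\<^sub>R std_rep))) a *v x \<in> UNIV \<otimes>\<^sub>S W"
      if "a \<in> G" "x \<in> UNIV \<otimes>\<^sub>S W" for a x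
      by (rule tensor_space_rep[OF _ _ that(2)]) (use W(2)[OF that(1)] in auto)
    show "((std_rep \<otimes>\<^sub>R (std_rep \<otimes>\<^sub>R std_rep)) \<otimes>\<^sub>R (std_rep \<otimes>\<^sub>R (std_rep \<otimes>\<^sub>R std_rep))) a *v x \<in> Sym2 W"
      if "a \<in> G" "x \<in> Sym2 W" for a x
      by (rule Sym2_rep[OF _ that(2)]) (use W(2)[OF that(1)] in auto)
    show "invariants G (?\<tau> \<otimes>\<^sub>R (std_rep \<otimes>\<^sub>R std_rep)) ({y \<in> ?Y. bianchi_sum y = 0} \<otimes>\<^sub>S Sym2_0) = {0}"
      using inv(3) unfolding curvature_space_def bianchi_map_eq_0_iff .
    show "curvature_tensor R \<in> ?Y"
      unfolding Lambda2_tensor_iff[OF \<gg>(1)] curvature_map_tensor[OF R(1)] using R(2,3) by blast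
    show "bianchi_sum (curvature_tensor R + skew_part X + quadratic_part (tensor \<xi> \<xi>)) = 0"
      unfolding T_def[symmetric]
      by (rule curvature_map_eqI)
        (simp add: matrix_eq curvature_map_bianchi_sum TK K(3) linear_0[OF linear_curvature_map])
    show "r z \<in> Sym2_0" for z unfolding r_def by (rule mat_tensor_sym_tracefree)
  qed (use std linr inv(1,2) G(1) \<xi> X in \<open>auto intro: orth_rep_tensor linear_bianchi_sum bianchi_sum_rep linear_skew_part
        skew_part_rep linear_quadratic_part quadratic_part_rep subspace_tensor_space subspace_Sym2 tensor_in_Sym2\<close>)
  then have "unmat (r T) = 0" by (simp add: unmat_simps)
  then have st: "sym_tracefree (ricci_matrix T) = 0" by (simp add: r_def)
  have ric: "b \<bullet> (ricci_matrix T *v c) = trace (matrix (\<lambda>m. K m b *v c))" for b c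
    by (simp add: ricci_matrix_inner TK)
  have linK: "linear (\<lambda>m. K m b *v c)" for b c
    using linear_curvature_first[of T] by (simp add: TK)
  \<comment> \<open>By the first Bianchi identity the skew part of the Ricci contraction is the
    trace of \<open>K b c\<close>, which is zero since \<open>K b c\<close> is a skew
    matrix.\<close>
  have "transpose (ricci_matrix T) = ricci_matrix T"
  proof (rule matrix_eq_inner)
    fix b c
    have "K m b *v c = K m c *v b - K b c *v m" for m
    proof -
      \<comment> \<open>Antisymmetry in the first two arguments is read off the decomposition, each
        of whose three summands has it.\<close>
      have "K c m = - K m c"
        unfolding decomp[of c m] decomp[of m c] R(3)[of c m]
        by (simp add: quadratic_def torsion_map_simps algebra_simps)
      then have "K c m *v b = - (K m c *v b)" by (simp add: matrix_vector_simps)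
      with K(3)[of m b c] show ?thesis by (simp add: algebra_simps)
    qed
    then have "matrix (\<lambda>m. K m b *v c) = matrix (\<lambda>m. K m c *v b) - K b c"
      unfolding matrix_eq matrix_vector_mult_diff_rdistrib matrix_linear[OF linK] by blast
    moreover have "trace (K b c) = 0"
    proof -
      have "trace (transpose (K b c)) = trace (K b c)" by (simp add: trace_def transpose_def)
      then show ?thesis using K(2)[of b c] linear_neg[OF trace_linear, of "K b c"] by simp
    qed
    ultimately have "trace (matrix (\<lambda>m. K m b *v c)) = trace (matrix (\<lambda>m. K m c *v b))"
      by (simp add: trace_sub)
    then have "b \<bullet> (ricci_matrix T *v c) = c \<bullet> (ricci_matrix T *v b)" by (simp add: ric)
    then show "b \<bullet> (transpose (ricci_matrix T) *v c) = b \<bullet> (ricci_matrix T *v c)"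
      by (metis inner_commute inner_transpose)
  qed
  with st have "ricci_matrix T = (trace (ricci_matrix T) / CARD('n)) *\<^sub>R mat 1"
    by (simp add: sym_tracefree_def flip: scaleR_2)
  then obtain s where "ricci_matrix T = s *\<^sub>R mat 1" by blast
  then have "b \<bullet> (ricci_matrix T *v c) = s * (b \<bullet> c)" for b c by (simp add: matrix_vector_simps)
  then show ?thesis unfolding ric by blast
qed

section \<open>The Lie algebra of a Lie subgroup\<close>

text \<open>The linear map \<open>y - orth_proj S y\<close> is zero along \<open>f\<close>, so it is
  zero on the derivative as well.\<close>

lemma has_derivative_in_subspace:
  fixes f :: "'a::real_normed_vector \<Rightarrow> 'b::euclidean_space"
  assumes "subspace S" "open T" "x \<in> T" "\<And>y. y \<in> T \<Longrightarrow> f y \<in> S" "(f has_derivative D) (at x)"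
  shows "D v \<in> S"
proof -
  let ?L = "\<lambda>y. y - orth_proj S y"
  have "linear ?L"
    using linear_orth_proj[OF assms(1)] by (simp add: linear_compose_sub linear_id[unfolded id_def])
  then have "bounded_linear ?L" by (simp add: linear_conv_bounded_linear)
  from bounded_linear.has_derivative[OF this assms(5)]
  have "((\<lambda>y. 0) has_derivative (\<lambda>v. ?L (D v))) (at x)"
    by (rule has_derivative_transform_within_open[OF _ assms(2,3)])
      (simp add: orth_proj_id[OF assms(1)] assms(4))
  then have "(\<lambda>v. ?L (D v)) = (\<lambda>v. 0)"
    by (rule has_derivative_unique) (rule has_derivative_const)
  then have "D v = orth_proj S (D v)" by (metis eq_iff_diff_eq_0)
  then show ?thesis using orth_proj(1)[OF assms(1)] by metis
qed

lemma has_vector_derivative_in_subspace: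
  fixes f :: "real \<Rightarrow> 'b::euclidean_space"
  assumes "subspace S" "open T" "x \<in> T" "\<And>y. y \<in> T \<Longrightarrow> f y \<in> S" "(f has_vector_derivative D) (at x)"
  shows "D \<in> S"
  using has_derivative_in_subspace[OF assms(1-4) assms(5)[unfolded has_vector_derivative_def], of 1] by simp

lemmas has_vector_derivative_matrix_mult =
  bounded_bilinear.has_vector_derivative[OF bounded_bilinear_matrix_mult]
lemmas has_vector_derivative_transpose =
  bounded_linear.has_vector_derivative[OF bounded_linear_transpose]

text \<open>Only the group structure is fixed here: the facts about the Lie algebra in this context
  come directly from curves. The manifold structure enters with \<open>lie_subgroup\<close>.\<close>

locale matrix_group =
  fixes G :: "(real^'n::finite^'n) set"
  assumes orth: "\<And>a. a \<in> G \<Longrightarrow> orthogonal_matrix a"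
    and one_mem: "mat 1 \<in> G"
    and mult_mem: "\<And>a b. a \<in> G \<Longrightarrow> b \<in> G \<Longrightarrow> a ** b \<in> G"
    and transpose_mem: "\<And>a. a \<in> G \<Longrightarrow> transpose a \<in> G"
begin

lemma lie_algebraE:
  assumes "A \<in> lie_algebra G"
  obtains \<gamma> e where "0 < e" "smooth_on {-e<..<e} \<gamma>" "\<And>t. t \<in> {-e<..<e} \<Longrightarrow> \<gamma> t \<in> G"
    "\<gamma> 0 = mat 1" "(\<gamma> has_vector_derivative A) (at 0)"
  using assms unfolding lie_algebra_def by blast

lemma lie_algebraI:
  assumes "0 < e" "smooth_on {-e<..<e} \<gamma>" "\<And>t. t \<in> {-e<..<e} \<Longrightarrow> \<gamma> t \<in> G"
    "\<gamma> 0 = mat 1" "(\<gamma> has_vector_derivative A) (at 0)"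
  shows "A \<in> lie_algebra G"
  unfolding lie_algebra_def using assms by blast

text \<open>Sums are velocities of products of curves, multiples are velocities of
  \<open>\<gamma> (c * t)\<close>; for the latter the interval is rescaled by the absolute value of
  \<open>c\<close>, which is why \<open>c = 0\<close> is treated apart.\<close>

lemma subspace_lie_algebra: "subspace (lie_algebra G)"
proof (rule subspaceI)
  show zero: "0 \<in> lie_algebra G"
    by (rule lie_algebraI[of 1 "\<lambda>t. mat 1"]) (auto simp: one_mem smooth_on_const)
  fix A assume "A \<in> lie_algebra G"
  then obtain \<gamma> e where \<gamma>: "0 < e" "smooth_on {-e<..<e} \<gamma>" "\<And>t. t \<in> {-e<..<e} \<Longrightarrow> \<gamma> t \<in> G"
    "\<gamma> 0 = mat 1" "(\<gamma> has_vector_derivative A) (at 0)" using lie_algebraE by metis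
  show "c *\<^sub>R A \<in> lie_algebra G" for c
  proof (cases "c = 0")
    case False
    have in_e: "c * t \<in> {-e<..<e}" if "t \<in> {-(e/\<bar>c\<bar>)<..<e/\<bar>c\<bar>}" for t
    proof -
      have "\<bar>t\<bar> < e / \<bar>c\<bar>" using that by auto
      then have "\<bar>c * t\<bar> < e" using False by (simp add: abs_mult field_simps)
      then show ?thesis by auto
    qed
    show ?thesis
    proof (rule lie_algebraI[of "e / \<bar>c\<bar>" "\<lambda>t. \<gamma> (c * t)"])
      show "0 < e / \<bar>c\<bar>" using \<gamma>(1) False by simp
      show "smooth_on {- (e / \<bar>c\<bar>)<..<e / \<bar>c\<bar>} (\<lambda>t. \<gamma> (c * t))"
        by (rule smooth_on_compose[OF \<gamma>(2) smooth_on_linear]) (use in_e in \<open>auto intro: bounded_linear_mult_right\<close>)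
      have "((\<lambda>t. c * t) has_vector_derivative c) (at 0)"
        by (auto intro!: derivative_eq_intros)
      from vector_diff_chain_at[OF this, of \<gamma> A] \<gamma>(5)
      show "((\<lambda>t. \<gamma> (c * t)) has_vector_derivative c *\<^sub>R A) (at 0)" by (simp add: o_def)
    qed (use \<gamma> in_e in auto)
  qed (simp add: zero)
  fix B assume "B \<in> lie_algebra G"
  then obtain \<delta> d where \<delta>: "0 < d" "smooth_on {-d<..<d} \<delta>" "\<And>t. t \<in> {-d<..<d} \<Longrightarrow> \<delta> t \<in> G"
    "\<delta> 0 = mat 1" "(\<delta> has_vector_derivative B) (at 0)" using lie_algebraE by metis
  show "A + B \<in> lie_algebra G"
  proof (rule lie_algebraI[of "min e d" "\<lambda>t. \<gamma> t ** \<delta> t"])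
    show "smooth_on {- min e d<..<min e d} (\<lambda>t. \<gamma> t ** \<delta> t)"
      by (intro smooth_on_bilinear[OF bounded_bilinear_matrix_mult] smooth_on_subset[OF \<gamma>(2)] smooth_on_subset[OF \<delta>(2)]) auto
    show "((\<lambda>t. \<gamma> t ** \<delta> t) has_vector_derivative A + B) (at 0)"
      using has_vector_derivative_matrix_mult[OF \<gamma>(5) \<delta>(5)] by (simp add: \<gamma> \<delta> add.commute)
  qed (use \<gamma> \<delta> mult_mem in auto)
qed

lemma lie_algebra_conjugate:
  assumes a: "a \<in> G" and A: "A \<in> lie_algebra G"
  shows "a ** A ** transpose a \<in> lie_algebra G"
proof -
  obtain \<gamma> e where \<gamma>: "0 < e" "smooth_on {-e<..<e} \<gamma>" "\<And>t. t \<in> {-e<..<e} \<Longrightarrow> \<gamma> t \<in> G"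
    "\<gamma> 0 = mat 1" "(\<gamma> has_vector_derivative A) (at 0)" using A lie_algebraE by metis
  show ?thesis
  proof (rule lie_algebraI[of e "\<lambda>t. a ** \<gamma> t ** transpose a"])
    show "smooth_on {-e<..<e} (\<lambda>t. a ** \<gamma> t ** transpose a)"
      by (intro smooth_on_bilinear[OF bounded_bilinear_matrix_mult] smooth_on_const \<gamma>)
    show "((\<lambda>t. a ** \<gamma> t ** transpose a) has_vector_derivative a ** A ** transpose a) (at 0)"
      using has_vector_derivative_matrix_mult[OF has_vector_derivative_matrix_mult[OF has_vector_derivative_const[of a] \<gamma>(5)]
          has_vector_derivative_const[of "transpose a"]]
      by (simp add: matrix_mult_simps)
    show "a ** \<gamma> 0 ** transpose a = mat 1"
      using orthogonal_matrix_cancel[OF orth[OF a]] by (simp add: \<gamma>)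
  qed (use \<gamma> mult_mem transpose_mem a in auto)
qed

lemma lie_algebra_skew: "A \<in> lie_algebra G \<Longrightarrow> transpose A = - A"
proof -
  assume "A \<in> lie_algebra G"
  then obtain \<gamma> e where \<gamma>: "0 < e" "\<And>t. t \<in> {-e<..<e} \<Longrightarrow> \<gamma> t \<in> G"
    "\<gamma> 0 = mat 1" "(\<gamma> has_vector_derivative A) (at 0)" using lie_algebraE by metis
  have "((\<lambda>t. transpose (\<gamma> t) ** \<gamma> t) has_vector_derivative A + transpose A) (at 0)"
    using has_vector_derivative_matrix_mult[OF has_vector_derivative_transpose[OF \<gamma>(4)] \<gamma>(4)]
    by (simp add: \<gamma>)
  then have "((\<lambda>t. mat 1) has_vector_derivative A + transpose A) (at 0)"
    by (rule has_vector_derivative_transform_within_open[of _ _ _ "{-e<..<e}"])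
      (use \<gamma> orth in \<open>auto simp: orthogonal_matrix\<close>)
  then have "A + transpose A = 0"
    using vector_derivative_unique_at has_vector_derivative_const by blast
  then show ?thesis by (simp add: eq_neg_iff_add_eq_0 add.commute)
qed

lemma lie_algebra_subset_so: "lie_algebra G \<subseteq> so_algebra"
  using lie_algebra_skew by (auto simp: so_algebra_def)

text \<open>The commutator is the derivative at 0 of the conjugates
  \<open>\<gamma> t ** B ** transpose (\<gamma> t)\<close>, which form a curve inside the linear
  space \<open>lie_algebra G\<close>.\<close>

lemma lie_algebra_bracket:
  assumes A: "A \<in> lie_algebra G" and B: "B \<in> lie_algebra G"
  shows "A ** B - B ** A \<in> lie_algebra G"
proof -
  obtain \<gamma> e where \<gamma>: "0 < e" "\<And>t. t \<in> {-e<..<e} \<Longrightarrow> \<gamma> t \<in> G"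
    "\<gamma> 0 = mat 1" "(\<gamma> has_vector_derivative A) (at 0)" using A lie_algebraE by metis
  have "((\<lambda>t. \<gamma> t ** B ** transpose (\<gamma> t)) has_vector_derivative A ** B - B ** A) (at 0)"
    using has_vector_derivative_matrix_mult[OF has_vector_derivative_matrix_mult[OF \<gamma>(4) has_vector_derivative_const[of B]]
        has_vector_derivative_transpose[OF \<gamma>(4)]]
    by (simp add: \<gamma> lie_algebra_skew[OF A] matrix_mult_simps)
  from has_vector_derivative_in_subspace[OF subspace_lie_algebra _ _ _ this, of "{-e<..<e}"]
  show ?thesis using \<gamma> lie_algebra_conjugate[OF _ B] by auto
qed

text \<open>The displayed tensor is the velocity at time 0 of the orbit of \<open>x\<close> under a
  curve in \<open>G\<close> with velocity \<open>A\<close>, and the orbit never leaves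
  \<open>W\<close>. It makes covariant derivatives of W-valued functions W-valued.\<close>

lemma infinitesimal_action:
  assumes W: "subspace W" "\<And>a x. a \<in> G \<Longrightarrow> x \<in> W \<Longrightarrow> (std_rep \<otimes>\<^sub>R (std_rep \<otimes>\<^sub>R std_rep)) a *v x \<in> W"
    and A: "A \<in> lie_algebra G" and x: "x \<in> W"
  shows "torsion_tensor (\<lambda>u. A ** torsion_map x u - torsion_map x u ** A - torsion_map x (A *v u)) \<in> W"
proof -
  obtain \<gamma> e where \<gamma>: "0 < e" "\<And>t. t \<in> {-e<..<e} \<Longrightarrow> \<gamma> t \<in> G"
    "\<gamma> 0 = mat 1" "(\<gamma> has_vector_derivative A) (at 0)" using A lie_algebraE by metis
  let ?X = "torsion_map x"
  let ?y = "\<lambda>t. torsion_tensor (\<lambda>u. \<gamma> t ** ?X (transpose (\<gamma> t) *v u) ** transpose (\<gamma> t))"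
  have blX: "bounded_linear ?X"
    using bilinear_torsion_map by (auto simp: bilinear_def linear_conv_bounded_linear)
  have y: "?y t = (std_rep \<otimes>\<^sub>R (std_rep \<otimes>\<^sub>R std_rep)) (\<gamma> t) *v x" for t
    by (rule torsion_map_eqI, subst torsion_map_tensor)
      (auto intro!: linearI simp: torsion_map_rep multilinear_simps torsion_map_simps)
  have d: "((\<lambda>t. \<gamma> t ** ?X (transpose (\<gamma> t) *v u) ** transpose (\<gamma> t)) has_vector_derivative
      A ** ?X u - ?X u ** A - ?X (A *v u)) (at 0)" for u
  proof -
    have "((\<lambda>t. transpose (\<gamma> t) *v u) has_vector_derivative transpose A *v u) (at 0)"
      using bounded_bilinear.has_vector_derivative[OF bounded_bilinear_matrix_vector
          has_vector_derivative_transpose[OF \<gamma>(4)] has_vector_derivative_const[of u]]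
      by (simp add: matrix_vector_simps)
    from has_vector_derivative_matrix_mult[OF has_vector_derivative_matrix_mult[OF \<gamma>(4)
          bounded_linear.has_vector_derivative[OF blX this]] has_vector_derivative_transpose[OF \<gamma>(4)]]
    show ?thesis
      by (rule has_vector_derivative_eq_rhs)
        (simp add: \<gamma> lie_algebra_skew[OF A] matrix_mult_simps matrix_vector_simps torsion_map_simps
          linear_neg[OF bounded_linear.linear[OF blX]])
  qed
  have "(?y has_vector_derivative torsion_tensor (\<lambda>u. A ** ?X u - ?X u ** A - ?X (A *v u))) (at 0)"
    unfolding torsion_tensor_sum
  proof (rule has_vector_derivative_sum)
    fix i :: 'n
    have "linear (\<lambda>M. tensor (axis i (1::real)) (mat_tensor (M :: real^'n^'n)))"
      by (auto intro!: linearI simp: vec_eq_iff tensor_def mat_tensor_def algebra_simps)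
    then have "bounded_linear (\<lambda>M. tensor (axis i (1::real)) (mat_tensor (M :: real^'n^'n)))"
      by (simp add: linear_conv_bounded_linear)
    from bounded_linear.has_vector_derivative[OF this d[of "axis i 1"]]
    show "((\<lambda>t. tensor (axis i 1) (mat_tensor (\<gamma> t ** ?X (transpose (\<gamma> t) *v axis i 1) ** transpose (\<gamma> t))))
        has_vector_derivative
        tensor (axis i 1) (mat_tensor (A ** ?X (axis i 1) - ?X (axis i 1) ** A - ?X (A *v axis i 1)))) (at 0)" .
  qed
  from has_vector_derivative_in_subspace[OF W(1) _ _ _ this, of "{-e<..<e}"]
  show ?thesis using \<gamma> W(2)[OF _ x] by (auto simp: y)
qed

text \<open>Right translation by the inverse of \<open>\<gamma> t\<close>, together with a shift of
  time, turns the curve into one through the identity.\<close>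

lemma lie_algebra_curve:
  assumes "open I" "t \<in> I" "smooth_on I \<gamma>" "\<And>s. s \<in> I \<Longrightarrow> \<gamma> s \<in> G" "(\<gamma> has_vector_derivative D) (at t)"
  shows "D ** transpose (\<gamma> t) \<in> lie_algebra G"
proof -
  obtain e where e: "e > 0" "ball t e \<subseteq> I" using assms open_contains_ball by blast
  have I: "t + s \<in> I" if "s \<in> {-e<..<e}" for s
    using e(2) that by (auto simp: subset_iff dist_real_def)
  have t: "\<gamma> t \<in> G" using assms by blast
  show ?thesis
  proof (rule lie_algebraI[of e "\<lambda>s. \<gamma> (t + s) ** transpose (\<gamma> t)"])
    have "smooth_on {-e<..<e} (\<lambda>s. t + s)"
      by (intro smooth_on_add smooth_on_const smooth_on_linear bounded_linear_ident)
    moreover have "(\<lambda>s. t + s) ` {-e<..<e} \<subseteq> I" using I by auto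
    ultimately have "smooth_on {-e<..<e} (\<lambda>s. \<gamma> (t + s))" by (rule smooth_on_compose[OF assms(3)])
    then show "smooth_on {-e<..<e} (\<lambda>s. \<gamma> (t + s) ** transpose (\<gamma> t))"
      by (intro smooth_on_bilinear[OF bounded_bilinear_matrix_mult] smooth_on_const)
    have "((\<lambda>s. t + s) has_vector_derivative 1) (at 0)" by (auto intro!: derivative_eq_intros)
    from vector_diff_chain_at[OF this, of \<gamma> D] assms(5)
    have "((\<lambda>s. \<gamma> (t + s)) has_vector_derivative D) (at 0)" by (simp add: o_def)
    from has_vector_derivative_matrix_mult[OF this has_vector_derivative_const[of "transpose (\<gamma> t)"]]
    show "((\<lambda>s. \<gamma> (t + s) ** transpose (\<gamma> t)) has_vector_derivative D ** transpose (\<gamma> t)) (at 0)"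
      by (simp add: matrix_mult_simps)
    show "\<gamma> (t + 0) ** transpose (\<gamma> t) = mat 1" using orth[OF t] by (simp add: orthogonal_matrix_def)
  qed (use e I assms(4) t mult_mem transpose_mem in auto)
qed

end

section \<open>Slice charts from the inverse function theorem\<close>

lemma smooth_inverse_function:
  fixes f :: "'a::euclidean_space \<Rightarrow> 'a"
  assumes U: "open U" "x0 \<in> U" and f: "smooth_on U f" and inj: "\<And>v. dir_deriv f x0 v = 0 \<Longrightarrow> v = 0"
  obtains U' V g where "open U'" "U' \<subseteq> U" "x0 \<in> U'" "open V" "f x0 \<in> V" "homeomorphism U' V f g"
    "\<And>y. y \<in> V \<Longrightarrow> g differentiable (at y)"
proof -
  have bl: "bounded_linear (dir_deriv f x)" if "x \<in> U" for x
    using smooth_on_has_derivative[OF f that] has_derivative_bounded_linear by blast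
  define f' where "f' = (\<lambda>x. Blinfun (dir_deriv f x))"
  have f': "blinfun_apply (f' x) = dir_deriv f x" if "x \<in> U" for x
    unfolding f'_def using bl[OF that] by (rule bounded_linear_Blinfun_apply)
  have lin: "linear (dir_deriv f x0)" using bl[OF U(2)] by (rule bounded_linear.linear)
  have "inj (dir_deriv f x0)" using linear_injective_0[OF lin] inj by blast
  then obtain h where h: "linear h" "h \<circ> dir_deriv f x0 = id"
    using linear_injective_left_inverse[OF lin] by blast
  have "bounded_linear h" using h(1) by (simp add: linear_conv_bounded_linear)
  then have hB: "blinfun_apply (Blinfun h) = h" by (rule bounded_linear_Blinfun_apply)
  show ?thesis
  proof (rule inverse_function_theorem[OF U(1), of f f' x0 "Blinfun h"])
    show "(f has_derivative blinfun_apply (f' x)) (at x)" if "x \<in> U" for x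
      unfolding f'[OF that] by (rule smooth_on_has_derivative[OF f that])
    show "continuous_on U f'"
    proof (rule continuous_on_blinfun_componentwise)
      fix i :: 'a
      show "continuous_on U (\<lambda>x. blinfun_apply (f' x) i)"
        using smooth_on_continuous_on[OF smooth_on_dir_deriv[OF U(1) f, of i]]
        by (rule continuous_on_eq) (simp add: f')
    qed
    show "Blinfun h o\<^sub>L f' x0 = id_blinfun"
      by (rule blinfun_eqI) (use h(2) in \<open>simp add: hB f'[OF U(2)] o_def id_def fun_eq_iff\<close>)
    fix U' V g g'
    assume "open U'" "U' \<subseteq> U" "x0 \<in> U'" "open V" "f x0 \<in> V" "homeomorphism U' V f g"
      and "\<And>y. y \<in> V \<Longrightarrow> (g has_derivative g' y) (at y)"
    then show thesis by (intro that[of U' V g]) (auto simp: differentiable_def)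
  qed (use U in auto)
qed

text \<open>The immersion \<open>F\<close> on \<open>E\<close> is completed to a local
  diffeomorphism sending z to \<open>F (\<pi> z) ** (mat 1 + \<sigma> z)\<close>, where \<pi>
  projects to \<open>E\<close> and \<sigma> carries the complement of \<open>E\<close> to the normal
  space of the tangent space at the identity. \<open>X\<close> and \<open>Y\<close> are the
  resulting coordinates along and across the image. The product form, instead of a sum, suits
  equations h' = B h, since velocities along the image can be compared by conjugation with
  \<open>F (X y)\<close>.\<close>

lemma slice_chart:
  fixes F :: "real^'n::finite^'n \<Rightarrow> real^'n^'n"
  assumes E: "subspace E" and T: "open T" "x0 \<in> T" "x0 \<in> E"
    and F: "smooth_on T F" "F x0 = mat 1" and inj: "\<And>v. v \<in> E \<Longrightarrow> dir_deriv F x0 v = 0 \<Longrightarrow> v = 0"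
  obtains V X Y d where "open V" "mat 1 \<in> V"
    "\<And>y. y \<in> V \<Longrightarrow> X differentiable (at y)" "\<And>y. y \<in> V \<Longrightarrow> Y differentiable (at y)"
    "\<And>y. y \<in> V \<Longrightarrow> X y \<in> E \<and> X y \<in> T" "\<And>y v. y \<in> V \<Longrightarrow> v \<in> E \<Longrightarrow> dir_deriv F x0 v \<bullet> Y y = 0"
    "\<And>y. y \<in> V \<Longrightarrow> y = F (X y) ** (mat 1 + Y y)" "Y (mat 1) = 0" "d > 0"
    "\<And>x. x \<in> E \<Longrightarrow> dist x x0 < d \<Longrightarrow> F x \<in> V \<and> X (F x) = x"
proof -
  let ?\<pi> = "orth_proj E"
  let ?D = "dir_deriv F x0"
  have linD: "linear ?D" using has_derivative_linear[OF smooth_on_has_derivative[OF F(1) T(2)]] .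
  have lin\<pi>: "linear ?\<pi>" by (rule linear_orth_proj[OF E])
  have id\<pi>: "?\<pi> x = x" if "x \<in> E" for x using orth_proj_id[OF E that] .
  have sD: "subspace (?D ` E)" using linear_subspace_image[OF linD E] .
  define E' where "E' = {y. \<forall>x\<in>E. orthogonal x y}"
  define N where "N = {y. \<forall>x\<in>?D ` E. orthogonal x y}"
  have sub: "subspace E'" "subspace N" unfolding E'_def N_def
    by (rule subspace_orthogonal_to_vectors)+
  have "inj_on ?D E"
  proof (rule inj_onI)
    fix x y assume xy: "x \<in> E" "y \<in> E" "?D x = ?D y"
    then have "?D (x - y) = 0" by (simp add: linear_diff[OF linD])
    then show "x = y" using inj[OF subspace_diff[OF E xy(1,2)]] by simp
  qed
  then have "dim (?D ` E) = dim E"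
    using dim_image_eq[OF linD, of E] E by (simp add: span_eq_iff[THEN iffD2])
  moreover have "dim E' + dim E = DIM(real^'n^'n)" "dim N + dim (?D ` E) = DIM(real^'n^'n)"
    using dim_subspace_orthogonal_to_vectors[OF E subspace_UNIV] dim_subspace_orthogonal_to_vectors[OF sD subspace_UNIV]
    unfolding E'_def N_def by (simp_all only: subset_UNIV dim_UNIV UNIV_I simp_thms mem_Collect_eq)
  ultimately have "dim E' = dim N" by simp
  \<comment> \<open>Injectivity of \<open>?D\<close> on \<open>E\<close> makes the two orthogonal
    complements equidimensional. An isometry between them supplies the transverse directions, and
    preservation of norms gives its injectivity.\<close>
  then obtain f where f: "linear f" "f ` E' = N" "\<And>x. x \<in> E' \<Longrightarrow> norm (f x) = norm x"
    using isometries_subspaces[OF sub] by metis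
  define \<sigma> where "\<sigma> = (\<lambda>z. f (z - ?\<pi> z))"
  have \<pi>': "z - ?\<pi> z \<in> E'" for z
    unfolding E'_def using orth_proj(2)[OF E, of _ z] by (auto simp: orthogonal_def inner_commute)
  have lin\<sigma>: "linear \<sigma>" unfolding \<sigma>_def
    by (rule linearI) (simp_all add: linear_add[OF lin\<pi>] linear_cmul[OF lin\<pi>] linear_add[OF f(1)] linear_diff[OF f(1)]
        linear_cmul[OF f(1)] algebra_simps)
  have \<sigma>N: "\<sigma> z \<in> N" for z unfolding \<sigma>_def using \<pi>' f(2) by blast
  have \<sigma>0: "\<sigma> x = 0" if "x \<in> E" for x unfolding \<sigma>_def using id\<pi>[OF that] linear_0[OF f(1)] by simp
  have bl: "bounded_linear ?\<pi>" "bounded_linear \<sigma>" using lin\<pi> lin\<sigma> by (simp_all add: linear_conv_bounded_linear)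
  define U where "U = ?\<pi> -` T"
  have U: "open U" "x0 \<in> U"
    unfolding U_def using T id\<pi> continuous_open_vimage[OF T(1)] linear_continuous_at[OF bl(1)] by auto
  define \<Psi> where "\<Psi> = (\<lambda>z. F (?\<pi> z) ** (mat 1 + \<sigma> z))"
  have sm: "smooth_on U (\<lambda>z. F (?\<pi> z))"
    by (rule smooth_on_compose[OF F(1) smooth_on_linear[OF bl(1)]]) (auto simp: U_def)
  have sm\<sigma>: "smooth_on U (\<lambda>z. mat 1 + \<sigma> z)" by (intro smooth_on_add smooth_on_const smooth_on_linear bl)
  have sm\<Psi>: "smooth_on U \<Psi>" unfolding \<Psi>_def by (rule smooth_on_bilinear[OF bounded_bilinear_matrix_mult sm sm\<sigma>])
  \<comment> \<open>At \<open>x0\<close> both factors equal \<open>mat 1\<close>, so the derivative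
    is a normal vector plus a tangent vector. These are orthogonal, so a vanishing sum forces both
    to vanish.\<close>
  have d\<Psi>: "dir_deriv \<Psi> x0 v = \<sigma> v + ?D (?\<pi> v)" for v
  proof -
    have "(F has_derivative ?D) (at (?\<pi> x0))"
      using smooth_on_has_derivative[OF F(1) T(2)] id\<pi>[OF T(3)] by simp
    from has_derivative_compose[OF bounded_linear_imp_has_derivative[OF bl(1)] this]
    have 1: "((\<lambda>z. F (?\<pi> z)) has_derivative (\<lambda>v. ?D (?\<pi> v))) (at x0)" .
    have 2: "((\<lambda>z. mat 1 + \<sigma> z) has_derivative \<sigma>) (at x0)"
      using has_derivative_add[OF has_derivative_const bounded_linear_imp_has_derivative[OF bl(2)]] by simp
    from bounded_bilinear.FDERIV[OF bounded_bilinear_matrix_mult 1 2]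
    have "(\<Psi> has_derivative (\<lambda>v. \<sigma> v + ?D (?\<pi> v))) (at x0)"
      unfolding \<Psi>_def by (simp add: id\<pi>[OF T(3)] \<sigma>0[OF T(3)] F(2))
    from frechet_derivative_at[OF this] show ?thesis by (rule fun_cong[symmetric])
  qed
  have inj\<Psi>: "v = 0" if "dir_deriv \<Psi> x0 v = 0" for v
  proof -
    have \<pi>E: "?\<pi> v \<in> E" using orth_proj(1)[OF E] .
    have s: "\<sigma> v + ?D (?\<pi> v) = 0" using that d\<Psi> by simp
    have "?D (?\<pi> v) \<bullet> \<sigma> v = 0" using \<sigma>N[of v] \<pi>E by (auto simp: N_def orthogonal_def)
    moreover have "(\<sigma> v + ?D (?\<pi> v)) \<bullet> \<sigma> v = 0" unfolding s by simp
    ultimately have "\<sigma> v \<bullet> \<sigma> v = 0" by (simp add: inner_add_left)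
    then have "\<sigma> v = 0" "?D (?\<pi> v) = 0" using s by simp_all
    then have "?\<pi> v = 0" "norm (v - ?\<pi> v) = 0"
      using inj[OF \<pi>E] f(3)[OF \<pi>', of v] by (simp_all add: \<sigma>_def)
    then show ?thesis by simp
  qed
  have \<Psi>x: "\<Psi> x = F x" if "x \<in> E" for x using that by (simp add: \<Psi>_def id\<pi> \<sigma>0)
  obtain U' V g where g: "open U'" "U' \<subseteq> U" "x0 \<in> U'" "open V" "\<Psi> x0 \<in> V" "homeomorphism U' V \<Psi> g"
    "\<And>y. y \<in> V \<Longrightarrow> g differentiable (at y)"
    using smooth_inverse_function[OF U sm\<Psi> inj\<Psi>] by metis
  have hom: "\<Psi> (g y) = y" "g y \<in> U'" if "y \<in> V" for y
    using g(6) that by (auto simp: homeomorphism_def)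
  have hom': "g (\<Psi> z) = z" "\<Psi> z \<in> V" if "z \<in> U'" for z
    using g(6) that by (auto simp: homeomorphism_def)
  obtain d where d: "d > 0" "ball x0 d \<subseteq> U'" using g(1,3) open_contains_ball by blast
  show ?thesis
  proof (rule that[of V "\<lambda>y. ?\<pi> (g y)" "\<lambda>y. \<sigma> (g y)" d])
    show "open V" "d > 0" using g d by auto
    show "mat 1 \<in> V" using g(5) \<Psi>x[OF T(3)] F(2) by simp
    show "(\<lambda>y. ?\<pi> (g y)) differentiable at y" "(\<lambda>y. \<sigma> (g y)) differentiable at y" if "y \<in> V" for y
      using g(7)[OF that] bounded_linear.has_derivative[OF bl(1)] bounded_linear.has_derivative[OF bl(2)]
      unfolding differentiable_def by blast+
    show "?\<pi> (g y) \<in> E \<and> ?\<pi> (g y) \<in> T" if "y \<in> V" for y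
      using hom(2)[OF that] g(2) orth_proj(1)[OF E] by (auto simp: U_def)
    show "?D v \<bullet> \<sigma> (g y) = 0" if "v \<in> E" for y v
      using \<sigma>N[of "g y"] that by (auto simp: N_def orthogonal_def)
    show "y = F (?\<pi> (g y)) ** (mat 1 + \<sigma> (g y))" if "y \<in> V" for y
      using hom(1)[OF that] by (simp add: \<Psi>_def)
    have "g (mat 1) = x0" using hom'(1)[OF g(3)] \<Psi>x[OF T(3)] F(2) by simp
    then show "\<sigma> (g (mat 1)) = 0" using \<sigma>0 T(3) by simp
    show "F x \<in> V \<and> ?\<pi> (g (F x)) = x" if "x \<in> E" "dist x x0 < d" for x
    proof -
      have "x \<in> U'" using d(2) that by (auto simp: dist_commute subset_iff)
      from hom'[OF this] show ?thesis using \<Psi>x[OF that(1)] id\<pi>[OF that(1)] by simp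
    qed
  qed
qed

lemma line_derivative:
  assumes "smooth_on T F" "x + t *\<^sub>R v \<in> T"
  shows "((\<lambda>t. F (x + t *\<^sub>R v)) has_vector_derivative dir_deriv F (x + t *\<^sub>R v) v) (at t)"
proof -
  have "((\<lambda>t. x + t *\<^sub>R v) has_derivative (\<lambda>h. h *\<^sub>R v)) (at t)"
    by (auto intro!: derivative_eq_intros)
  from has_derivative_compose[OF this smooth_on_has_derivative[OF assms]]
  have "((\<lambda>t. F (x + t *\<^sub>R v)) has_derivative (\<lambda>h. dir_deriv F (x + t *\<^sub>R v) (h *\<^sub>R v))) (at t)" .
  then show ?thesis unfolding has_vector_derivative_def
    using linear_cmul[OF has_derivative_linear[OF smooth_on_has_derivative[OF assms]]] by simp
qed

lemma open_line: "open T \<Longrightarrow> open {t::real. x + t *\<^sub>R v \<in> (T :: 'a::real_normed_vector set)}"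
  using continuous_open_vimage[of T "\<lambda>t. x + t *\<^sub>R v"] by (simp add: vimage_def)

lemma smooth_on_line: "smooth_on T F \<Longrightarrow> smooth_on {t. x + t *\<^sub>R v \<in> T} (\<lambda>t. F (x + t *\<^sub>R v))"
  by (rule smooth_on_compose)
    (auto intro: smooth_on_add[OF smooth_on_const smooth_on_linear[OF bounded_linear_scaleR_left]])

lemma has_vector_derivative_LIMSEQ:
  assumes "(f has_vector_derivative D) (at x)" "t \<longlonglongrightarrow> x" "\<And>k. t k \<noteq> x"
  shows "(\<lambda>k. (1 / (t k - x)) *\<^sub>R (f (t k) - f x)) \<longlonglongrightarrow> D"
proof -
  have "((\<lambda>y. norm (f y - f x - (y - x) *\<^sub>R D) / norm (y - x)) \<longlongrightarrow> 0) (at x)"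
    using assms(1) by (simp add: has_vector_derivative_def has_derivative_iff_norm)
  then have "(\<lambda>k. norm (f (t k) - f x - (t k - x) *\<^sub>R D) / norm (t k - x)) \<longlonglongrightarrow> 0"
    by (rule filterlim_compose) (use assms(2,3) in \<open>auto simp: filterlim_at\<close>)
  moreover have "norm (f (t k) - f x - (t k - x) *\<^sub>R D) / norm (t k - x)
      = norm ((1 / (t k - x)) *\<^sub>R (f (t k) - f x) - D)" for k
  proof -
    have "(1 / (t k - x)) *\<^sub>R (f (t k) - f x) - D = (1 / (t k - x)) *\<^sub>R (f (t k) - f x - (t k - x) *\<^sub>R D)"
      using assms(3)[of k] by (simp add: scaleR_diff_right)
    then show ?thesis by (simp only: norm_scaleR) (simp add: field_simps)
  qed
  ultimately show ?thesis by (simp add: tendsto_norm_zero_iff LIM_zero_cancel)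
qed

lemma uncountable_limit_point:
  fixes Z :: "real set"
  assumes "uncountable Z" "closed Z"
  obtains z t where "z \<in> Z" "\<And>k. t k \<in> Z" "\<And>k. t k \<noteq> z" "t \<longlonglongrightarrow> z"
proof -
  obtain z where z: "z islimpt Z" using assms(1) no_limpt_imp_countable by blast
  then obtain t where "\<forall>n. t n \<in> Z - {z}" "t \<longlonglongrightarrow> z" unfolding islimpt_sequential by blast
  moreover have "z \<in> Z" using z assms(2) closed_limpt by blast
  ultimately show ?thesis using that by blast
qed

section \<open>Tangent spaces of an immersed subgroup and integral curves\<close>

locale lie_subgroup = matrix_group G for G :: "(real^'n::finite^'n) set" +
  fixes E :: "(real^'n^'n) set" and \<U> :: "((real^'n^'n) set \<times> (real^'n^'n \<Rightarrow> real^'n^'n)) set"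
  assumes atlas: "immersed_atlas E \<U> G" and ops: "smooth_group_operations E \<U>"
begin

lemma E: "subspace E" using atlas by (simp add: immersed_atlas_def)

text \<open>A chart map is smooth only within a relatively open subset of \<open>E\<close>. The
  function \<open>F\<close> extends it to an open set of matrices, so that ordinary derivatives
  exist; values of \<open>F\<close> and its derivatives carry meaning only at points of
  \<open>E\<close> and in directions of \<open>E\<close>. The last clause is the immersion condition
  at \<open>x\<close>.\<close>

definition extends_at :: "(real^'n^'n) set \<Rightarrow> (real^'n^'n \<Rightarrow> real^'n^'n) \<Rightarrow> real^'n^'n \<Rightarrow>
    (real^'n^'n) set \<Rightarrow> (real^'n^'n \<Rightarrow> real^'n^'n) \<Rightarrow> bool" where
  "extends_at U \<phi> x T F \<longleftrightarrow> open T \<and> x \<in> T \<and> x \<in> E \<and> smooth_on T F \<and>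
     (\<forall>y\<in>E \<inter> T. y \<in> U \<and> F y = \<phi> y \<and> F y \<in> G) \<and> (\<forall>v\<in>E. dir_deriv F x v = 0 \<longrightarrow> v = 0)"

lemma chart_extension:
  assumes c: "(U, \<phi>) \<in> \<U>" and x: "x \<in> U"
  obtains T F where "extends_at U \<phi> x T F"
proof -
  have U: "openin (top_of_set E) U" and sm: "smooth_within U \<phi>"
    and imm: "\<And>v. v \<in> E \<Longrightarrow> ((\<lambda>t. \<phi> (x + t *\<^sub>R v)) has_vector_derivative 0) (at 0) \<Longrightarrow> v = 0"
    and im: "(\<Union>(U, \<phi>)\<in>\<U>. \<phi> ` U) = G"
    using atlas c x unfolding immersed_atlas_def by fast+
  obtain S where S: "open S" "U = E \<inter> S" using U unfolding openin_open by blast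
  obtain T F where T: "open T" "x \<in> T" "smooth_on T F" "\<forall>y\<in>U \<inter> T. F y = \<phi> y"
    using sm x unfolding smooth_within_def by blast
  have xE: "x \<in> E" using x S by blast
  have FG: "y \<in> U \<and> F y = \<phi> y \<and> F y \<in> G" if "y \<in> E \<inter> (T \<inter> S)" for y
  proof -
    have y: "y \<in> U" "F y = \<phi> y" using that S T by auto
    then have "\<phi> y \<in> G" using im c by blast
    with y show ?thesis by simp
  qed
  have sm': "smooth_on (T \<inter> S) F" using smooth_on_subset[OF T(3)] by blast
  have "v = 0" if v: "v \<in> E" "dir_deriv F x v = 0" for v
  proof (rule imm[OF v(1)])
    have "((\<lambda>t. F (x + t *\<^sub>R v)) has_vector_derivative 0) (at 0)"
      using line_derivative[OF T(3), of x 0 v] T(2) v(2) by simp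
    then show "((\<lambda>t. \<phi> (x + t *\<^sub>R v)) has_vector_derivative 0) (at 0)"
    proof (rule has_vector_derivative_transform_within_open)
      show "open {t. x + t *\<^sub>R v \<in> T \<inter> S}" using open_line T(1) S(1) by blast
      show "0 \<in> {t. x + t *\<^sub>R v \<in> T \<inter> S}" using T(2) x S by simp
      fix t assume t: "t \<in> {t. x + t *\<^sub>R v \<in> T \<inter> S}"
      have "x + t *\<^sub>R v \<in> E" using E xE v by (simp add: subspace_add subspace_scale)
      with t show "F (x + t *\<^sub>R v) = \<phi> (x + t *\<^sub>R v)" using FG by blast
    qed
  qed
  then have "extends_at U \<phi> x (T \<inter> S) F"
    unfolding extends_at_def using T S xE x sm' FG by blast
  then show thesis by (rule that)
qed

lemma tangent_in_lie_algebra: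
  assumes F: "extends_at U \<phi> x T F" and y: "y \<in> E" "y \<in> T" and v: "v \<in> E"
  shows "dir_deriv F y v ** transpose (F y) \<in> lie_algebra G"
proof -
  have T: "open T" "smooth_on T F" "\<And>y. y \<in> E \<Longrightarrow> y \<in> T \<Longrightarrow> F y \<in> G"
    using F unfolding extends_at_def by blast+
  have "dir_deriv F y v ** transpose (F (y + 0 *\<^sub>R v)) \<in> lie_algebra G"
  proof (rule lie_algebra_curve)
    show "open {t. y + t *\<^sub>R v \<in> T}" by (rule open_line[OF T(1)])
    show "smooth_on {t. y + t *\<^sub>R v \<in> T} (\<lambda>t. F (y + t *\<^sub>R v))" by (rule smooth_on_line[OF T(2)])
    show "((\<lambda>t. F (y + t *\<^sub>R v)) has_vector_derivative dir_deriv F y v) (at 0)"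
      using line_derivative[OF T(2), of y 0 v] y by simp
    show "F (y + s *\<^sub>R v) \<in> G" if "s \<in> {t. y + t *\<^sub>R v \<in> T}" for s
      using that T(3) E y v by (simp add: subspace_add subspace_scale)
  qed (use y in simp)
  then show ?thesis by simp
qed

text \<open>Smoothness of the group multiplication in charts shows that the coordinates, in the
  chart at \<open>x\<close>, of the translated curve \<open>F0 (x0 + t *\<^sub>R v) ** F x\<close>
  depend smoothly on \<open>t\<close>. The velocity of these coordinates is the required
  \<open>w\<close>.\<close>

lemma right_translate_tangent:
  assumes c0: "(U0, \<phi>0) \<in> \<U>" "extends_at U0 \<phi>0 x0 T0 F0" "\<phi>0 x0 = mat 1" "x0 \<in> U0"
    and c: "(U, \<phi>) \<in> \<U>" "extends_at U \<phi> x T F" "x \<in> U" and v: "v \<in> E"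
  shows "\<exists>w\<in>E. dir_deriv F x w = dir_deriv F0 x0 v ** F x"
proof -
  have X0: "open T0" "x0 \<in> T0" "x0 \<in> E" "smooth_on T0 F0" "\<And>y. y \<in> E \<Longrightarrow> y \<in> T0 \<Longrightarrow> y \<in> U0 \<and> F0 y = \<phi>0 y"
    and X: "open T" "x \<in> T" "x \<in> E" "smooth_on T F" "\<And>y. y \<in> E \<Longrightarrow> y \<in> T \<Longrightarrow> F y = \<phi> y"
    using c0(2) c(2) unfolding extends_at_def by blast+
  define D where "D = {z\<in>U0 \<times> U. \<phi>0 (fst z) ** \<phi> (snd z) \<in> \<phi> ` U}"
  define j where "j = (\<lambda>z. inv_into U \<phi> (\<phi>0 (fst z) ** \<phi> (snd z)))"
  have op: "openin (top_of_set (E \<times> E)) D" and smj: "smooth_within D j"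
    using ops c0(1) c(1) unfolding smooth_group_operations_def Let_def D_def j_def by fast+
  have inD: "(x0, x) \<in> D" using c0(3,4) c(3) by (simp add: D_def)
  obtain S where S: "open S" "D = (E \<times> E) \<inter> S" using op unfolding openin_open by blast
  obtain S' H where H: "open S'" "(x0, x) \<in> S'" "smooth_on S' H" "\<forall>y\<in>D \<inter> S'. H y = j y"
    using smj inD unfolding smooth_within_def by blast
  define I where "I = {t. (x0, x) + t *\<^sub>R (v, 0) \<in> S \<inter> S'} \<inter> {t. x0 + t *\<^sub>R v \<in> T0}"
  have I: "open I" unfolding I_def using open_line[of "S \<inter> S'"] open_line[OF X0(1)] S(1) H(1) by blast
  have I0: "0 \<in> I" using inD S H X0 by (simp add: I_def)
  have lineE: "x0 + t *\<^sub>R v \<in> E" for t using E X0 v by (simp add: subspace_add subspace_scale)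
  define k where "k = (\<lambda>t. H ((x0, x) + t *\<^sub>R (v, 0)))"
  have k: "k t \<in> U \<and> \<phi> (k t) = F0 (x0 + t *\<^sub>R v) ** F x" if t: "t \<in> I" for t
  proof -
    have tD: "(x0 + t *\<^sub>R v, x) \<in> D" using t lineE X(3) by (simp add: I_def S(2))
    then have "k t = inv_into U \<phi> (\<phi>0 (x0 + t *\<^sub>R v) ** \<phi> x)"
      using H(4) t by (simp add: k_def I_def j_def)
    moreover have m: "\<phi>0 (x0 + t *\<^sub>R v) ** \<phi> x \<in> \<phi> ` U" using tD by (simp add: D_def)
    ultimately have "k t \<in> U" "\<phi> (k t) = \<phi>0 (x0 + t *\<^sub>R v) ** \<phi> x"
      using inv_into_into[OF m] f_inv_into_f[OF m] by simp_all
    moreover have "F0 (x0 + t *\<^sub>R v) = \<phi>0 (x0 + t *\<^sub>R v)" "F x = \<phi> x"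
      using X0(5)[OF lineE, of t] t X by (auto simp: I_def)
    ultimately show ?thesis by simp
  qed
  have UE: "U \<subseteq> E" using atlas c(1) openin_imp_subset unfolding immersed_atlas_def by fast
  have k0: "k 0 = x"
  proof -
    have "inj_on \<phi> U" using atlas c(1) unfolding immersed_atlas_def by fast
    moreover have "F0 x0 = mat 1" "F x = \<phi> x" using X0 c0(3) X by auto
    ultimately show ?thesis using k[OF I0] c(3) by (auto dest: inj_onD)
  qed
  have dk: "(k has_vector_derivative dir_deriv H (x0, x) (v, 0)) (at 0)"
    using line_derivative[OF H(3), of "(x0, x)" 0 "(v, 0)"] H(2) by (simp add: k_def)
  let ?w = "dir_deriv H (x0, x) (v, 0)"
  \<comment> \<open>\<open>H\<close> is just some smooth extension, with values anywhere; its
    derivative along the line lies in \<open>E\<close> because \<open>k\<close> takes values in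
    \<open>U\<close>.\<close>
  have wE: "?w \<in> E"
    by (rule has_vector_derivative_in_subspace[OF E I I0 _ dk]) (use k UE in blast)
  define I' where "I' = {t\<in>I. k t \<in> T}"
  have contk: "continuous_on I k"
    unfolding k_def
    by (rule continuous_on_compose2[OF smooth_on_continuous_on[OF H(3)]])
      (auto simp: I_def intro!: continuous_intros)
  have I': "open I'" "0 \<in> I'"
    using continuous_open_preimage[OF contk I X(1)] k0 X(2) I0 by (auto simp: I'_def vimage_def Collect_conj_eq)
  have "((\<lambda>t. F (k t)) has_vector_derivative dir_deriv F x ?w) (at 0)"
    using has_derivative_compose[OF dk[unfolded has_vector_derivative_def], of F "dir_deriv F x"]
      smooth_on_has_derivative[OF X(4,2)] linear_cmul[OF has_derivative_linear[OF smooth_on_has_derivative[OF X(4,2)]]]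
    by (simp add: has_vector_derivative_def k0)
  then have "((\<lambda>t. F0 (x0 + t *\<^sub>R v) ** F x) has_vector_derivative dir_deriv F x ?w) (at 0)"
  proof (rule has_vector_derivative_transform_within_open[OF _ I'])
    fix t assume "t \<in> I'"
    then have "t \<in> I" "k t \<in> T" by (auto simp: I'_def)
    with k[of t] X(5)[of "k t"] UE show "F (k t) = F0 (x0 + t *\<^sub>R v) ** F x" by auto
  qed
  moreover have "((\<lambda>t. F0 (x0 + t *\<^sub>R v) ** F x) has_vector_derivative dir_deriv F0 x0 v ** F x) (at 0)"
    using has_vector_derivative_matrix_mult[OF line_derivative[OF X0(4), of x0 0 v] has_vector_derivative_const[of "F x"]] X0(2)
    by (simp add: matrix_mult_simps)
  ultimately have "dir_deriv F x ?w = dir_deriv F0 x0 v ** F x" by (rule vector_derivative_unique_at)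
  with wE show ?thesis by blast
qed

text \<open>The translated tangent space at the identity is contained in the tangent space at
  \<open>x\<close>. It has the dimension of \<open>E\<close>, and the other space has at most that
  dimension, so the two coincide.\<close>

lemma tangent_eq_right_translate:
  assumes c0: "(U0, \<phi>0) \<in> \<U>" "extends_at U0 \<phi>0 x0 T0 F0" "\<phi>0 x0 = mat 1" "x0 \<in> U0"
    and c: "(U, \<phi>) \<in> \<U>" "extends_at U \<phi> x T F" "x \<in> U" and w: "w \<in> E"
  shows "\<exists>v\<in>E. dir_deriv F x w = dir_deriv F0 x0 v ** F x"
proof -
  let ?A = "(\<lambda>v. dir_deriv F0 x0 v ** F x) ` E" and ?B = "dir_deriv F x ` E"
  have X0: "x0 \<in> T0" "smooth_on T0 F0" "\<And>v. v \<in> E \<Longrightarrow> dir_deriv F0 x0 v = 0 \<Longrightarrow> v = 0"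
    and X: "x \<in> T" "x \<in> E" "smooth_on T F" "F x \<in> G"
    using c0(2) c(2) unfolding extends_at_def by blast+
  have lin0: "linear (dir_deriv F0 x0)" and lin: "linear (dir_deriv F x)"
    using X X0 smooth_on_has_derivative has_derivative_linear by blast+
  have linA: "linear (\<lambda>v. dir_deriv F0 x0 v ** F x)"
    by (rule linearI) (simp_all add: linear_add[OF lin0] linear_cmul[OF lin0] matrix_mult_simps)
  have "inj_on (\<lambda>v. dir_deriv F0 x0 v ** F x) E"
  proof (rule inj_onI)
    fix a b assume ab: "a \<in> E" "b \<in> E" "dir_deriv F0 x0 a ** F x = dir_deriv F0 x0 b ** F x"
    then have "dir_deriv F0 x0 a ** F x ** transpose (F x) = dir_deriv F0 x0 b ** F x ** transpose (F x)" by simp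
    then have "dir_deriv F0 x0 a = dir_deriv F0 x0 b"
      unfolding orthogonal_matrix_cancel(4)[OF orth[OF X(4)]] .
    then have "dir_deriv F0 x0 (a - b) = 0" by (simp add: linear_diff[OF lin0])
    then show "a = b" using X0(3)[OF subspace_diff[OF E ab(1,2)]] by simp
  qed
  then have "dim ?A = dim E" using dim_image_eq[OF linA, of E] E by (simp add: span_eq_iff[THEN iffD2])
  moreover have "dim ?B \<le> dim E" by (rule dim_image_le[OF lin])
  moreover have "?A \<subseteq> ?B"
  proof
    fix M assume "M \<in> ?A"
    then obtain v where v: "v \<in> E" "M = dir_deriv F0 x0 v ** F x" by blast
    obtain w where "w \<in> E" "dir_deriv F x w = M"
      using right_translate_tangent[OF c0 c v(1)] v(2) by blast
    then show "M \<in> ?B" by (intro image_eqI[of _ _ w]) simp_all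
  qed
  ultimately have "?A = ?B"
    by (intro subspace_dim_equal linear_subspace_image[OF linA E] linear_subspace_image[OF lin E]) simp_all
  then show ?thesis using w by blast
qed

text \<open>Since \<open>G\<close> is a countable union of compact pieces of charts, uncountably many points of a curve
  in \<open>G\<close> lie in one of them; at a limit point of these the velocity is tangent to the piece.\<close>
lemma curve_tangent_somewhere:
  assumes c0: "(U0, \<phi>0) \<in> \<U>" "extends_at U0 \<phi>0 x0 T0 F0" "\<phi>0 x0 = mat 1" "x0 \<in> U0"
    and cd: "a < b" and \<gamma>: "\<And>t. t \<in> {a..b} \<Longrightarrow> \<gamma> t \<in> G" "\<And>t. t \<in> {a..b} \<Longrightarrow> (\<gamma> has_vector_derivative \<gamma>' t) (at t)"
  shows "\<exists>t\<in>{a..b}. \<gamma>' t ** transpose (\<gamma> t) \<in> dir_deriv F0 x0 ` E"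
proof -
  have cont\<gamma>: "continuous_on {a..b} \<gamma>"
    by (rule continuous_at_imp_continuous_on) (use has_vector_derivative_continuous[OF \<gamma>(2)] in blast)
  have "\<exists>C. (\<forall>n::nat. compact (C n)) \<and> U = (\<Union>n. C n)" if c: "(U, \<phi>) \<in> \<U>" for U \<phi>
  proof -
    have "openin (top_of_set E) U" using atlas c unfolding immersed_atlas_def by fast
    then obtain S where S: "open S" "U = E \<inter> S" unfolding openin_open by blast
    obtain C :: "nat \<Rightarrow> (real^'n^'n) set" where C: "\<And>n. compact (C n)" "\<Union>(range C) = S"
      by (rule open_Union_compact_subsets[OF S(1)]) (rule that)
    have "compact (E \<inter> C n)" for n using closed_subspace[OF E] C(1) closed_Int_compact by blast
    then show ?thesis using S(2) C(2) by (intro exI[of _ "\<lambda>n. E \<inter> C n"]) auto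
  qed
  note ex = this
  define C where "C c = (SOME C. (\<forall>n::nat. compact (C n)) \<and> fst c = (\<Union>n. C n))"
    for c :: "(real^'n^'n) set \<times> (real^'n^'n \<Rightarrow> real^'n^'n)"
  have "(\<forall>n. compact (C c n)) \<and> fst c = (\<Union>n. C c n)" if "c \<in> \<U>" for c
    unfolding C_def
    by (rule someI_ex[of "\<lambda>C. (\<forall>n. compact (C n)) \<and> fst c = (\<Union>n. C n)"]) (use ex[of "fst c" "snd c"] that in simp)
  then have C: "\<And>c n. c \<in> \<U> \<Longrightarrow> compact (C c n)" "\<And>c. c \<in> \<U> \<Longrightarrow> fst c = (\<Union>n. C c n)" by simp_all
  define Z where "Z = (\<lambda>(c, n). {t\<in>{a..b}. \<gamma> t \<in> snd c ` C c n})"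
  have cover: "{a..b} \<subseteq> (\<Union>i\<in>\<U> \<times> UNIV. Z i)"
  proof
    fix t assume t: "t \<in> {a..b}"
    have "(\<Union>(U, \<phi>)\<in>\<U>. \<phi> ` U) = G" using atlas unfolding immersed_atlas_def by fast
    then obtain U \<phi> x where x: "(U, \<phi>) \<in> \<U>" "x \<in> U" "\<gamma> t = \<phi> x" using \<gamma>(1)[OF t] by blast
    then obtain n where "x \<in> C (U, \<phi>) n" using C(2)[OF x(1)] by auto
    then have "t \<in> Z ((U, \<phi>), n)" using t x by (auto simp: Z_def)
    then show "t \<in> (\<Union>i\<in>\<U> \<times> UNIV. Z i)" using x(1) by blast
  qed
  have "countable (\<U> \<times> (UNIV :: nat set))" using atlas by (simp add: immersed_atlas_def)
  moreover have "uncountable {a..b}" using cd uncountable_closed_interval by blast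
  ultimately have "\<not> (\<forall>i\<in>\<U> \<times> UNIV. countable (Z i))"
  proof (intro notI)
    assume cU: "countable (\<U> \<times> (UNIV :: nat set))" and un: "uncountable {a..b}"
      and all: "\<forall>i\<in>\<U> \<times> UNIV. countable (Z i)"
    have "countable (\<Union>i\<in>\<U> \<times> UNIV. Z i)" by (rule countable_UN[OF cU]) (use all in blast)
    then show False using countable_subset[OF cover] un by simp
  qed
  then obtain i where i: "i \<in> \<U> \<times> UNIV" "uncountable (Z i)" by blast
  then obtain U \<phi> n where c: "(U, \<phi>) \<in> \<U>" and unc: "uncountable (Z ((U, \<phi>), n))" by (cases i) auto
  let ?K = "C (U, \<phi>) n"
  have K: "compact ?K" "?K \<subseteq> U" using C(1)[OF c] C(2)[OF c] by auto
  have inj: "inj_on \<phi> U" and smU: "smooth_within U \<phi>" and UE: "U \<subseteq> E"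
    using atlas c openin_imp_subset unfolding immersed_atlas_def by fast+
  have cont\<phi>: "continuous_on ?K \<phi>"
  proof (rule continuous_on_subset[OF _ K(2)])
    show "continuous_on U \<phi>" unfolding continuous_on_eq_continuous_within
    proof
      fix x assume x: "x \<in> U"
      obtain T F where T: "open T" "x \<in> T" "smooth_on T F" "\<forall>y\<in>U \<inter> T. F y = \<phi> y"
        using smU x unfolding smooth_within_def by blast
      have "continuous (at x within U) F"
        using smooth_on_continuous_on[OF T(3)] T(1,2) continuous_on_eq_continuous_at continuous_at_imp_continuous_within by blast
      then show "continuous (at x within U) \<phi>"
        by (rule continuous_transform_within_openin[of _ _ _ "U \<inter> T"]) (use T x in \<open>auto simp: openin_open\<close>)
    qed
  qed
  have Zeq: "Z ((U, \<phi>), n) = {a..b} \<inter> \<gamma> -` (\<phi> ` ?K)" by (auto simp: Z_def)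
  have "closed (Z ((U, \<phi>), n))" unfolding Zeq
    by (rule continuous_closed_preimage[OF cont\<gamma>]) (auto intro: compact_imp_closed compact_continuous_image cont\<phi> K)
  from uncountable_limit_point[OF unc this]
  obtain z t where z: "z \<in> Z ((U, \<phi>), n)" and t: "\<And>k. t k \<in> Z ((U, \<phi>), n)" "\<And>k. t k \<noteq> z" "t \<longlonglongrightarrow> z" by metis
  define g where "g = inv_into U \<phi>"
  have g\<phi>: "g (\<phi> x) = x" if "x \<in> U" for x unfolding g_def using inj that by simp
  \<comment> \<open>The purpose of the compact pieces: a continuous injection on a compact set has a
    continuous inverse, so on the piece convergence of matrices implies convergence of chart
    coordinates, even if the topology of the group is finer elsewhere.\<close>
  have contg: "continuous_on (\<phi> ` ?K) g"
    by (rule continuous_on_inv[OF cont\<phi> K(1)]) (use g\<phi> K in auto)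
  have mem: "g (\<gamma> s) \<in> U" "\<phi> (g (\<gamma> s)) = \<gamma> s" if "s \<in> Z ((U, \<phi>), n)" for s
    using that g\<phi> K(2) unfolding Zeq by auto
  have zab: "z \<in> {a..b}" using z by (simp add: Zeq)
  have lim\<gamma>: "(\<lambda>k. \<gamma> (t k)) \<longlonglongrightarrow> \<gamma> z"
    by (rule continuous_on_tendsto_compose[OF cont\<gamma> t(3) zab]) (use t(1) in \<open>simp add: Zeq\<close>)
  define x where "x = g (\<gamma> z)"
  have x: "x \<in> U" "\<phi> x = \<gamma> z" using mem[OF z] by (simp_all add: x_def)
  have limx: "(\<lambda>k. g (\<gamma> (t k))) \<longlonglongrightarrow> x"
    unfolding x_def by (rule continuous_on_tendsto_compose[OF contg lim\<gamma>]) (use z t(1) in \<open>auto simp: Zeq\<close>)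
  obtain T F where TF: "extends_at U \<phi> x T F" using chart_extension[OF c x(1)] by metis
  have T: "open T" "x \<in> T" "x \<in> E" "smooth_on T F" "\<And>y. y \<in> E \<Longrightarrow> y \<in> T \<Longrightarrow> F y = \<phi> y" "F x \<in> G"
    "\<And>v. v \<in> E \<Longrightarrow> dir_deriv F x v = 0 \<Longrightarrow> v = 0"
    using TF unfolding extends_at_def by blast+
  have Fx: "F x = \<gamma> z" using T(2,3,5) x by simp
  note c\<gamma> = orthogonal_matrix_cancel[OF orth[OF T(6)]]
  \<comment> \<open>\<open>slice_chart\<close> is centred at the identity matrix, so the chart and
    the curve are both translated by the inverse of \<open>F x\<close>.\<close>
  define F' where "F' = (\<lambda>y. F y ** transpose (F x))"
  have smF': "smooth_on T F'" unfolding F'_def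
    by (rule smooth_on_bilinear[OF bounded_bilinear_matrix_mult T(4) smooth_on_const])
  have dF': "dir_deriv F' x v = dir_deriv F x v ** transpose (F x)" for v
  proof -
    have "F differentiable (at x)" using T(2,4) smooth_on_differentiable by blast
    then show ?thesis unfolding F'_def
      by (simp add: dir_deriv_bilinear[OF bounded_bilinear_matrix_mult] matrix_mult_simps)
  qed
  have inj': "v = 0" if "v \<in> E" "dir_deriv F' x v = 0" for v
  proof (rule T(7)[OF that(1)])
    have "dir_deriv F x v ** transpose (F x) ** F x = 0" using that(2) dF' by (simp add: matrix_mult_simps)
    then show "dir_deriv F x v = 0" by (simp add: c\<gamma>)
  qed
  have "F' x = mat 1" by (simp add: F'_def c\<gamma>)
  from slice_chart[OF E T(1-3) smF' this inj']
  obtain V X d where V: "mat 1 \<in> V" "\<And>y. y \<in> V \<Longrightarrow> X differentiable (at y)" "d > 0"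
    "\<And>y. y \<in> E \<Longrightarrow> dist y x < d \<Longrightarrow> F' y \<in> V \<and> X (F' y) = y" by metis
  define q where "q = (\<lambda>s. \<gamma> s ** transpose (F x))"
  have dq: "(q has_vector_derivative \<gamma>' z ** transpose (F x)) (at z)"
    unfolding q_def using has_vector_derivative_matrix_mult[OF \<gamma>(2)[OF zab] has_vector_derivative_const[of "transpose (F x)"]]
    by (simp add: matrix_mult_simps)
  have qz: "q z = mat 1" by (simp add: q_def Fx[symmetric] c\<gamma>)
  obtain DX where DX: "(X has_derivative DX) (at (mat 1))" using V(1,2) differentiable_def by blast
  \<comment> \<open>The chart coordinate of the curve makes sense only at times in the uncountable
    set and has no derivative of its own. The slice coordinate \<open>p\<close> is differentiable at
    \<open>z\<close> and agrees with the chart coordinate along the sequence.\<close>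
  define p where "p = (\<lambda>s. X (q s))"
  have dp: "(p has_vector_derivative DX (\<gamma>' z ** transpose (F x))) (at z)"
    using has_derivative_compose[OF dq[unfolded has_vector_derivative_def], of X DX] DX
      linear_cmul[OF has_derivative_linear[OF DX]]
    by (simp add: has_vector_derivative_def qz p_def)
  have xE: "g (\<gamma> (t k)) \<in> E" for k using mem(1)[OF t(1)] UE by blast
  have "eventually (\<lambda>k. dist (g (\<gamma> (t k))) x < d) sequentially"
    using limx V(3) tendstoD by blast
  moreover have "eventually (\<lambda>k. g (\<gamma> (t k)) \<in> T) sequentially"
    using limx T(1,2) by (auto simp: tendsto_def)
  ultimately have ev: "eventually (\<lambda>k. p (t k) = g (\<gamma> (t k)) \<and> F' (p (t k)) = q (t k)) sequentially"
  proof eventually_elim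
    case (elim k)
    have "F (g (\<gamma> (t k))) = \<gamma> (t k)" using T(5)[OF xE elim(2)] mem(2)[OF t(1)] by simp
    then have "F' (g (\<gamma> (t k))) = q (t k)" by (simp add: F'_def q_def)
    then show ?case using V(4)[OF xE elim(1)] by (simp add: p_def)
  qed
  have pz: "p z = x" using V(3) V(4)[OF T(3)] by (simp add: p_def qz F'_def c\<gamma>)
  let ?w = "DX (\<gamma>' z ** transpose (F x))"
  \<comment> \<open>The difference quotients of \<open>p\<close> along the sequence are differences
    of points of \<open>E\<close>, and \<open>E\<close> is closed.\<close>
  have "?w \<in> E"
  proof (rule Lim_in_closed_set[OF closed_subspace[OF E] _ _ has_vector_derivative_LIMSEQ[OF dp t(3,2)]])
    show "eventually (\<lambda>k. (1 / (t k - z)) *\<^sub>R (p (t k) - p z) \<in> E) sequentially"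
      using ev by eventually_elim (use xE T(3) E in \<open>simp add: pz subspace_scale subspace_diff\<close>)
  qed simp
  have dFp: "((\<lambda>s. F' (p s)) has_vector_derivative dir_deriv F' x ?w) (at z)"
    using has_derivative_compose[OF dp[unfolded has_vector_derivative_def], of F' "dir_deriv F' x"]
      smooth_on_has_derivative[OF smF' T(2)] linear_cmul[OF has_derivative_linear[OF smooth_on_has_derivative[OF smF' T(2)]]]
    by (simp add: has_vector_derivative_def pz)
  \<comment> \<open>\<open>F'\<close> after \<open>p\<close> and the translated curve
    \<open>q\<close> take the same values at \<open>z\<close> and eventually along the sequence.
    Both are differentiable at \<open>z\<close>, so their velocities there agree, although the
    functions may differ in between.\<close>
  have "(\<lambda>k. (1 / (t k - z)) *\<^sub>R (q (t k) - q z)) \<longlonglongrightarrow> dir_deriv F' x ?w"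
  proof (rule Lim_transform_eventually[OF has_vector_derivative_LIMSEQ[OF dFp t(3,2)]])
    show "\<forall>\<^sub>F k in sequentially. (1 / (t k - z)) *\<^sub>R (F' (p (t k)) - F' (p z)) = (1 / (t k - z)) *\<^sub>R (q (t k) - q z)"
      using ev
    proof eventually_elim
      case (elim k)
      have "F' (p z) = q z" by (simp add: pz qz F'_def c\<gamma>)
      moreover have "F' (p (t k)) = q (t k)" using elim by blast
      ultimately show ?case by (simp only:)
    qed
  qed
  then have eq: "\<gamma>' z ** transpose (F x) = dir_deriv F x ?w ** transpose (F x)"
    using LIMSEQ_unique has_vector_derivative_LIMSEQ[OF dq t(3,2)] unfolding dF' by blast
  obtain v where v: "v \<in> E" "dir_deriv F x ?w = dir_deriv F0 x0 v ** F x"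
    using tangent_eq_right_translate[OF c0 c TF x(1) \<open>?w \<in> E\<close>] by blast
  have "\<gamma>' z ** transpose (\<gamma> z) = dir_deriv F0 x0 v" using eq v(2) c\<gamma> by (simp add: Fx[symmetric])
  then show ?thesis using v(1) zab by blast
qed

text \<open>In each short interval after 0 there is a time at which the translated velocity is
  tangent to the chart. These times tend to 0; continuity of the translated velocity and closedness
  of a finite-dimensional subspace carry the property to time 0, where the velocity is
  \<open>A\<close>.\<close>

lemma lie_algebra_tangent:
  assumes c0: "(U0, \<phi>0) \<in> \<U>" "extends_at U0 \<phi>0 x0 T0 F0" "\<phi>0 x0 = mat 1" "x0 \<in> U0"
    and A: "A \<in> lie_algebra G"
  shows "A \<in> dir_deriv F0 x0 ` E"
proof -
  let ?h = "dir_deriv F0 x0 ` E"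
  have X0: "x0 \<in> T0" "smooth_on T0 F0" using c0(2) unfolding extends_at_def by blast+
  have "subspace ?h"
    by (rule linear_subspace_image[OF has_derivative_linear[OF smooth_on_has_derivative[OF X0(2,1)]] E])
  then have cl: "closed ?h" by (rule closed_subspace)
  obtain \<gamma> e where \<gamma>: "0 < e" "smooth_on {-e<..<e} \<gamma>" "\<And>t. t \<in> {-e<..<e} \<Longrightarrow> \<gamma> t \<in> G"
    "\<gamma> 0 = mat 1" "(\<gamma> has_vector_derivative A) (at 0)" using A lie_algebraE by metis
  define \<gamma>' where "\<gamma>' = (\<lambda>t. dir_deriv \<gamma> t 1)"
  have d\<gamma>: "(\<gamma> has_vector_derivative \<gamma>' t) (at t)" if "t \<in> {-e<..<e}" for t
  proof -
    note D = smooth_on_has_derivative[OF \<gamma>(2) that]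
    have "dir_deriv \<gamma> t = (\<lambda>h. h *\<^sub>R dir_deriv \<gamma> t 1)"
    proof
      fix h :: real
      show "dir_deriv \<gamma> t h = h *\<^sub>R dir_deriv \<gamma> t 1"
        using linear_cmul[OF has_derivative_linear[OF D], of h 1] by simp
    qed
    from subst[OF this, of "\<lambda>d. (\<gamma> has_derivative d) (at t)", OF D] show ?thesis
      unfolding \<gamma>'_def has_vector_derivative_def .
  qed
  define f where "f = (\<lambda>t. \<gamma>' t ** transpose (\<gamma> t))"
  have "smooth_on {-e<..<e} f" unfolding f_def \<gamma>'_def
    by (intro smooth_on_bilinear[OF bounded_bilinear_matrix_mult] smooth_on_dir_deriv
        smooth_on_linear_compose[OF bounded_linear_transpose] \<gamma>(2)) simp
  then have contf: "continuous_on {-e<..<e} f" by (rule smooth_on_continuous_on)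
  define r where "r = (\<lambda>k. e / 2 * inverse (real (Suc k)))"
  have r: "0 < r k" "r k < e" for k
  proof -
    show "0 < r k" using \<gamma>(1) by (simp add: r_def)
    have "e / 2 * inverse (real (Suc k)) \<le> e / 2 * 1"
      using \<gamma>(1) by (intro mult_left_mono) (simp_all add: inverse_le_1_iff)
    then show "r k < e" using \<gamma>(1) unfolding r_def by linarith
  qed
  have "\<exists>t\<in>{0..r k}. f t \<in> ?h" for k
    unfolding f_def by (rule curve_tangent_somewhere[OF c0 r(1)]) (use \<gamma>(1,3) d\<gamma> r(2)[of k] in auto)
  then obtain t where t: "\<And>k. t k \<in> {0..r k}" "\<And>k. f (t k) \<in> ?h" by metis
  have "r \<longlonglongrightarrow> 0" unfolding r_def by (rule tendsto_mult_right_zero[OF LIMSEQ_inverse_real_of_nat])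
  then have "t \<longlonglongrightarrow> 0"
    by (rule tendsto_sandwich[OF _ _ tendsto_const, rotated 2]) (use t(1) in auto)
  moreover have "t k \<in> {-e<..<e}" for k using t(1)[of k] r[of k] \<gamma>(1) by simp
  ultimately have lim: "(\<lambda>k. f (t k)) \<longlonglongrightarrow> f 0"
    by (intro continuous_on_tendsto_compose[OF contf]) (use \<gamma>(1) in auto)
  have "f 0 \<in> ?h"
    by (rule Lim_in_closed_set[OF cl _ sequentially_bot lim]) (use t(2) in simp)
  moreover have "f 0 = A"
    using vector_derivative_unique_at[OF \<gamma>(5) d\<gamma>[of 0]] \<gamma>(1,4) by (simp add: f_def)
  ultimately show ?thesis by simp
qed

text \<open>In the coordinates \<open>h = F x (1 + y)\<close> of a slice chart the equation \<open>h' = B h\<close> becomes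
  \<open>y' = D (1 + y)\<close> with \<open>D\<close> in the Lie algebra and \<open>y'\<close> orthogonal to it; for small \<open>y\<close> this forces
  \<open>D = 0\<close>, so no existence theorem for differential equations is needed.\<close>
lemma eventually_in_group:
  assumes t0: "t0 \<in> {a<..<b}" and h0: "h t0 = mat 1"
    and h: "\<And>t. t \<in> {a<..<b} \<Longrightarrow> (h has_vector_derivative B t ** h t) (at t)"
    and B: "\<And>t. t \<in> {a<..<b} \<Longrightarrow> B t \<in> lie_algebra G"
  shows "\<exists>e>0. \<forall>t. dist t t0 < e \<longrightarrow> t \<in> {a<..<b} \<and> h t \<in> G"
proof -
  have im: "(\<Union>(U, \<phi>)\<in>\<U>. \<phi> ` U) = G" using atlas unfolding immersed_atlas_def by fast
  then obtain U \<phi> x0 where c0: "(U, \<phi>) \<in> \<U>" "x0 \<in> U" "\<phi> x0 = mat 1" using one_mem by fastforce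
  obtain T F where TF: "extends_at U \<phi> x0 T F" using chart_extension[OF c0(1,2)] by metis
  have T: "open T" "x0 \<in> T" "x0 \<in> E" "smooth_on T F" "\<And>y. y \<in> E \<Longrightarrow> y \<in> T \<Longrightarrow> F y = \<phi> y"
    "\<And>y. y \<in> E \<Longrightarrow> y \<in> T \<Longrightarrow> F y \<in> G" "\<And>v. v \<in> E \<Longrightarrow> dir_deriv F x0 v = 0 \<Longrightarrow> v = 0"
    using TF unfolding extends_at_def by blast+
  have "F x0 = mat 1" using T(2,3,5) c0(3) by simp
  from slice_chart[OF E T(1-4) this T(7)]
  obtain V X Y where V: "open V" "mat 1 \<in> V"
    "\<And>y. y \<in> V \<Longrightarrow> X differentiable (at y)" "\<And>y. y \<in> V \<Longrightarrow> Y differentiable (at y)"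
    "\<And>y. y \<in> V \<Longrightarrow> X y \<in> E \<and> X y \<in> T" "\<And>y v. y \<in> V \<Longrightarrow> v \<in> E \<Longrightarrow> dir_deriv F x0 v \<bullet> Y y = 0"
    "\<And>y. y \<in> V \<Longrightarrow> y = F (X y) ** (mat 1 + Y y)" "Y (mat 1) = 0" by metis
  \<comment> \<open>The slice is orthogonal to the tangent space of the chart by construction;
    \<open>lie_algebra_tangent\<close> extends this to every element of the Lie algebra defined by
    curves.\<close>
  have orthY: "D \<bullet> Y y = 0" if D: "D \<in> lie_algebra G" and y: "y \<in> V" for D y
  proof -
    obtain v where "v \<in> E" "D = dir_deriv F x0 v"
      using lie_algebra_tangent[OF c0(1) TF c0(3,2) D] by blast
    then show ?thesis using V(6)[OF y] by simp
  qed
  \<comment> \<open>The norm here is the Euclidean norm of the entries, so submultiplicativity is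
    taken only up to a constant; the smallness condition on \<open>y\<close> is scaled
    accordingly.\<close>
  obtain K where K: "K > 0" "\<And>(A :: real^'n^'n) (C :: real^'n^'n). norm (A ** C) \<le> norm A * norm C * K"
    using bounded_bilinear.pos_bounded[OF bounded_bilinear_matrix_mult] by blast
  define I where "I = {a<..<b}"
  have conth: "continuous_on I h"
    by (rule continuous_at_imp_continuous_on) (use has_vector_derivative_continuous[OF h] in \<open>auto simp: I_def\<close>)
  define I1 where "I1 = {t\<in>I. h t \<in> V}"
  have "I1 = I \<inter> h -` V" "open I" by (auto simp: I1_def I_def)
  then have I1: "open I1" "t0 \<in> I1"
    using continuous_open_preimage[OF conth _ V(1)] t0 h0 V(2) by (simp_all add: I_def)
  define y where "y = (\<lambda>t. Y (h t))"
  define x where "x = (\<lambda>t. X (h t))"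
  have comp: "((\<lambda>t. Z (h t)) has_vector_derivative dir_deriv Z (h t) (B t ** h t)) (at t)"
    if "t \<in> I1" and Z: "Z differentiable (at (h t))" for t and Z :: "real^'n^'n \<Rightarrow> real^'n^'n"
  proof -
    have "(h has_derivative (\<lambda>s. s *\<^sub>R (B t ** h t))) (at t)"
      using h that by (auto simp: I1_def I_def has_vector_derivative_def)
    moreover have DZ: "(Z has_derivative dir_deriv Z (h t)) (at (h t))" using Z frechet_derivative_works by blast
    ultimately have "((\<lambda>t. Z (h t)) has_derivative (\<lambda>s. dir_deriv Z (h t) (s *\<^sub>R (B t ** h t)))) (at t)"
      by (rule has_derivative_compose)
    then show ?thesis using linear_cmul[OF has_derivative_linear[OF DZ]] by (simp add: has_vector_derivative_def)
  qed
  define x' where "x' = (\<lambda>t. dir_deriv X (h t) (B t ** h t))"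
  define y' where "y' = (\<lambda>t. dir_deriv Y (h t) (B t ** h t))"
  have dx: "(x has_vector_derivative x' t) (at t)" if "t \<in> I1" for t
    unfolding x_def x'_def using comp that V(3) by (simp add: I1_def)
  have dy: "(y has_vector_derivative y' t) (at t)" if "t \<in> I1" for t
    unfolding y_def y'_def using comp that V(4) by (simp add: I1_def)
  have xET: "x t \<in> E" "x t \<in> T" if "t \<in> I1" for t using that V(5) by (auto simp: x_def I1_def)
  have y'0: "y' t = 0" if t: "t \<in> I1" and small: "norm (y t) * K < 1" for t
  proof -
    have x'E: "x' t \<in> E"
      by (rule has_vector_derivative_in_subspace[OF E I1(1) t xET(1) dx[OF t]])
    have orthy': "D \<bullet> y' t = 0" if D: "D \<in> lie_algebra G" for D
    proof -
      have "((\<lambda>t. D \<bullet> y t) has_vector_derivative D \<bullet> y' t) (at t)"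
        by (rule bounded_linear.has_vector_derivative[OF bounded_linear_inner_right dy[OF t]])
      then have "((\<lambda>t. 0) has_vector_derivative D \<bullet> y' t) (at t)"
        by (rule has_vector_derivative_transform_within_open[OF _ I1(1) t])
          (use orthY[OF D] in \<open>simp add: y_def I1_def\<close>)
      then show ?thesis using vector_derivative_unique_at[OF _ has_vector_derivative_const] by blast
    qed
    let ?F = "F (x t)"
    have FG: "?F \<in> G" using T(6) xET[OF t] by blast
    note c = orthogonal_matrix_cancel[OF orth[OF FG]]
    define C where "C = dir_deriv F (x t) (x' t) ** transpose ?F"
    have C: "C \<in> lie_algebra G" unfolding C_def by (rule tangent_in_lie_algebra[OF TF xET[OF t] x'E])
    have "((\<lambda>t. F (x t)) has_vector_derivative C ** ?F) (at t)"
    proof -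
      have DF: "(F has_derivative dir_deriv F (x t)) (at (x t))"
        by (rule smooth_on_has_derivative[OF T(4) xET(2)[OF t]])
      from has_derivative_compose[OF dx[OF t, unfolded has_vector_derivative_def] this]
        linear_cmul[OF has_derivative_linear[OF DF]]
      show ?thesis by (simp add: has_vector_derivative_def C_def c)
    qed
    moreover have "((\<lambda>t. mat 1 + y t) has_vector_derivative y' t) (at t)"
      using has_vector_derivative_add[OF has_vector_derivative_const dy[OF t]] by simp
    ultimately have "((\<lambda>t. F (x t) ** (mat 1 + y t)) has_vector_derivative ?F ** y' t + C ** ?F ** (mat 1 + y t)) (at t)"
      by (rule has_vector_derivative_matrix_mult)
    then have "(h has_vector_derivative ?F ** y' t + C ** ?F ** (mat 1 + y t)) (at t)"
      by (rule has_vector_derivative_transform_within_open[OF _ I1(1) t])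
        (use V(7) in \<open>simp add: x_def y_def I1_def\<close>)
    then have "?F ** y' t + C ** ?F ** (mat 1 + y t) = B t ** h t"
      by (rule vector_derivative_unique_at) (use h t in \<open>simp add: I1_def I_def\<close>)
    moreover have "h t = ?F ** (mat 1 + y t)" using V(7) t by (simp add: x_def y_def I1_def)
    ultimately have "?F ** y' t = (B t - C) ** ?F ** (mat 1 + y t)"
      by (simp add: matrix_mult_simps matrix_mul_assoc algebra_simps)
    then have "transpose ?F ** (?F ** y' t) = transpose ?F ** ((B t - C) ** ?F ** (mat 1 + y t))" by simp
    \<comment> \<open>\<open>C\<close> is the translated velocity of the part of \<open>h\<close>
      along the group, so \<open>B t - C\<close> is the defect. Conjugation by
      \<open>F (x t)\<close>, an element of \<open>G\<close>, keeps the defect in the Lie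
      algebra.\<close>
    moreover define D where "D = transpose ?F ** (B t - C) ** ?F"
    ultimately have y'D: "y' t = D + D ** y t"
      by (simp add: matrix_mul_assoc c matrix_add_ldistrib)
    have "B t - C \<in> lie_algebra G"
      using B C t subspace_diff[OF subspace_lie_algebra] by (simp add: I1_def I_def)
    from lie_algebra_conjugate[OF transpose_mem[OF FG] this]
    have D: "D \<in> lie_algebra G" by (simp add: D_def)
    \<comment> \<open>\<open>orthy'\<close> is applied to \<open>D\<close> itself in the equation
      \<open>y' t = D + D ** y t\<close>.\<close>
    have "(norm D)\<^sup>2 = - (D \<bullet> (D ** y t))"
      using orthy'[OF D] unfolding y'D inner_add_right by (simp add: power2_norm_eq_inner)
    also have "\<dots> \<le> norm D * norm (D ** y t)" using Cauchy_Schwarz_ineq2[of D "D ** y t"] by simp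
    also have "\<dots> \<le> norm D * (norm D * norm (y t) * K)" by (rule mult_left_mono[OF K(2) norm_ge_zero])
    also have "\<dots> = (norm D)\<^sup>2 * (norm (y t) * K)" by (simp add: power2_eq_square)
    finally have le: "(norm D)\<^sup>2 \<le> (norm D)\<^sup>2 * (norm (y t) * K)" .
    have "D = 0"
    proof (rule ccontr)
      assume "D \<noteq> 0"
      then have "(norm D)\<^sup>2 * (norm (y t) * K) < (norm D)\<^sup>2" using small by simp
      with le show False by simp
    qed
    then show ?thesis using y'D by (simp add: matrix_mult_simps)
  qed
  define I2 where "I2 = {t\<in>I1. norm (y t) * K < 1}"
  have y0: "y t0 = 0" by (simp add: y_def h0 V(8))
  have "continuous_on I1 (\<lambda>t. norm (y t) * K)"
    using has_vector_derivative_continuous[OF dy]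
    by (intro continuous_intros continuous_at_imp_continuous_on) auto
  from continuous_open_preimage[OF this I1(1), of "{..<1}"]
  have "open (I1 \<inter> (\<lambda>t. norm (y t) * K) -` {..<1})" by simp
  moreover have "I1 \<inter> (\<lambda>t. norm (y t) * K) -` {..<1} = I2" by (auto simp: I2_def)
  ultimately have "open I2" by simp
  moreover have "t0 \<in> I2" using I1(2) y0 by (simp add: I2_def)
  ultimately obtain e where e: "e > 0" "ball t0 e \<subseteq> I2" using open_contains_ball by blast
  have z: "(y has_vector_derivative 0) (at t within ball t0 e)" if "t \<in> ball t0 e" for t
  proof -
    from that have "t \<in> I1" "norm (y t) * K < 1" using e(2) by (auto simp: I2_def)
    then show ?thesis using dy[of t] y'0[of t] by (simp add: has_vector_derivative_at_within)
  qed
  obtain c where c: "\<And>t. t \<in> ball t0 e \<Longrightarrow> y t = c"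
    by (rule has_vector_derivative_zero_constant[OF _ z]) auto
  then have y: "y t = 0" if "t \<in> ball t0 e" for t
    using y0 c[of t0] c[OF that] e(1) by simp
  have "t \<in> {a<..<b} \<and> h t \<in> G" if "dist t t0 < e" for t
  proof -
    have t: "t \<in> ball t0 e" using that by (simp add: dist_commute)
    then have t1: "t \<in> I1" using e(2) by (auto simp: I2_def)
    then have "h t = F (x t) ** (mat 1 + y t)" using V(7) by (simp add: x_def y_def I1_def)
    then show ?thesis using T(6) xET[OF t1] y[OF t] t1 by (simp add: I1_def I_def)
  qed
  then show ?thesis using e(1) by blast
qed

text \<open>The equation is invariant under right translation, so \<open>eventually_in_group\<close>
  applies to \<open>h t ** transpose (h t0)\<close> at every time \<open>t0\<close>, whether or not
  \<open>h t0\<close> is in \<open>G\<close>; orthogonality of all \<open>h t\<close>, needed for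
  this, holds because \<open>transpose (h t) ** h t\<close> is constant. Thus membership in
  \<open>G\<close> is locally constant on the interval, hence constant.\<close>

proposition integral_curve_in_group:
  assumes h: "\<And>t. t \<in> {a<..<b} \<Longrightarrow> (h has_vector_derivative B t ** h t) (at t)"
    and B: "\<And>t. t \<in> {a<..<b} \<Longrightarrow> B t \<in> lie_algebra G"
    and s: "s \<in> {a<..<b}" "h s \<in> G" and t: "t \<in> {a<..<b}"
  shows "h t \<in> G"
proof -
  let ?I = "{a<..<b}"
  have z: "((\<lambda>t. transpose (h t) ** h t) has_vector_derivative 0) (at t within ?I)" if t: "t \<in> ?I" for t
  proof -
    from has_vector_derivative_matrix_mult[OF has_vector_derivative_transpose[OF h[OF t]] h[OF t]]
    have "((\<lambda>t. transpose (h t) ** h t) has_vector_derivative 0) (at t)"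
      by (simp add: matrix_transpose_mul lie_algebra_skew[OF B[OF t]] matrix_mult_simps matrix_mul_assoc)
    then show ?thesis by (rule has_vector_derivative_at_within)
  qed
  obtain c where c: "\<And>t. t \<in> ?I \<Longrightarrow> transpose (h t) ** h t = c"
    by (rule has_vector_derivative_zero_constant[OF _ z]) auto
  have "c = mat 1" using c[OF s(1)] orth[OF s(2)] by (simp add: orthogonal_matrix)
  with c have oh: "orthogonal_matrix (h t)" if "t \<in> ?I" for t using that by (simp add: orthogonal_matrix)
  have loc: "\<exists>e>0. \<forall>t. dist t t0 < e \<longrightarrow> t \<in> ?I \<and> h t ** transpose (h t0) \<in> G" if t0: "t0 \<in> ?I" for t0
  proof (rule eventually_in_group[OF t0 _ _ B])
    show "h t0 ** transpose (h t0) = mat 1" using oh[OF t0] by (simp add: orthogonal_matrix_def)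
    show "((\<lambda>t. h t ** transpose (h t0)) has_vector_derivative B t ** (h t ** transpose (h t0))) (at t)"
      if "t \<in> ?I" for t
      using has_vector_derivative_matrix_mult[OF h[OF that] has_vector_derivative_const[of "transpose (h t0)"]]
      by (simp add: matrix_mult_simps matrix_mul_assoc)
  qed
  have "(\<lambda>t. h t \<in> G) constant_on ?I"
  proof (rule locally_constant_imp_constant)
    fix t0 assume t0: "t0 \<in> ?I"
    then obtain e where e: "e > 0" "\<And>t. dist t t0 < e \<Longrightarrow> t \<in> ?I \<and> h t ** transpose (h t0) \<in> G"
      using loc by blast
    note c0 = orthogonal_matrix_cancel[OF oh[OF t0]]
    have iff: "h t \<in> G \<longleftrightarrow> h t0 \<in> G" if "dist t t0 < e" for t
    proof
      define k where "k = h t ** transpose (h t0)"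
      have k: "k \<in> G" using e(2)[OF that] by (simp add: k_def)
      have "k ** h t0 = h t" by (simp add: k_def c0)
      then show "h t0 \<in> G \<Longrightarrow> h t \<in> G" using mult_mem[OF k] by metis
      have "transpose k ** h t = h t0"
        using oh[of t] e(2)[OF that] by (simp add: k_def matrix_transpose_mul orthogonal_matrix flip: matrix_mul_assoc)
      then show "h t \<in> G \<Longrightarrow> h t0 \<in> G" using mult_mem[OF transpose_mem[OF k]] by metis
    qed
    have op: "openin (top_of_set ?I) (ball t0 e)"
      by (rule open_subset) (use e(2) in \<open>auto simp: dist_commute\<close>)
    show "\<exists>T. openin (top_of_set ?I) T \<and> t0 \<in> T \<and> (\<forall>x\<in>T. (h x \<in> G) = (h t0 \<in> G))"
    proof (intro exI conjI ballI)
      show "(h x \<in> G) = (h t0 \<in> G)" if "x \<in> ball t0 e" for x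
        by (rule iff) (use that in \<open>simp add: dist_commute\<close>)
    qed (use op e(1) in auto)
  qed (rule connected_Ioo)
  then show ?thesis using s t by (auto simp: constant_on_def)
qed

end

section \<open>Riemannian curvature in a moving frame\<close>

text \<open>The Leibniz rule for a field of linear maps applied to a field of vectors. Smoothness of
  \<open>L\<close> is known in fixed directions only, so the argument is expanded in a basis
  first.\<close>

lemma dir_deriv_linear_in:
  fixes L :: "'a::euclidean_space \<Rightarrow> 'b::euclidean_space \<Rightarrow> 'c::euclidean_space"
  assumes S: "open S" "x \<in> S" and L: "\<And>y. y \<in> S \<Longrightarrow> linear (L y)" "\<And>v. smooth_on S (\<lambda>y. L y v)"
    and f: "smooth_on S f"
  shows "dir_deriv (\<lambda>y. L y (f y)) x u = dir_deriv (\<lambda>y. L y (f x)) x u + L x (dir_deriv f x u)"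
    and "smooth_on S (\<lambda>y. L y (f y))"
proof -
  have ex: "L y v = (\<Sum>b\<in>Basis. (v \<bullet> b) *\<^sub>R L y b)" if "y \<in> S" for y v
    by (rule linear_Basis_expand[OF L(1)[OF that]])
  have sm: "smooth_on S (\<lambda>y. \<Sum>b\<in>Basis. (f y \<bullet> b) *\<^sub>R L y b)"
    by (intro smooth_on_sum smooth_on_bilinear[OF bounded_bilinear_scaleR]
        smooth_on_bilinear[OF bounded_bilinear_inner] smooth_on_const f L)
  show "smooth_on S (\<lambda>y. L y (f y))" by (rule smooth_on_cong[OF S(1) sm]) (simp add: ex)
  have Df: "(f has_derivative dir_deriv f x) (at x)" by (rule smooth_on_has_derivative[OF f S(2)])
  have DL: "((\<lambda>y. L y v) has_derivative dir_deriv (\<lambda>y. L y v) x) (at x)" for v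
    by (rule smooth_on_has_derivative[OF L(2) S(2)])
  have "((\<lambda>y. \<Sum>b\<in>Basis. (f y \<bullet> b) *\<^sub>R L y b) has_derivative
      (\<lambda>u. \<Sum>b\<in>Basis. (f x \<bullet> b) *\<^sub>R dir_deriv (\<lambda>y. L y b) x u + (dir_deriv f x u \<bullet> b) *\<^sub>R L x b)) (at x)"
    by (intro has_derivative_sum bounded_bilinear.FDERIV[OF bounded_bilinear_scaleR]
        bounded_linear.has_derivative[OF bounded_linear_inner_left] Df DL)
  then have "((\<lambda>y. L y (f y)) has_derivative
      (\<lambda>u. \<Sum>b\<in>Basis. (f x \<bullet> b) *\<^sub>R dir_deriv (\<lambda>y. L y b) x u + (dir_deriv f x u \<bullet> b) *\<^sub>R L x b)) (at x)"
    by (rule has_derivative_transform_within_open[OF _ S]) (simp add: ex)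
  from fun_cong[OF frechet_derivative_at[OF this], of u]
  have 1: "dir_deriv (\<lambda>y. L y (f y)) x u = (\<Sum>b\<in>Basis. (f x \<bullet> b) *\<^sub>R dir_deriv (\<lambda>y. L y b) x u) + L x (dir_deriv f x u)"
    by (simp add: sum.distrib flip: ex[OF S(2)])
  have "((\<lambda>y. \<Sum>b\<in>Basis. (f x \<bullet> b) *\<^sub>R L y b) has_derivative
      (\<lambda>u. \<Sum>b\<in>Basis. (f x \<bullet> b) *\<^sub>R dir_deriv (\<lambda>y. L y b) x u)) (at x)"
    by (intro has_derivative_sum bounded_linear.has_derivative[OF bounded_linear_scaleR_right] DL)
  then have "((\<lambda>y. L y (f x)) has_derivative (\<lambda>u. \<Sum>b\<in>Basis. (f x \<bullet> b) *\<^sub>R dir_deriv (\<lambda>y. L y b) x u)) (at x)"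
    by (rule has_derivative_transform_within_open[OF _ S]) (simp add: ex)
  from fun_cong[OF frechet_derivative_at[OF this], of u] 1
  show "dir_deriv (\<lambda>y. L y (f y)) x u = dir_deriv (\<lambda>y. L y (f x)) x u + L x (dir_deriv f x u)" by simp
qed

lemma dir_deriv_add:
  "f differentiable (at x) \<Longrightarrow> g differentiable (at x) \<Longrightarrow>
    dir_deriv (\<lambda>y. f y + g y) x v = dir_deriv f x v + dir_deriv g x v"
  unfolding frechet_derivative_works by (metis (no_types) frechet_derivative_at has_derivative_add)

lemma dir_deriv_diff:
  "f differentiable (at x) \<Longrightarrow> g differentiable (at x) \<Longrightarrow>
    dir_deriv (\<lambda>y. f y - g y) x v = dir_deriv f x v - dir_deriv g x v"
  unfolding frechet_derivative_works by (metis (no_types) frechet_derivative_at has_derivative_diff)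

lemmas dir_deriv_matrix_mult = dir_deriv_bilinear[OF bounded_bilinear_matrix_mult]
lemmas smooth_on_matrix_mult = smooth_on_bilinear[OF bounded_bilinear_matrix_mult]
lemmas smooth_on_transpose = smooth_on_linear_compose[OF bounded_linear_transpose]

lemma dir_deriv_in_subspace:
  fixes f :: "'a::euclidean_space \<Rightarrow> 'b::euclidean_space"
  assumes "subspace V" "open S" "x \<in> S" "\<And>y. y \<in> S \<Longrightarrow> f y \<in> V" "smooth_on S f"
  shows "dir_deriv f x v \<in> V"
  by (rule has_derivative_in_subspace[OF assms(1-4) smooth_on_has_derivative[OF assms(5,3)]])

lemma subspace_so: "subspace so_algebra"
  by (auto simp: subspace_def so_algebra_def transpose_simps)

text \<open>Riemannian geometry in one coordinate domain: \<open>h\<close> is the metric,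
  \<open>\<Gamma> x v\<close> is the matrix of the Christoffel symbols in direction
  \<open>v\<close>, and the columns of \<open>A\<close> are an orthonormal frame.
  \<open>\<Gamma>_sym\<close> expresses that the connection is torsion-free,
  \<open>\<Gamma>_metric\<close> that it is metric.\<close>

locale frame_field =
  fixes S :: "(real^'n::finite) set" and A h :: "real^'n \<Rightarrow> real^'n^'n"
    and \<Gamma> :: "real^'n \<Rightarrow> real^'n \<Rightarrow> real^'n^'n"
  assumes S: "open S" and A: "smooth_on S A" and h: "smooth_on S h"
    and h_sym: "\<And>x. x \<in> S \<Longrightarrow> transpose (h x) = h x"
    and \<Gamma>_smooth: "\<And>v. smooth_on S (\<lambda>x. \<Gamma> x v)" and \<Gamma>_linear: "\<And>x. x \<in> S \<Longrightarrow> linear (\<Gamma> x)"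
    and \<Gamma>_sym: "\<And>x u v. x \<in> S \<Longrightarrow> \<Gamma> x u *v v = \<Gamma> x v *v u"
    and \<Gamma>_metric: "\<And>x v. x \<in> S \<Longrightarrow> dir_deriv h x v = transpose (\<Gamma> x v) ** h x + h x ** \<Gamma> x v"
    and orthonormal: "\<And>x. x \<in> S \<Longrightarrow> transpose (A x) ** h x ** A x = mat 1"
begin

text \<open>\<open>\<theta>\<close> is the inverse of the frame, \<open>\<omega>\<close> and \<open>\<Omega>\<close> are the connection and curvature forms in the
  frame.  The form arguments of \<open>\<omega>\<close>, \<open>\<Omega>\<close>, \<open>Rm\<close> are coordinate vectors, those of \<open>w\<close>, \<open>K\<close> and of
  the covariant derivative \<open>DK\<close> of \<open>K\<close> are components with respect to the frame.\<close>
definition \<theta> :: "real^'n \<Rightarrow> real^'n^'n" where "\<theta> x = transpose (A x) ** h x"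

definition \<omega> :: "real^'n \<Rightarrow> real^'n \<Rightarrow> real^'n^'n" where
  "\<omega> x v = \<theta> x ** (dir_deriv A x v + \<Gamma> x v ** A x)"

definition \<Omega> :: "real^'n \<Rightarrow> real^'n \<Rightarrow> real^'n \<Rightarrow> real^'n^'n" where
  "\<Omega> x u v = dir_deriv (\<lambda>y. \<omega> y v) x u - dir_deriv (\<lambda>y. \<omega> y u) x v + \<omega> x u ** \<omega> x v - \<omega> x v ** \<omega> x u"

definition Rm :: "real^'n \<Rightarrow> real^'n \<Rightarrow> real^'n \<Rightarrow> real^'n^'n" where
  "Rm x u v = dir_deriv (\<lambda>y. \<Gamma> y v) x u - dir_deriv (\<lambda>y. \<Gamma> y u) x v + \<Gamma> x u ** \<Gamma> x v - \<Gamma> x v ** \<Gamma> x u"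

definition w :: "real^'n \<Rightarrow> real^'n \<Rightarrow> real^'n^'n" where "w x e = \<omega> x (A x *v e)"

definition K :: "real^'n \<Rightarrow> real^'n \<Rightarrow> real^'n \<Rightarrow> real^'n^'n" where
  "K x a b = \<Omega> x (A x *v a) (A x *v b)"

lemma \<theta>A: "x \<in> S \<Longrightarrow> \<theta> x ** A x = mat 1" and A\<theta>: "x \<in> S \<Longrightarrow> A x ** \<theta> x = mat 1"
  using orthonormal by (simp_all add: \<theta>_def matrix_left_right_inverse)

lemma \<theta>A_cancel:
  "x \<in> S \<Longrightarrow> A x ** (\<theta> x ** M) = M" "x \<in> S \<Longrightarrow> \<theta> x ** (A x ** M) = M"
  "x \<in> S \<Longrightarrow> A x *v (\<theta> x *v u) = u" "x \<in> S \<Longrightarrow> \<theta> x *v (A x *v u) = u"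
  by (simp_all add: matrix_mul_assoc matrix_vector_mul_assoc \<theta>A A\<theta>)

lemma smooth_\<theta>: "smooth_on S \<theta>"
  unfolding \<theta>_def by (intro smooth_on_matrix_mult smooth_on_transpose A h)

lemma linear_dA: "x \<in> S \<Longrightarrow> linear (dir_deriv A x)"
  using smooth_on_has_derivative[OF A] has_derivative_linear by blast

lemma linear_\<omega>: "x \<in> S \<Longrightarrow> linear (\<omega> x)"
  by (rule linearI)
    (simp_all add: \<omega>_def linear_add[OF linear_dA] linear_cmul[OF linear_dA] linear_add[OF \<Gamma>_linear]
      linear_cmul[OF \<Gamma>_linear] matrix_mult_simps algebra_simps)

lemma smooth_\<omega>: "smooth_on S (\<lambda>x. \<omega> x v)"
  unfolding \<omega>_def by (intro smooth_on_matrix_mult smooth_on_add smooth_on_dir_deriv smooth_\<theta> A S \<Gamma>_smooth)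

lemma A\<omega>: "x \<in> S \<Longrightarrow> A x ** \<omega> x v = dir_deriv A x v + \<Gamma> x v ** A x"
  by (simp add: \<omega>_def \<theta>A_cancel)

text \<open>Differentiate the orthonormality of the frame and insert the metric condition on
  \<Gamma>.\<close>

lemma \<omega>_skew:
  assumes x: "x \<in> S"
  shows "transpose (\<omega> x v) = - \<omega> x v"
proof -
  note d = smooth_on_differentiable[OF _ x]
  have "dir_deriv (\<lambda>y. transpose (A y) ** h y ** A y) x v = dir_deriv (\<lambda>y. mat 1) x v"
    using dir_deriv_cong[OF S x, of "\<lambda>y. transpose (A y) ** h y ** A y" "\<lambda>y. mat 1"] orthonormal by simp
  then have "transpose (A x) ** h x ** dir_deriv A x v + (transpose (A x) ** dir_deriv h x v
      + transpose (dir_deriv A x v) ** h x) ** A x = 0"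
    using d[OF A] d[OF h] d[OF smooth_on_transpose[OF A]] d[OF smooth_on_matrix_mult[OF smooth_on_transpose[OF A] h]]
    by (simp add: dir_deriv_matrix_mult dir_deriv_linear_compose[OF bounded_linear_transpose])
  then show ?thesis
    unfolding \<omega>_def \<theta>_def \<Gamma>_metric[OF x]
    by (simp add: matrix_transpose_mul transpose_simps matrix_mult_simps matrix_mul_assoc h_sym[OF x]
        eq_neg_iff_add_eq_0 algebra_simps)
qed

text \<open>The first structure equation. The Christoffel terms cancel by symmetry, and the
  right-hand side is the Lie bracket of the frame fields with constant components \<open>a\<close>
  and \<open>b\<close>.\<close>

lemma torsion_free:
  assumes x: "x \<in> S"
  shows "A x *v (w x a *v b - w x b *v a)
    = dir_deriv A x (A x *v a) *v b - dir_deriv A x (A x *v b) *v a"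
proof -
  have "A x *v (w x a *v b) = dir_deriv A x (A x *v a) *v b + \<Gamma> x (A x *v a) *v (A x *v b)" for a b
    using A\<omega>[OF x, of "A x *v a"] by (simp add: w_def matrix_vector_mul_assoc matrix_vector_mult_add_rdistrib)
  then show ?thesis
    using \<Gamma>_sym[OF x, of "A x *v a" "A x *v b"] by (simp add: matrix_vector_simps)
qed

text \<open>The curvature is tensorial under the change from coordinates to the frame: second
  derivatives of \<open>A\<close> cancel by symmetry, and the first-order terms cancel after
  replacing \<open>A x ** \<omega> x v\<close> by
  \<open>dir_deriv A x v + \<Gamma> x v ** A x\<close>.\<close>

lemma A\<Omega>:
  assumes x: "x \<in> S"
  shows "A x ** \<Omega> x u v = Rm x u v ** A x"
proof -
  note d = smooth_on_differentiable[OF _ x]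
  have *: "A x ** dir_deriv (\<lambda>y. \<omega> y v) x u = dir_deriv (\<lambda>y. dir_deriv A y v) x u
      + dir_deriv (\<lambda>y. \<Gamma> y v) x u ** A x + \<Gamma> x v ** dir_deriv A x u - dir_deriv A x u ** \<omega> x v" for u v
  proof -
    have "dir_deriv (\<lambda>y. A y ** \<omega> y v) x u = dir_deriv (\<lambda>y. dir_deriv A y v + \<Gamma> y v ** A y) x u"
      using dir_deriv_cong[OF S x, of "\<lambda>y. A y ** \<omega> y v" "\<lambda>y. dir_deriv A y v + \<Gamma> y v ** A y"] A\<omega> by simp
    then show ?thesis
      using d[OF A] d[OF smooth_\<omega>] d[OF smooth_on_dir_deriv[OF S A]] d[OF \<Gamma>_smooth] d[OF smooth_on_matrix_mult[OF \<Gamma>_smooth A]]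
      by (simp add: dir_deriv_matrix_mult dir_deriv_add algebra_simps)
  qed
  have **: "A x ** \<omega> x u ** \<omega> x v = dir_deriv A x u ** \<omega> x v + \<Gamma> x u ** dir_deriv A x v + \<Gamma> x u ** \<Gamma> x v ** A x" for u v
  proof -
    have "A x ** \<omega> x u ** \<omega> x v = dir_deriv A x u ** \<omega> x v + \<Gamma> x u ** (A x ** \<omega> x v)"
      by (simp add: matrix_mul_assoc A\<omega>[OF x, of u] matrix_mult_simps)
    then show ?thesis by (simp add: A\<omega>[OF x] matrix_mult_simps matrix_mul_assoc)
  qed
  show ?thesis
    unfolding \<Omega>_def Rm_def using dir_deriv_commute[OF S A x, of u v]
    by (simp add: matrix_mult_simps * ** matrix_mul_assoc)
qed

text \<open>Differentiating the symmetry of the Christoffel symbols makes the derivative terms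
  cancel in pairs in the cyclic sum; the symmetry itself does the same for the products.\<close>

lemma Rm_bianchi:
  assumes x: "x \<in> S"
  shows "Rm x u v *v z + Rm x v z *v u + Rm x z u *v v = 0"
proof -
  have d\<Gamma>: "dir_deriv (\<lambda>y. \<Gamma> y a) x u *v b = dir_deriv (\<lambda>y. \<Gamma> y b) x u *v a" for a b u
  proof -
    have *: "dir_deriv (\<lambda>y. \<Gamma> y a *v b) x u = dir_deriv (\<lambda>y. \<Gamma> y a) x u *v b" for a b
      using smooth_on_differentiable[OF \<Gamma>_smooth x]
      by (simp add: dir_deriv_bilinear[OF bounded_bilinear_matrix_vector] matrix_vector_simps)
    have "dir_deriv (\<lambda>y. \<Gamma> y a *v b) x = dir_deriv (\<lambda>y. \<Gamma> y b *v a) x"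
      by (rule dir_deriv_cong[OF S x \<Gamma>_sym])
    then show ?thesis using * by metis
  qed
  show ?thesis unfolding Rm_def
    by (simp add: matrix_vector_simps d\<Gamma>[of z v u] d\<Gamma>[of u z v] d\<Gamma>[of z u v]
        \<Gamma>_sym[OF x, of z u] \<Gamma>_sym[OF x, of u v] \<Gamma>_sym[OF x, of z v] flip: matrix_vector_mul_assoc)
qed

lemma linear_w: "x \<in> S \<Longrightarrow> linear (w x)"
  unfolding w_def using linear_compose[OF _ linear_\<omega>, of "(*v) (A x)" x] by (simp add: o_def)

lemma smooth_A_vec: "smooth_on S (\<lambda>x. A x *v a)"
  by (intro smooth_on_bilinear[OF bounded_bilinear_matrix_vector] A smooth_on_const)

lemma dA_vec: "x \<in> S \<Longrightarrow> dir_deriv (\<lambda>y. A y *v a) x u = dir_deriv A x u *v a"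
  using smooth_on_differentiable[OF A]
  by (simp add: dir_deriv_bilinear[OF bounded_bilinear_matrix_vector] matrix_vector_simps)

lemma smooth_w: "smooth_on S (\<lambda>x. w x a)"
  and dw: "x \<in> S \<Longrightarrow> dir_deriv (\<lambda>y. w y a) x u = dir_deriv (\<lambda>y. \<omega> y (A x *v a)) x u + \<omega> x (dir_deriv A x u *v a)"
proof -
  show "x \<in> S \<Longrightarrow> dir_deriv (\<lambda>y. w y a) x u = dir_deriv (\<lambda>y. \<omega> y (A x *v a)) x u + \<omega> x (dir_deriv A x u *v a)"
    unfolding w_def
    using dir_deriv_linear_in(1)[OF S _ linear_\<omega> smooth_\<omega> smooth_A_vec, of x a u] by (simp add: dA_vec)
  show "smooth_on S (\<lambda>x. w x a)"
  \<comment> \<open>\<open>dir_deriv_linear_in\<close> is stated relative to a point of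
    \<open>S\<close>, so the empty domain is settled separately.\<close>
  proof (cases "S = {}")
    case True
    then show ?thesis using smooth_on_cong[OF S smooth_on_const] by blast
  next
    case False
    then show ?thesis unfolding w_def
      using dir_deriv_linear_in(2)[OF S _ linear_\<omega> smooth_\<omega> smooth_A_vec, of _ a] by blast
  qed
qed

lemma w_skew: "x \<in> S \<Longrightarrow> transpose (w x a) = - w x a"
  by (simp add: w_def \<omega>_skew)

text \<open>The second structure equation on frame fields. The last term comes from their Lie
  bracket, expressed through \<open>w\<close> by \<open>torsion_free\<close>. Only derivatives along
  the frame fields occur, which serves both the splitting of the curvature and its independence of
  coordinates.\<close>

lemma K_structure:
  assumes x: "x \<in> S"
  shows "K x a b = dir_deriv (\<lambda>y. w y b) x (A x *v a) - dir_deriv (\<lambda>y. w y a) x (A x *v b)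
    + w x a ** w x b - w x b ** w x a - w x (w x a *v b - w x b *v a)"
proof -
  have "w x (w x a *v b - w x b *v a) = \<omega> x (dir_deriv A x (A x *v a) *v b) - \<omega> x (dir_deriv A x (A x *v b) *v a)"
    unfolding w_def[of x "_ - _"] torsion_free[OF x] by (simp add: linear_diff[OF linear_\<omega>[OF x]])
  then show ?thesis
    unfolding K_def \<Omega>_def dw[OF x] w_def[of x a] w_def[of x b] by simp
qed

lemma linear_d\<omega>: "x \<in> S \<Longrightarrow> linear (dir_deriv (\<lambda>y. \<omega> y v) x)"
  using smooth_on_has_derivative[OF smooth_\<omega>] has_derivative_linear by blast

lemma linear_d\<omega>':
  assumes x: "x \<in> S"
  shows "linear (\<lambda>v. dir_deriv (\<lambda>y. \<omega> y v) x u)"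
proof (rule linearI)
  note d = smooth_on_differentiable[OF smooth_\<omega> x]
  fix a b r
  have "dir_deriv (\<lambda>y. \<omega> y (a + b)) x = dir_deriv (\<lambda>y. \<omega> y a + \<omega> y b) x"
    by (rule dir_deriv_cong[OF S x]) (simp add: linear_add[OF linear_\<omega>])
  then show "dir_deriv (\<lambda>y. \<omega> y (a + b)) x u = dir_deriv (\<lambda>y. \<omega> y a) x u + dir_deriv (\<lambda>y. \<omega> y b) x u"
    by (simp add: dir_deriv_add d)
  have "dir_deriv (\<lambda>y. \<omega> y (r *\<^sub>R a)) x = dir_deriv (\<lambda>y. r *\<^sub>R \<omega> y a) x"
    by (rule dir_deriv_cong[OF S x]) (simp add: linear_cmul[OF linear_\<omega>])
  then show "dir_deriv (\<lambda>y. \<omega> y (r *\<^sub>R a)) x u = r *\<^sub>R dir_deriv (\<lambda>y. \<omega> y a) x u"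
    by (simp add: dir_deriv_linear_compose[OF bounded_linear_scaleR_right] d)
qed

lemma bilinear_\<Omega>: "x \<in> S \<Longrightarrow> bilinear (\<Omega> x)"
  unfolding bilinear_def \<Omega>_def
  by (auto intro!: linearI
      simp: linear_add[OF linear_d\<omega>] linear_cmul[OF linear_d\<omega>] linear_add[OF linear_d\<omega>'] linear_cmul[OF linear_d\<omega>']
        linear_add[OF linear_\<omega>] linear_cmul[OF linear_\<omega>] matrix_mult_simps algebra_simps)

lemma \<Omega>_antisym: "\<Omega> x u v = - \<Omega> x v u"
  by (simp add: \<Omega>_def)

lemma smooth_\<Omega>: "smooth_on S (\<lambda>x. \<Omega> x u v)"
  unfolding \<Omega>_def by (intro smooth_on_diff smooth_on_add smooth_on_matrix_mult smooth_on_dir_deriv S smooth_\<omega>)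

lemma \<Omega>_skew:
  assumes x: "x \<in> S"
  shows "transpose (\<Omega> x u v) = - \<Omega> x u v"
proof -
  have "dir_deriv (\<lambda>y. \<omega> y v) x u \<in> so_algebra" for u v
    by (rule dir_deriv_in_subspace[OF subspace_so S x _ smooth_\<omega>]) (simp add: so_algebra_def \<omega>_skew)
  then have "transpose (dir_deriv (\<lambda>y. \<omega> y v) x u) = - dir_deriv (\<lambda>y. \<omega> y v) x u" for u v
    by (simp add: so_algebra_def)
  then show ?thesis
    by (simp add: \<Omega>_def transpose_simps matrix_transpose_mul \<omega>_skew[OF x] matrix_mult_simps)
qed

lemma bilinear_K: "x \<in> S \<Longrightarrow> bilinear (K x)"
  unfolding bilinear_def[of "K x"] K_def
  by (auto intro!: linearI simp: matrix_vector_simps bilinear_ladd[OF bilinear_\<Omega>] bilinear_radd[OF bilinear_\<Omega>]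
      bilinear_lmul[OF bilinear_\<Omega>] bilinear_rmul[OF bilinear_\<Omega>])

lemma K_antisym: "K x a b = - K x b a"
  by (simp add: K_def \<Omega>_antisym[of x "A x *v a"])

lemma K_skew: "x \<in> S \<Longrightarrow> transpose (K x a b) = - K x a b"
  by (simp add: K_def \<Omega>_skew)

lemma AK: "x \<in> S \<Longrightarrow> A x *v (K x a b *v c) = Rm x (A x *v a) (A x *v b) *v (A x *v c)"
  unfolding K_def by (simp add: matrix_vector_mul_assoc A\<Omega>)

lemma K_bianchi:
  assumes x: "x \<in> S"
  shows "K x a b *v c + K x b c *v a + K x c a *v b = 0"
proof -
  have "A x *v (K x a b *v c + K x b c *v a + K x c a *v b) = 0"
    using Rm_bianchi[OF x] by (simp add: matrix_vector_simps AK[OF x])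
  then have "\<theta> x *v (A x *v (K x a b *v c + K x b c *v a + K x c a *v b)) = 0" by simp
  then show ?thesis by (simp only: \<theta>A_cancel[OF x])
qed

text \<open>The endomorphism in coordinates is conjugate by the frame to the one in frame
  components, and the trace is invariant under conjugation.\<close>

lemma trace_Rm:
  assumes x: "x \<in> S"
  shows "trace (matrix (\<lambda>X. Rm x X (A x *v b) *v (A x *v c))) = trace (matrix (\<lambda>m. K x m b *v c))"
proof -
  have linK: "linear (\<lambda>m. K x m b *v c)"
    by (auto intro!: linearI simp: bilinear_ladd[OF bilinear_K[OF x]] bilinear_lmul[OF bilinear_K[OF x]] matrix_vector_simps)
  have R: "Rm x X (A x *v b) *v (A x *v c) = A x *v (K x (\<theta> x *v X) b *v c)" for X
    using AK[OF x, of "\<theta> x *v X" b c] by (simp add: \<theta>A_cancel[OF x])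
  have "linear (\<lambda>X. Rm x X (A x *v b) *v (A x *v c))"
    unfolding R using linear_compose[OF linear_compose[OF matrix_vector_mul_linear linK] matrix_vector_mul_linear]
    by (simp add: o_def)
  then have "matrix (\<lambda>X. Rm x X (A x *v b) *v (A x *v c)) = A x ** (matrix (\<lambda>m. K x m b *v c) ** \<theta> x)"
    unfolding matrix_eq
    by (simp add: matrix_linear R matrix_linear[OF linK] flip: matrix_vector_mul_assoc)
  then show ?thesis by (simp add: trace_mul_sym[of "A x"] \<theta>A[OF x] flip: matrix_mul_assoc)
qed

section \<open>The second Bianchi identity and Schur's lemma for the Ricci tensor\<close>

lemma \<Omega>_second_bianchi:
  assumes x: "x \<in> S"
  shows "dir_deriv (\<lambda>y. \<Omega> y v z) x u + dir_deriv (\<lambda>y. \<Omega> y z u) x v + dir_deriv (\<lambda>y. \<Omega> y u v) x z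
    + (\<omega> x u ** \<Omega> x v z - \<Omega> x v z ** \<omega> x u) + (\<omega> x v ** \<Omega> x z u - \<Omega> x z u ** \<omega> x v)
    + (\<omega> x z ** \<Omega> x u v - \<Omega> x u v ** \<omega> x z) = 0"
proof -
  note d = smooth_on_differentiable[OF _ x]
  note sd = smooth_on_dir_deriv[OF S smooth_\<omega>]
  have d\<Omega>: "dir_deriv (\<lambda>y. \<Omega> y v z) x u =
      dir_deriv (\<lambda>y. dir_deriv (\<lambda>y. \<omega> y z) y v) x u - dir_deriv (\<lambda>y. dir_deriv (\<lambda>y. \<omega> y v) y z) x u
      + (\<omega> x v ** dir_deriv (\<lambda>y. \<omega> y z) x u + dir_deriv (\<lambda>y. \<omega> y v) x u ** \<omega> x z)
      - (\<omega> x z ** dir_deriv (\<lambda>y. \<omega> y v) x u + dir_deriv (\<lambda>y. \<omega> y z) x u ** \<omega> x v)" for u v z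
    unfolding \<Omega>_def
    by (simp add: dir_deriv_diff dir_deriv_add dir_deriv_matrix_mult
        d[OF sd] d[OF smooth_\<omega>] d[OF smooth_on_matrix_mult[OF smooth_\<omega> smooth_\<omega>]]
        d[OF smooth_on_diff[OF sd sd]] d[OF smooth_on_add[OF smooth_on_diff[OF sd sd] smooth_on_matrix_mult[OF smooth_\<omega> smooth_\<omega>]]])
  \<comment> \<open>Second derivatives of \<omega> occur in pairs that differ in the order of
    directions and cancel. What remains of the derivatives of the products combines with the
    commutators of \<omega> and \<Omega>.\<close>
  note c = dir_deriv_commute[OF S smooth_\<omega> x]
  show ?thesis unfolding d\<Omega> c[where v=u and u=v] c[where v=u and u=z] c[where v=v and u=z]
    by (simp add: \<Omega>_def matrix_mult_simps matrix_mul_assoc)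
qed

lemma smooth_K: "smooth_on S (\<lambda>x. K x a b)"
  and dK: "x \<in> S \<Longrightarrow> dir_deriv (\<lambda>y. K y a b) x u = dir_deriv (\<lambda>y. \<Omega> y (A x *v a) (A x *v b)) x u
    + \<Omega> x (dir_deriv A x u *v a) (A x *v b) + \<Omega> x (A x *v a) (dir_deriv A x u *v b)"
proof -
  have lin: "linear (\<Omega> y v)" "linear (\<lambda>v. \<Omega> y v z)" if "y \<in> S" for y v z
    using bilinear_\<Omega>[OF that] by (auto simp: bilinear_def)
  have *: "smooth_on S (\<lambda>y. \<Omega> y v (A y *v b))"
    "dir_deriv (\<lambda>y. \<Omega> y v (A y *v b)) x u = dir_deriv (\<lambda>y. \<Omega> y v (A x *v b)) x u + \<Omega> x v (dir_deriv A x u *v b)"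
    if x: "x \<in> S" for v x
    using dir_deriv_linear_in[where L="\<lambda>y. \<Omega> y v" and f="\<lambda>y. A y *v b", OF S x lin(1) smooth_\<Omega> smooth_A_vec]
    by (simp_all add: dA_vec[OF x])
  have **: "smooth_on S (\<lambda>x. K x a b)"
    "dir_deriv (\<lambda>y. K y a b) x u = dir_deriv (\<lambda>y. \<Omega> y (A x *v a) (A y *v b)) x u + \<Omega> x (dir_deriv A x u *v a) (A x *v b)"
    if x: "x \<in> S" for x
    using dir_deriv_linear_in[where L="\<lambda>y v. \<Omega> y v (A y *v b)" and f="\<lambda>y. A y *v a",
        OF S x lin(2) *(1)[OF x] smooth_A_vec]
    by (simp_all add: dA_vec[OF x] K_def)
  show "smooth_on S (\<lambda>x. K x a b)"
  proof (cases "S = {}")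
    case True
    then show ?thesis using smooth_on_cong[OF S smooth_on_const[of S 0]] by blast
  qed (use **(1) in blast)
  show "x \<in> S \<Longrightarrow> dir_deriv (\<lambda>y. K y a b) x u = dir_deriv (\<lambda>y. \<Omega> y (A x *v a) (A x *v b)) x u
    + \<Omega> x (dir_deriv A x u *v a) (A x *v b) + \<Omega> x (A x *v a) (dir_deriv A x u *v b)"
    by (simp add: ** *(2))
qed

definition DK :: "real^'n \<Rightarrow> real^'n \<Rightarrow> real^'n \<Rightarrow> real^'n \<Rightarrow> real^'n^'n" where
  "DK x k a b = dir_deriv (\<lambda>y. K y a b) x (A x *v k) + w x k ** K x a b - K x a b ** w x k
     - K x (w x k *v a) b - K x a (w x k *v b)"

lemma DK_antisym:
  assumes "x \<in> S"
  shows "DK x k a b = - DK x k b a"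
proof -
  have "dir_deriv (\<lambda>y. K y a b) x = dir_deriv (\<lambda>y. - K y b a) x"
    by (rule dir_deriv_cong[OF S assms K_antisym])
  then have "dir_deriv (\<lambda>y. K y a b) x u = - dir_deriv (\<lambda>y. K y b a) x u" for u
    using dir_deriv_linear_compose[OF bounded_linear_minus[OF bounded_linear_ident]
        smooth_on_differentiable[OF smooth_K assms]] by simp
  then show ?thesis
    unfolding DK_def K_antisym[of x a b] K_antisym[of x "w x k *v a"] K_antisym[of x a "w x k *v b"]
    by (simp add: matrix_mult_simps)
qed

lemma DK_skew: "x \<in> S \<Longrightarrow> transpose (DK x k a b) = - DK x k a b"
proof -
  assume x: "x \<in> S"
  have "dir_deriv (\<lambda>y. K y a b) x u \<in> so_algebra" for u
    by (rule dir_deriv_in_subspace[OF subspace_so S x _ smooth_K]) (simp add: so_algebra_def K_skew)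
  then have "transpose (dir_deriv (\<lambda>y. K y a b) x u) = - dir_deriv (\<lambda>y. K y a b) x u" for u
    by (simp add: so_algebra_def)
  then show ?thesis
    by (simp add: DK_def transpose_simps matrix_transpose_mul K_skew[OF x] w_skew[OF x] matrix_mult_simps)
qed

text \<open>Passing from \<Omega> to frame components differentiates the frame fields, whose
  derivative is a \<open>w\<close> term minus a Christoffel term \<open>?g\<close>. The
  \<open>w\<close> terms are absorbed by the definition of \<open>DK\<close>, and the Christoffel
  terms cancel in the cyclic sum by symmetry.\<close>

lemma second_bianchi:
  assumes x: "x \<in> S"
  shows "DK x k a b + DK x a b k + DK x b k a = 0"
proof -
  let ?g = "\<lambda>a b. \<Gamma> x (A x *v a) *v (A x *v b)"
  have g: "dir_deriv A x (A x *v k) *v a = A x *v (w x k *v a) - ?g k a" for k a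
    using A\<omega>[OF x, of "A x *v k"] by (simp add: w_def matrix_vector_mul_assoc matrix_vector_mult_add_rdistrib)
  note lin = bilinear_lsub[OF bilinear_\<Omega>[OF x]] bilinear_rsub[OF bilinear_\<Omega>[OF x]]
  have DK: "DK x k a b = dir_deriv (\<lambda>y. \<Omega> y (A x *v a) (A x *v b)) x (A x *v k)
     + (w x k ** K x a b - K x a b ** w x k) + \<Omega> x (?g k b) (A x *v a) - \<Omega> x (?g k a) (A x *v b)" for k a b
    unfolding DK_def dK[OF x] unfolding g lin K_def \<Omega>_antisym[of x "A x *v a" "?g k b"] by simp
  show ?thesis
    unfolding DK using \<Omega>_second_bianchi[OF x, of "A x *v a" "A x *v b" "A x *v k"]
    by (simp add: \<Gamma>_sym[OF x, of "A x *v a" "A x *v k"] \<Gamma>_sym[OF x, of "A x *v b" "A x *v a"]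
        \<Gamma>_sym[OF x, of "A x *v b" "A x *v k"] w_def K_def algebra_simps)
qed

lemma trace_sum: "trace (M :: real^'n^'n) = (\<Sum>i\<in>UNIV. (M *v axis i 1) $ i)"
  by (simp only: matrix_vector_mult_basis) (simp add: trace_def column_def)

lemma trace_K:
  "trace (matrix (\<lambda>m. K x m b *v c)) = (\<Sum>i\<in>UNIV. (K x (axis i 1) b *v c) $ i)"
  by (simp add: trace_def matrix_def)

text \<open>Schur's lemma, from the contracted second Bianchi identity \<open>(n - 2) ds = 0\<close>.\<close>
proposition schur:
  assumes n: "CARD('n) \<noteq> 2" and x: "x \<in> S"
    and ric: "\<And>y b c. y \<in> S \<Longrightarrow> trace (matrix (\<lambda>m. K y m b *v c)) = s y * (b \<bullet> c)"
  shows "(s has_derivative (\<lambda>u. 0)) (at x)"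
proof -
  note ric' = ric[unfolded trace_K]
  let ?e = "\<lambda>i. axis i 1 :: real^'n"
  have sm_ric: "smooth_on S (\<lambda>y. \<Sum>i\<in>UNIV. (K y (?e i) b *v c) $ i)" for b c
    by (intro smooth_on_sum smooth_on_linear_compose[OF bounded_linear_vec_nth]
        smooth_on_bilinear[OF bounded_bilinear_matrix_vector] smooth_K smooth_on_const)
  \<comment> \<open>An arbitrary index: the Ricci contraction on the corresponding unit vector
    equals \<open>s\<close>, so the smoothness of \<open>s\<close> comes from that of the
    curvature.\<close>
  obtain i0 :: 'n where True by simp
  have sm_s: "smooth_on S s"
    by (rule smooth_on_cong[OF S sm_ric[of "?e i0" "?e i0"]])
      (simp add: trace_K[symmetric] ric inner_axis_axis)
  define ds where "ds = (\<lambda>k. dir_deriv s x (A x *v k))"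
  have Ds: "(s has_derivative dir_deriv s x) (at x)" by (rule smooth_on_has_derivative[OF sm_s x])
  have lin_ds: "linear ds" unfolding ds_def
    using linear_compose[OF matrix_vector_mul_linear has_derivative_linear[OF Ds]] by (simp add: o_def)
  have ds_sum: "(\<Sum>i\<in>UNIV. d $ i * ds (?e i)) = ds d" for d
    using linear_axis_expand[OF lin_ds, of d] by simp
  note linK = bilinear_ladd[OF bilinear_K[OF x]] bilinear_lmul[OF bilinear_K[OF x]]
  \<comment> \<open>The contraction commutes with the covariant derivative: the two trace terms
    agree by cyclicity, and the two terms with \<open>s x\<close> cancel since \<open>w x k\<close>
    is skew, so only the derivative of \<open>s\<close> is left.\<close>
  have P: "(\<Sum>i\<in>UNIV. (DK x k (?e i) b *v c) $ i) = ds k * (b \<bullet> c)" for k b c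
  proof -
    define M where "M = matrix (\<lambda>m. K x m b *v c)"
    have "linear (\<lambda>m. K x m b *v c)" by (auto intro!: linearI simp: linK matrix_vector_simps)
    then have M: "M *v m = K x m b *v c" for m unfolding M_def by (rule matrix_linear)
    have 1: "(\<Sum>i\<in>UNIV. (dir_deriv (\<lambda>y. K y (?e i) b) x u *v c) $ i) = dir_deriv s x u * (b \<bullet> c)" for u
    proof -
      have "((\<lambda>y. \<Sum>i\<in>UNIV. (K y (?e i) b *v c) $ i) has_derivative
          (\<lambda>u. \<Sum>i\<in>UNIV. (dir_deriv (\<lambda>y. K y (?e i) b) x u *v c) $ i)) (at x)"
      proof (intro has_derivative_sum bounded_linear.has_derivative[OF bounded_linear_vec_nth])
        fix i
        show "((\<lambda>y. K y (?e i) b *v c) has_derivative (\<lambda>u. dir_deriv (\<lambda>y. K y (?e i) b) x u *v c)) (at x)"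
          using bounded_linear.has_derivative[OF bounded_bilinear.bounded_linear_left[OF bounded_bilinear_matrix_vector]
              smooth_on_has_derivative[OF smooth_K x]] .
      qed
      then have d1: "((\<lambda>y. s y * (b \<bullet> c)) has_derivative
          (\<lambda>u. \<Sum>i\<in>UNIV. (dir_deriv (\<lambda>y. K y (?e i) b) x u *v c) $ i)) (at x)"
        by (rule has_derivative_transform_within_open[OF _ S x]) (rule ric')
      have d2: "((\<lambda>y. s y * (b \<bullet> c)) has_derivative (\<lambda>u. dir_deriv s x u * (b \<bullet> c))) (at x)"
        by (rule bounded_linear.has_derivative[OF bounded_linear_mult_left Ds])
      from fun_cong[OF has_derivative_unique[OF d1 d2], of u] show ?thesis .
    qed
    have 2: "(\<Sum>i\<in>UNIV. (w x k *v (K x (?e i) b *v c)) $ i) = trace (w x k ** M)"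
      by (simp add: trace_sum M flip: matrix_vector_mul_assoc)
    have 3: "(\<Sum>i\<in>UNIV. (K x (w x k *v ?e i) b *v c) $ i) = trace (M ** w x k)"
      by (simp add: trace_sum M flip: matrix_vector_mul_assoc)
    have 4: "b \<bullet> (w x k *v c) + (w x k *v b) \<bullet> c = 0"
      by (simp add: inner_transpose w_skew[OF x] matrix_vector_simps)
    have "(\<Sum>i\<in>UNIV. (DK x k (?e i) b *v c) $ i) = ds k * (b \<bullet> c) + trace (w x k ** M)
        - s x * (b \<bullet> (w x k *v c)) - trace (M ** w x k) - s x * ((w x k *v b) \<bullet> c)"
      unfolding DK_def ds_def 1[symmetric] 2[symmetric] 3[symmetric] ric'[OF x, symmetric]
      by (simp add: matrix_vector_simps sum.distrib sum_subtractf flip: matrix_vector_mul_assoc)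
    also have "\<dots> = ds k * (b \<bullet> c) - s x * (b \<bullet> (w x k *v c) + (w x k *v b) \<bullet> c)"
      by (simp add: trace_mul_sym[of "w x k"] algebra_simps)
    finally show ?thesis by (simp add: 4)
  qed
  have comp: "(M *v ?e a) $ m = M $ m $ a" for M :: "real^'n^'n" and a m
    by (simp only: matrix_vector_mult_basis) (simp add: column_def)
  \<comment> \<open>The divergence of the curvature: the second Bianchi identity turns the
    contraction with the direction of differentiation into two contractions of the kind computed in
    \<open>P\<close>.\<close>
  have Z: "(\<Sum>m\<in>UNIV. (DK x (?e m) b d *v c) $ m) = ds b * (d \<bullet> c) - ds d * (b \<bullet> c)" for b c d
  proof -
    have "DK x (?e m) b d = DK x b (?e m) d - DK x d (?e m) b" for m
      using second_bianchi[OF x, of "?e m" b d] DK_antisym[OF x, of b d "?e m"] by (simp add: algebra_simps)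
    then have "(\<Sum>m\<in>UNIV. (DK x (?e m) b d *v c) $ m)
      = (\<Sum>m\<in>UNIV. (DK x b (?e m) d *v c) $ m) - (\<Sum>m\<in>UNIV. (DK x d (?e m) b *v c) $ m)"
      by (simp add: matrix_vector_simps sum_subtractf)
    then show ?thesis by (simp add: P)
  qed
  have "ds d = 0" for d
  proof -
    \<comment> \<open>One double contraction is evaluated twice. By \<open>Z\<close> it is
      \<open>ds d\<close> minus n times \<open>ds d\<close>, with n the dimension; by skewness of
      the matrix values and \<open>P\<close> it is \<open>- ds d\<close>. The difference is the
      factor n - 2.\<close>
    have "(\<Sum>a\<in>UNIV. \<Sum>m\<in>UNIV. (DK x (?e m) (?e a) d *v ?e a) $ m) = ds d - of_nat CARD('n) * ds d"
      unfolding Z using ds_sum[of d]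
      by (simp add: sum_subtractf inner_axis inner_axis_axis mult.commute)
    moreover have "(DK x (?e m) (?e a) d *v ?e a) $ m = - (DK x (?e m) (?e a) d *v ?e m) $ a" for a m
    proof -
      have "transpose (DK x (?e m) (?e a) d) $ m $ a = - DK x (?e m) (?e a) d $ m $ a"
        by (simp add: DK_skew[OF x])
      then show ?thesis unfolding comp by (simp add: transpose_def)
    qed
    then have "(\<Sum>a\<in>UNIV. \<Sum>m\<in>UNIV. (DK x (?e m) (?e a) d *v ?e a) $ m)
        = - (\<Sum>m\<in>UNIV. \<Sum>a\<in>UNIV. (DK x (?e m) (?e a) d *v ?e m) $ a)"
      by (subst sum.swap) (simp add: sum_negf)
    moreover have "(\<Sum>m\<in>UNIV. \<Sum>a\<in>UNIV. (DK x (?e m) (?e a) d *v ?e m) $ a) = ds d"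
      unfolding P using ds_sum[of d] by (simp add: inner_axis mult.commute)
    ultimately have "(real CARD('n) - 2) * ds d = 0" by (simp add: algebra_simps)
    moreover have "real CARD('n) - 2 \<noteq> 0" using n by (metis diff_eq_diff_eq diff_self of_nat_eq_iff of_nat_numeral)
    ultimately show ?thesis by simp
  qed
  then have "dir_deriv s x u = 0" for u
    unfolding ds_def using \<theta>A_cancel(3)[OF x, of u] by metis
  with Ds show ?thesis by (simp add: fun_eq_iff[symmetric])
qed

end

lemma smooth_torsion_tensor:
  assumes "\<And>e. smooth_on S (\<lambda>x. f x e)"
  shows "smooth_on S (\<lambda>x. torsion_tensor (f x))"
  unfolding torsion_tensor_sum
proof (rule smooth_on_sum)
  fix i :: 'a
  have "linear (\<lambda>M. tensor (axis i (1::real)) (mat_tensor (M :: real^'a^'a)))"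
    by (auto intro!: linearI simp: vec_eq_iff tensor_def mat_tensor_def algebra_simps)
  then have "bounded_linear (\<lambda>M. tensor (axis i (1::real)) (mat_tensor (M :: real^'a^'a)))"
    by (simp add: linear_conv_bounded_linear)
  from smooth_on_linear_compose[OF this assms]
  show "smooth_on S (\<lambda>x. tensor (axis i 1) (mat_tensor (f x (axis i 1))))" .
qed

lemma bilinear_diff: "bilinear f \<Longrightarrow> bilinear g \<Longrightarrow> bilinear (\<lambda>a b. f a b - g a b)"
  by (simp add: bilinear_def linear_compose_sub)

context frame_field
begin

text \<open>Writing \<open>w = \<omega> + \<xi>\<close> with \<open>\<omega>\<close> valued in the Lie algebra and \<open>\<xi>\<close> in its complement, the curvature
  is the curvature of \<open>\<omega>\<close> plus terms linear in the covariant derivative of \<open>\<xi>\<close> and quadratic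
  in \<open>\<xi>\<close>.\<close>
proposition einstein_at:
  assumes "matrix_group G"
    and W: "subspace W" "\<And>a x. a \<in> G \<Longrightarrow> x \<in> W \<Longrightarrow> (std_rep \<otimes>\<^sub>R (std_rep \<otimes>\<^sub>R std_rep)) a *v x \<in> W"
    and inv: "invariants G ((std_rep \<otimes>\<^sub>R (std_rep \<otimes>\<^sub>R (std_rep \<otimes>\<^sub>R std_rep))) \<otimes>\<^sub>R (std_rep \<otimes>\<^sub>R std_rep))
           ((UNIV \<otimes>\<^sub>S W) \<otimes>\<^sub>S Sym2_0) = {0}"
      "invariants G (((std_rep \<otimes>\<^sub>R (std_rep \<otimes>\<^sub>R std_rep)) \<otimes>\<^sub>R (std_rep \<otimes>\<^sub>R (std_rep \<otimes>\<^sub>R std_rep)))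
             \<otimes>\<^sub>R (std_rep \<otimes>\<^sub>R std_rep)) (Sym2 W \<otimes>\<^sub>S Sym2_0) = {0}"
      "invariants G (((std_rep \<otimes>\<^sub>R std_rep) \<otimes>\<^sub>R (std_rep \<otimes>\<^sub>R std_rep)) \<otimes>\<^sub>R (std_rep \<otimes>\<^sub>R std_rep))
           (curvature_space (lie_algebra G) \<otimes>\<^sub>S Sym2_0) = {0}"
    and \<xi>W: "\<And>y. y \<in> S \<Longrightarrow> torsion_tensor (\<lambda>e. w y e - orth_proj (lie_algebra G) (w y e)) \<in> W"
    and x: "x \<in> S"
  shows "\<exists>s. \<forall>b c. trace (matrix (\<lambda>m. K x m b *v c)) = s * (b \<bullet> c)"
proof -
  interpret G: matrix_group G by fact
  let ?\<gg> = "lie_algebra G"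
  let ?p = "orth_proj ?\<gg>"
  note sub = G.subspace_lie_algebra
  have linp: "linear ?p" by (rule linear_orth_proj[OF sub])
  then have blp: "bounded_linear ?p" by (simp add: linear_conv_bounded_linear)
  define z where "z = (\<lambda>y e. w y e - ?p (w y e))"
  define \<Xi> where "\<Xi> = (\<lambda>y. torsion_tensor (z y))"
  have lin_z: "linear (z y)" if "y \<in> S" for y
    unfolding z_def
    by (rule linearI) (simp_all add: linear_add[OF linear_w[OF that]] linear_cmul[OF linear_w[OF that]]
        linear_add[OF linp] linear_cmul[OF linp] algebra_simps)
  have \<Xi>_map: "torsion_map (\<Xi> y) e = z y e" if "y \<in> S" for y e
    unfolding \<Xi>_def by (rule torsion_map_tensor[OF lin_z[OF that]])
  have \<Xi>W: "\<Xi> y \<in> W" if "y \<in> S" for y using \<xi>W[OF that] by (simp add: \<Xi>_def z_def)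
  have sm_z: "smooth_on S (\<lambda>y. z y e)" for e
    unfolding z_def by (intro smooth_on_diff smooth_w smooth_on_linear_compose[OF blp])
  have sm_\<Xi>: "smooth_on S \<Xi>" unfolding \<Xi>_def by (rule smooth_torsion_tensor[OF sm_z])
  note d = smooth_on_differentiable[OF _ x]
  have dz: "dir_deriv (\<lambda>y. z y e) x u = dir_deriv (\<lambda>y. w y e) x u - ?p (dir_deriv (\<lambda>y. w y e) x u)" for e u
    unfolding z_def using d[OF smooth_w] d[OF smooth_on_linear_compose[OF blp smooth_w]]
    by (simp add: dir_deriv_diff dir_deriv_linear_compose[OF blp])
  have d\<Xi>: "torsion_map (dir_deriv \<Xi> x u) e = dir_deriv (\<lambda>y. z y e) x u" for u e
  proof -
    have "bounded_linear (\<lambda>T :: real^('n \<times> ('n \<times> 'n)). torsion_map T e)"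
      using bilinear_torsion_map by (auto simp: bilinear_def linear_conv_bounded_linear)
    from dir_deriv_linear_compose[OF this d[OF sm_\<Xi>]]
    have "torsion_map (dir_deriv \<Xi> x u) e = dir_deriv (\<lambda>y. torsion_map (\<Xi> y) e) x u" by simp
    also have "dir_deriv (\<lambda>y. torsion_map (\<Xi> y) e) x = dir_deriv (\<lambda>y. z y e) x"
      by (rule dir_deriv_cong[OF S x \<Xi>_map])
    finally show ?thesis .
  qed
  define wh where "wh = (\<lambda>k. ?p (w x k))"
  have wh: "wh k \<in> ?\<gg>" for k unfolding wh_def by (rule orth_proj(1)[OF sub])
  have lin_wh: "linear wh" unfolding wh_def using linear_compose[OF linear_w[OF x] linp] by (simp add: o_def)
  have w: "w x k = wh k + z x k" for k by (simp add: wh_def z_def)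
  note lz = linear_add[OF lin_z[OF x]] linear_cmul[OF lin_z[OF x]] linear_diff[OF lin_z[OF x]]
  define act where "act = (\<lambda>k. torsion_tensor (\<lambda>u. wh k ** torsion_map (\<Xi> x) u - torsion_map (\<Xi> x) u ** wh k
      - torsion_map (\<Xi> x) (wh k *v u)))"
  have act_map: "torsion_map (act k) u = wh k ** z x u - z x u ** wh k - z x (wh k *v u)" for k u
    unfolding act_def
    by (subst torsion_map_tensor)
      (auto intro!: linearI simp: \<Xi>_map[OF x] lz matrix_mult_simps matrix_vector_simps algebra_simps)
  \<comment> \<open>The covariant derivative of \<Xi> for the connection whose form is
    \<open>wh\<close>, the projection of \<open>w\<close> to the Lie algebra. Both summands lie in
    \<open>W\<close>: the first as derivative of a W-valued function, the second by
    \<open>infinitesimal_action\<close>.\<close>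
  define Y where "Y = (\<lambda>k. dir_deriv \<Xi> x (A x *v k) + act k)"
  have Y_map: "torsion_map (Y k) u = dir_deriv (\<lambda>y. z y u) x (A x *v k)
      + wh k ** z x u - z x u ** wh k - z x (wh k *v u)" for k u
    by (simp add: Y_def torsion_map_simps d\<Xi> act_map)
  have YW: "Y k \<in> W" for k
    unfolding Y_def act_def
    by (intro subspace_add[OF W(1)] dir_deriv_in_subspace[OF W(1) S x \<Xi>W sm_\<Xi>]
        G.infinitesimal_action[OF W wh \<Xi>W[OF x]])
  have lin_d\<Xi>: "linear (dir_deriv \<Xi> x)" using smooth_on_has_derivative[OF sm_\<Xi> x] has_derivative_linear by blast
  have lin_act: "linear act"
    by (rule linearI; rule torsion_map_eqI)
      (simp_all add: act_map torsion_map_simps linear_add[OF lin_wh] linear_cmul[OF lin_wh] lz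
        matrix_mult_simps matrix_vector_simps algebra_simps)
  have lin_Y: "linear Y"
    by (rule linearI) (simp_all add: Y_def linear_add[OF lin_d\<Xi>] linear_cmul[OF lin_d\<Xi>] linear_add[OF lin_act]
        linear_cmul[OF lin_act] matrix_vector_simps algebra_simps)
  \<comment> \<open>The linear map \<open>Y\<close>, packed as an element of V \<otimes> W whose
    contraction with \<open>k\<close> gives \<open>Y k\<close> back.\<close>
  define X where "X = (\<Sum>i\<in>UNIV. tensor (axis i 1) (Y (axis i 1)))"
  have X: "contract X k = Y k" for k
  proof -
    have lc: "linear (\<lambda>T. contract T k :: real^('n \<times> ('n \<times> 'n)))" using bilinear_contract unfolding bilinear_def by blast
    have "contract X k = (\<Sum>i\<in>UNIV. k $ i *\<^sub>R Y (axis i 1))"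
      unfolding X_def linear_sum[OF lc] by (simp add: contract_tensor inner_axis')
    then show ?thesis using linear_axis_expand[OF lin_Y, of k] by simp
  qed
  have XW: "X \<in> UNIV \<otimes>\<^sub>S W" by (rule in_tensor_spaceI) (simp add: X YW)
  \<comment> \<open>Defined as the remainder, so that the decomposition holds by construction; what
    has to be shown is that its values lie in the Lie algebra.\<close>
  define R where "R = (\<lambda>a b. K x a b - (torsion_map (contract X a) b - torsion_map (contract X b) a)
     - quadratic (\<Xi> x) (\<Xi> x) a b)"
  \<comment> \<open>All terms with \<open>z\<close> cancel: its derivative and its commutators with
    \<open>wh\<close> are contained in \<open>Y\<close>, its products in \<open>quadratic\<close>.
    The result is the curvature of the projected connection, where the last argument keeps the full
    \<open>w\<close> because it is the bracket of the frame fields.\<close>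
  have R: "R a b = ?p (dir_deriv (\<lambda>y. w y b) x (A x *v a)) - ?p (dir_deriv (\<lambda>y. w y a) x (A x *v b))
     + (wh a ** wh b - wh b ** wh a) - wh (w x a *v b - w x b *v a)" for a b
  proof -
    have "w x (w x a *v b - w x b *v a) = wh (w x a *v b - w x b *v a)
      + z x (wh a *v b) + z x (z x a *v b) - z x (wh b *v a) - z x (z x b *v a)"
      unfolding w[of "w x a *v b - w x b *v a"] by (simp add: w[of a] w[of b] matrix_vector_simps lz)
    then show ?thesis
      unfolding R_def X Y_map dz quadratic_def \<Xi>_map[OF x] K_structure[OF x]
      by (simp add: w[of a] w[of b] lz matrix_mult_simps)
  qed
  show ?thesis
  proof (rule ricci_of_decomposition[OF G.orth G.transpose_mem sub G.lie_algebra_conjugate W inv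
        bilinear_K[OF x] K_skew[OF x] K_bianchi[OF x] _ _ _ \<Xi>W[OF x] XW, of R])
    show "bilinear R"
      unfolding R_def by (intro bilinear_diff bilinear_K[OF x] bilinear_skew_part bilinear_quadratic)
    show "R u v \<in> ?\<gg>" for u v
      unfolding R
      by (intro subspace_diff[OF sub] subspace_add[OF sub] orth_proj(1)[OF sub] G.lie_algebra_bracket wh)
    show "R u v = - R v u" for u v
      unfolding R using linear_neg[OF lin_wh, of "w x u *v v - w x v *v u"] by simp
    show "K x u v = R u v + (torsion_map (contract X u) v - torsion_map (contract X v) u) + quadratic (\<Xi> x) (\<Xi> x) u v" for u v
      by (simp add: R_def)
  qed
qed

end

section \<open>Independence of the frame formulas from coordinates\<close>

lemma skew_torsion_unique:
  fixes f g :: "real^'n::finite \<Rightarrow> real^'n^'n"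
  assumes f: "\<And>a. transpose (f a) = - f a" and g: "\<And>a. transpose (g a) = - g a"
    and eq: "\<And>a b. f a *v b - f b *v a = g a *v b - g b *v a"
  shows "f = g"
proof
  fix a
  define d where "d = (\<lambda>a. f a - g a)"
  have sym: "d a *v b = d b *v a" for a b
    using eq[of a b] by (simp add: d_def matrix_vector_simps algebra_simps)
  have skew: "(d a *v b) \<bullet> c = - (b \<bullet> (d a *v c))" for a b c
  proof -
    have "transpose (d a) = - d a" by (simp add: d_def transpose_simps f g)
    then show ?thesis by (simp add: inner_transpose matrix_vector_simps)
  qed
  \<comment> \<open>The trilinear form is symmetric in one pair of neighbouring arguments and skew
    in the other. Alternating the two exchanges three times restores the original order with the
    opposite sign.\<close>
  have "(d a *v b) \<bullet> c = 0" for b c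
  proof -
    have "(d a *v b) \<bullet> c = - ((d c *v a) \<bullet> b)" unfolding skew[of a b c] sym[of a c] by (simp add: inner_commute)
    also have "\<dots> = (d b *v c) \<bullet> a" unfolding skew[of c a b] sym[of c b] by (simp add: inner_commute)
    also have "\<dots> = - ((d a *v b) \<bullet> c)" unfolding skew[of b c a] sym[of b a] by (simp add: inner_commute)
    finally show ?thesis by simp
  qed
  then have "d a = 0" by (simp add: matrix_eq) (metis inner_eq_zero_iff)
  then show "f a = g a" by (simp add: d_def)
qed

text \<open>In a moving frame the Levi-Civita connection and the curvature are determined by Lie brackets,
  hence independent of the coordinates.\<close>
locale frame_change = F1: frame_field S\<^sub>1 A\<^sub>1 h\<^sub>1 \<Gamma>\<^sub>1 + F2: frame_field S\<^sub>2 A\<^sub>2 h\<^sub>2 \<Gamma>\<^sub>2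
  for S\<^sub>1 :: "(real^'n::finite) set" and A\<^sub>1 h\<^sub>1 \<Gamma>\<^sub>1 and S\<^sub>2 :: "(real^'n) set" and A\<^sub>2 h\<^sub>2 \<Gamma>\<^sub>2 +
  fixes \<tau> :: "real^'n \<Rightarrow> real^'n"
  assumes \<tau>: "smooth_on S\<^sub>1 \<tau>" "\<And>x. x \<in> S\<^sub>1 \<Longrightarrow> \<tau> x \<in> S\<^sub>2"
    and push: "\<And>x. x \<in> S\<^sub>1 \<Longrightarrow> A\<^sub>2 (\<tau> x) = matrix (dir_deriv \<tau> x) ** A\<^sub>1 x"
begin

lemma d\<tau>: "x \<in> S\<^sub>1 \<Longrightarrow> matrix (dir_deriv \<tau> x) *v v = dir_deriv \<tau> x v"
  by (rule matrix_linear) (use smooth_on_has_derivative[OF \<tau>(1)] has_derivative_linear in blast)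

lemma chain:
  fixes f :: "real^'n \<Rightarrow> 'b::euclidean_space"
  assumes "x \<in> S\<^sub>1" "smooth_on S\<^sub>2 f"
  shows "dir_deriv f (\<tau> x) (A\<^sub>2 (\<tau> x) *v a) = dir_deriv (\<lambda>y. f (\<tau> y)) x (A\<^sub>1 x *v a)"
  using dir_deriv_compose[OF smooth_on_differentiable[OF \<tau>(1) assms(1)]
      smooth_on_differentiable[OF assms(2) \<tau>(2)[OF assms(1)]], of "A\<^sub>1 x *v a"]
  by (simp add: push[OF assms(1)] d\<tau>[OF assms(1)] flip: matrix_vector_mul_assoc)

lemma w_eq:
  assumes x: "x \<in> S\<^sub>1"
  shows "F2.w (\<tau> x) = F1.w x"
proof (rule skew_torsion_unique)
  let ?J = "\<lambda>y. matrix (dir_deriv \<tau> y)"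
  show "transpose (F2.w (\<tau> x) a) = - F2.w (\<tau> x) a" "transpose (F1.w x a) = - F1.w x a" for a
    using F2.w_skew[OF \<tau>(2)[OF x]] F1.w_skew[OF x] by auto
  fix a b
  \<comment> \<open>The derivative of a pushed-forward frame field has an extra term with second
    derivatives of \<tau>. It is symmetric in \<open>a\<close> and \<open>b\<close>, so it
    disappears from the bracket.\<close>
  have dA: "dir_deriv A\<^sub>2 (\<tau> x) (A\<^sub>2 (\<tau> x) *v a) *v b = ?J x *v (dir_deriv A\<^sub>1 x (A\<^sub>1 x *v a) *v b)
      + dir_deriv (\<lambda>y. dir_deriv \<tau> y (A\<^sub>1 x *v b)) x (A\<^sub>1 x *v a)" for a b
  proof -
    have lin: "linear (dir_deriv \<tau> y)" if "y \<in> S\<^sub>1" for y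
      using smooth_on_has_derivative[OF \<tau>(1) that] has_derivative_linear by blast
    have "dir_deriv A\<^sub>2 (\<tau> x) (A\<^sub>2 (\<tau> x) *v a) *v b = dir_deriv (\<lambda>y. A\<^sub>2 y *v b) (\<tau> x) (A\<^sub>2 (\<tau> x) *v a)"
      by (simp add: F2.dA_vec[OF \<tau>(2)[OF x]])
    also have "\<dots> = dir_deriv (\<lambda>y. A\<^sub>2 (\<tau> y) *v b) x (A\<^sub>1 x *v a)"
      by (rule chain[OF x F2.smooth_A_vec])
    also have "dir_deriv (\<lambda>y. A\<^sub>2 (\<tau> y) *v b) x = dir_deriv (\<lambda>y. dir_deriv \<tau> y (A\<^sub>1 y *v b)) x"
      by (rule dir_deriv_cong[OF F1.S x]) (simp add: push d\<tau> flip: matrix_vector_mul_assoc)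
    also have "dir_deriv (\<lambda>y. dir_deriv \<tau> y (A\<^sub>1 y *v b)) x (A\<^sub>1 x *v a)
      = dir_deriv (\<lambda>y. dir_deriv \<tau> y (A\<^sub>1 x *v b)) x (A\<^sub>1 x *v a) + dir_deriv \<tau> x (dir_deriv (\<lambda>y. A\<^sub>1 y *v b) x (A\<^sub>1 x *v a))"
      by (rule dir_deriv_linear_in(1)[where L="dir_deriv \<tau>", OF F1.S x lin smooth_on_dir_deriv[OF F1.S \<tau>(1)] F1.smooth_A_vec])
    finally show ?thesis by (simp add: F1.dA_vec[OF x] d\<tau>[OF x])
  qed
  have "A\<^sub>2 (\<tau> x) *v (F1.w x a *v b - F1.w x b *v a)
      = ?J x *v (dir_deriv A\<^sub>1 x (A\<^sub>1 x *v a) *v b - dir_deriv A\<^sub>1 x (A\<^sub>1 x *v b) *v a)"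
    by (simp only: push[OF x] matrix_vector_mul_assoc[symmetric] F1.torsion_free[OF x])
  then have "A\<^sub>2 (\<tau> x) *v (F2.w (\<tau> x) a *v b - F2.w (\<tau> x) b *v a) = A\<^sub>2 (\<tau> x) *v (F1.w x a *v b - F1.w x b *v a)"
    unfolding F2.torsion_free[OF \<tau>(2)[OF x]] dA dir_deriv_commute[OF F1.S \<tau>(1) x, of "A\<^sub>1 x *v b" "A\<^sub>1 x *v a"]
    by (simp add: matrix_vector_mult_diff_distrib)
  then show "F2.w (\<tau> x) a *v b - F2.w (\<tau> x) b *v a = F1.w x a *v b - F1.w x b *v a"
    using F2.\<theta>A_cancel(4)[OF \<tau>(2)[OF x]] by metis
qed

lemma K_eq:
  assumes x: "x \<in> S\<^sub>1"
  shows "F2.K (\<tau> x) a b = F1.K x a b"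
proof -
  have "dir_deriv (\<lambda>y. F2.w y b) (\<tau> x) (A\<^sub>2 (\<tau> x) *v a) = dir_deriv (\<lambda>y. F1.w y b) x (A\<^sub>1 x *v a)" for a b
  proof -
    have "dir_deriv (\<lambda>y. F2.w (\<tau> y) b) x = dir_deriv (\<lambda>y. F1.w y b) x"
      by (rule dir_deriv_cong[OF F1.S x]) (simp add: w_eq)
    then show ?thesis by (simp add: chain[OF x F2.smooth_w])
  qed
  then show ?thesis by (simp add: F1.K_structure[OF x] F2.K_structure[OF \<tau>(2)[OF x]] w_eq[OF x])
qed

end

section \<open>Charts and adapted frames\<close>

lemma matrix_inv_eqI:
  fixes A B :: "real^'n^'n"
  assumes "B ** A = mat 1"
  shows "matrix_inv A = B"
proof -
  have "A ** B = mat 1" using assms by (simp add: matrix_left_right_inverse)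
  with assms have "\<exists>C. A ** C = mat 1 \<and> C ** A = mat 1" by blast
  then have "A ** matrix_inv A = mat 1" unfolding matrix_inv_def by (rule someI_ex[THEN conjunct1])
  then have "B ** A ** matrix_inv A = B" by (simp flip: matrix_mul_assoc)
  then show ?thesis by (simp add: assms)
qed

lemma chart_inv_left:
  assumes "smooth_atlas \<A>" "c \<in> \<A>" "p \<in> fst c"
  shows "chart_inv c (snd c p) = p"
  using assms unfolding smooth_atlas_def by (metis homeomorphism_apply1)

lemma open_chart_image:
  assumes at: "smooth_atlas \<A>" and c: "c \<in> \<A>" and V: "open V" "V \<subseteq> fst c"
  shows "open (snd c ` V)"
proof -
  have "open (snd c ` fst c)" and hom: "homeomorphism (fst c) (snd c ` fst c) (snd c) (chart_inv c)"
    using at c unfolding smooth_atlas_def by auto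
  then have "open (snd c ` fst c \<inter> chart_inv c -` V)"
    using continuous_open_preimage[OF homeomorphism_cont2[OF hom]] V(1) by blast
  moreover have "snd c ` fst c \<inter> chart_inv c -` V = snd c ` V"
    using V(2) chart_inv_left[OF at c] by force
  ultimately show ?thesis by simp
qed

lemma open_chart_domain: "smooth_atlas \<A> \<Longrightarrow> c \<in> \<A> \<Longrightarrow> open (fst c)"
  unfolding smooth_atlas_def by blast

lemma smooth_transition:
  "smooth_atlas \<A> \<Longrightarrow> c \<in> \<A> \<Longrightarrow> c' \<in> \<A> \<Longrightarrow> smooth_on (snd c ` (fst c \<inter> fst c')) (transition c c')"
  unfolding smooth_atlas_def by blast

lemma smooth_on_matrix:
  fixes f :: "'a::euclidean_space \<Rightarrow> real^'n \<Rightarrow> real^'m"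
  assumes "\<And>j. smooth_on S (\<lambda>x. f x (axis j 1))"
  shows "smooth_on S (\<lambda>x. matrix (f x))"
proof -
  have eq: "matrix F = (\<Sum>j\<in>UNIV. \<Sum>i\<in>UNIV. F (axis j 1) $ i *\<^sub>R axis i (axis j 1))" for F :: "real^'n \<Rightarrow> real^'m"
    by (simp add: vec_eq_iff matrix_def axis_def if_distrib[of "\<lambda>z. z $ _"] if_distrib[of "\<lambda>z. _ * z"] cong: if_cong)
  show ?thesis
    unfolding eq
    by (intro smooth_on_sum smooth_on_bilinear[OF bounded_bilinear_scaleR] smooth_on_const
        smooth_on_linear_compose[OF bounded_linear_vec_nth] assms)
qed

locale riemannian_atlas =
  fixes \<A> :: "('m::{t2_space,second_countable_topology}, 'n::finite) chart set" and g :: "('m, 'n) metric"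
  assumes at: "smooth_atlas \<A>" and rm: "riemannian_metric \<A> g"
begin

definition metric_in :: "('m, 'n) chart \<Rightarrow> real^'n \<Rightarrow> real^'n^'n" where
  "metric_in c x = g c (chart_inv c x)"

definition christoffel :: "('m, 'n) chart \<Rightarrow> real^'n \<Rightarrow> real^'n \<Rightarrow> real^'n^'n" where
  "christoffel c x v = matrix (levi_civita g c (chart_inv c x) v)"

lemma smooth_metric_in: "c \<in> \<A> \<Longrightarrow> smooth_on (snd c ` fst c) (metric_in c)"
  using rm unfolding riemannian_metric_def metric_in_def[abs_def] by blast

lemma metric_sym: "c \<in> \<A> \<Longrightarrow> p \<in> fst c \<Longrightarrow> transpose (g c p) = g c p"
  using rm unfolding riemannian_metric_def by blast

lemma linear_levi_civita:
  assumes c: "c \<in> \<A>" and p: "p \<in> fst c"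
  shows "linear (levi_civita g c p v)" "linear (\<lambda>u. levi_civita g c p u v)"
proof -
  have "(\<lambda>x. g c (chart_inv c x)) differentiable (at (snd c p))"
    using smooth_on_differentiable[OF smooth_metric_in[OF c]] p unfolding metric_in_def[abs_def] by blast
  then have lin: "linear (dir_deriv (\<lambda>x. g c (chart_inv c x)) (snd c p))" by (rule linear_frechet_derivative)
  show 1: "linear (levi_civita g c p v)" for v
    unfolding levi_civita_def Let_def
  proof (rule linear_compose[unfolded o_def, OF _ matrix_vector_mul_linear], rule linearI)
  qed (simp_all add: vec_eq_iff linear_add[OF lin] linear_cmul[OF lin] matrix_vector_simps inner_add_right
      add_divide_distrib diff_divide_distrib algebra_simps)
  show "linear (\<lambda>u. levi_civita g c p u v)"
    using 1[of v] levi_civita_torsion_free[OF rm at c p, of _ v] by simp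
qed

lemma christoffel: "c \<in> \<A> \<Longrightarrow> p \<in> fst c \<Longrightarrow> christoffel c (snd c p) v *v z = levi_civita g c p v z"
  unfolding christoffel_def by (simp add: chart_inv_left[OF at] matrix_linear[OF linear_levi_civita(1)])

lemma frame_field_chart:
  assumes c: "c \<in> \<A>" and V: "open V" "V \<subseteq> fst c" and a: "smooth_on (snd c ` V) a"
    and orth: "\<And>q. q \<in> V \<Longrightarrow> transpose (a (snd c q)) ** g c q ** a (snd c q) = mat 1"
  shows "frame_field (snd c ` V) a (metric_in c) (christoffel c)"
proof -
  let ?S = "snd c ` V"
  have S: "open ?S" by (rule open_chart_image[OF at c V])
  have inv: "chart_inv c x \<in> V" "snd c (chart_inv c x) = x" "chart_inv c x \<in> fst c" if "x \<in> ?S" for x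
    using that V(2) chart_inv_left[OF at c] by auto
  have smh: "smooth_on ?S (metric_in c)" by (rule smooth_on_subset[OF smooth_metric_in[OF c]]) (use V in blast)
  have lin: "linear (dir_deriv (metric_in c) x)" if "x \<in> ?S" for x
    using smooth_on_has_derivative[OF smh that] has_derivative_linear by blast
  show ?thesis
  proof (rule frame_field.intro)
    show "open ?S" by (rule S)
    show "smooth_on ?S a" "smooth_on ?S (metric_in c)" by (rule a, rule smh)
    show "smooth_on ?S (\<lambda>x. christoffel c x v)" for v
      unfolding christoffel_def
    proof (rule smooth_on_matrix)
      fix j
      let ?d = "\<lambda>x u. dir_deriv (metric_in c) x u"
      let ?e = "axis j 1 :: real^'n"
      let ?k = "\<lambda>x l. ((?d x v *v ?e) \<bullet> axis l 1 + (?d x ?e *v v) \<bullet> axis l 1 - v \<bullet> (?d x (axis l 1) *v ?e)) / 2"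
      \<comment> \<open>Smoothness of the Levi-Civita connection requires that of the inverse
        metric. The orthonormal frame provides it, since the inverse metric is
        \<open>a x ** transpose (a x)\<close>.\<close>
      have sm: "smooth_on ?S (\<lambda>x. (a x ** transpose (a x)) *v (\<Sum>l\<in>UNIV. ?k x l *\<^sub>R axis l 1))"
        unfolding divide_inverse
        by (intro smooth_on_bilinear[OF bounded_bilinear_matrix_vector] smooth_on_matrix_mult a smooth_on_transpose
            smooth_on_sum smooth_on_bilinear[OF bounded_bilinear_scaleR] smooth_on_bilinear[OF bounded_bilinear_mult]
            smooth_on_diff smooth_on_add smooth_on_bilinear[OF bounded_bilinear_inner]
            smooth_on_const smooth_on_dir_deriv[OF S smh])
      show "smooth_on ?S (\<lambda>x. levi_civita g c (chart_inv c x) v ?e)"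
      proof (rule smooth_on_cong[OF S sm])
        fix x assume x: "x \<in> ?S"
        have 1: "transpose (a x) ** metric_in c x ** a x = mat 1"
          using orth[OF inv(1)[OF x]] by (simp add: metric_in_def inv(2)[OF x])
        then have "a x ** (transpose (a x) ** metric_in c x) = mat 1" by (simp add: matrix_left_right_inverse)
        then have 2: "a x ** transpose (a x) ** metric_in c x = mat 1" by (simp add: matrix_mul_assoc)
        have 3: "matrix_inv (metric_in c x) = a x ** transpose (a x)"
          by (rule matrix_inv_eqI[OF 2])
        have "(\<Sum>l\<in>UNIV. ?k x l *\<^sub>R axis l 1) = (\<chi> l. ?k x l)"
          by (simp add: vec_eq_iff axis_def if_distrib[of "\<lambda>z. _ * z"] cong: if_cong)
        then show "(a x ** transpose (a x)) *v (\<Sum>l\<in>UNIV. ?k x l *\<^sub>R axis l 1) = levi_civita g c (chart_inv c x) v ?e"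
          unfolding levi_civita_def Let_def inv(2)[OF x] 3[symmetric]
          by (simp add: metric_in_def[abs_def] inner_axis)
      qed
    qed
    fix x assume x: "x \<in> ?S"
    note lc = linear_levi_civita[OF c inv(3)[OF x]]
    have \<Gamma>: "christoffel c x v *v z = levi_civita g c (chart_inv c x) v z" for v z
      using christoffel[OF c inv(3)[OF x]] by (simp add: inv(2)[OF x])
    show "transpose (metric_in c x) = metric_in c x"
      unfolding metric_in_def by (rule metric_sym[OF c inv(3)[OF x]])
    show "linear (christoffel c x)"
      by (rule linearI)
        (simp_all add: matrix_eq \<Gamma> matrix_vector_mult_add_rdistrib linear_add[OF lc(2)] linear_cmul[OF lc(2)] matrix_vector_simps)
    show "christoffel c x u *v v = christoffel c x v *v u" for u v
      unfolding \<Gamma> by (rule levi_civita_torsion_free[OF rm at c inv(3)[OF x]])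
    show "dir_deriv (metric_in c) x v = transpose (christoffel c x v) ** metric_in c x + metric_in c x ** christoffel c x v" for v
    proof (rule matrix_eq_inner)
      fix b z
      have "b \<bullet> (dir_deriv (metric_in c) x v *v z)
          = (christoffel c x v *v b) \<bullet> (metric_in c x *v z) + b \<bullet> (metric_in c x *v (christoffel c x v *v z))"
        using levi_civita_metric[OF rm at c inv(3)[OF x], of b v z]
        unfolding \<Gamma>[symmetric] inv(2)[OF x] metric_in_def[symmetric] .
      then show "b \<bullet> (dir_deriv (metric_in c) x v *v z)
          = b \<bullet> ((transpose (christoffel c x v) ** metric_in c x + metric_in c x ** christoffel c x v) *v z)"
        by (simp add: matrix_vector_mult_add_rdistrib inner_add_right inner_transpose flip: matrix_vector_mul_assoc)
    qed
    show "transpose (a x) ** metric_in c x ** a x = mat 1"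
      using orth[OF inv(1)[OF x]] by (simp add: metric_in_def inv(2)[OF x])
  qed
qed

lemma curvature_levi_civita:
  assumes F: "frame_field (snd c ` V) a (metric_in c) (christoffel c)"
    and c: "c \<in> \<A>" and V: "open V" "V \<subseteq> fst c" and p: "p \<in> V"
  shows "curvature (levi_civita g) c p u v z = frame_field.Rm (christoffel c) (snd c p) u v *v z"
proof -
  interpret frame_field "snd c ` V" a "metric_in c" "christoffel c" by fact
  have x: "snd c p \<in> snd c ` V" using p by blast
  have pc: "p \<in> fst c" using p V by blast
  have d: "dir_deriv (\<lambda>y. levi_civita g c (chart_inv c y) v z) (snd c p) u
      = dir_deriv (\<lambda>y. christoffel c y v) (snd c p) u *v z" for u v
  proof -
    have "dir_deriv (\<lambda>y. levi_civita g c (chart_inv c y) v z) (snd c p) = dir_deriv (\<lambda>y. christoffel c y v *v z) (snd c p)"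
    proof (rule dir_deriv_cong[OF S x])
      fix y assume "y \<in> snd c ` V"
      then show "levi_civita g c (chart_inv c y) v z = christoffel c y v *v z"
        using christoffel[OF c, of "chart_inv c y"] chart_inv_left[OF at c] V(2) by auto
    qed
    then show ?thesis
      using smooth_on_differentiable[OF \<Gamma>_smooth x]
      by (simp add: dir_deriv_bilinear[OF bounded_bilinear_matrix_vector] matrix_vector_simps)
  qed
  show ?thesis
    unfolding curvature_def Rm_def d
    by (simp add: matrix_vector_mult_diff_rdistrib matrix_vector_mult_add_rdistrib christoffel[OF c pc] flip: matrix_vector_mul_assoc)
qed

lemma ricci_frame:
  assumes F: "frame_field (snd c ` V) a (metric_in c) (christoffel c)"
    and c: "c \<in> \<A>" and V: "open V" "V \<subseteq> fst c" and p: "p \<in> V"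
  shows "ricci g c p (a (snd c p) *v b) (a (snd c p) *v z)
    = trace (matrix (\<lambda>m. frame_field.K a (metric_in c) (christoffel c) (snd c p) m b *v z))"
proof -
  interpret frame_field "snd c ` V" a "metric_in c" "christoffel c" by fact
  have x: "snd c p \<in> snd c ` V" using p by blast
  have "ricci g c p (a (snd c p) *v b) (a (snd c p) *v z)
      = trace (matrix (\<lambda>X. Rm (snd c p) X (a (snd c p) *v b) *v (a (snd c p) *v z)))"
    by (simp add: ricci_def curvature_levi_civita[OF F c V p] trace_def matrix_def)
  then show ?thesis by (simp add: trace_Rm[OF x])
qed

end

section \<open>Adapted frames and the projected G-connection\<close>

locale adapted_frame = riemannian_atlas \<A> g + matrix_group G
  for \<A> :: "('m::{t2_space,second_countable_topology}, 'n::finite) chart set" and g and G +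
  fixes P :: "('m, 'n) frames" and c0 :: "('m, 'n) chart" and U :: "'m set" and s :: "'m \<Rightarrow> real^'n^'n"
  assumes red: "G_reduction \<A> g G P" and c0: "c0 \<in> \<A>" and U: "open U" "U \<subseteq> fst c0"
    and s: "smooth_on (snd c0 ` U) (\<lambda>x. s (chart_inv c0 x))" "\<And>q. q \<in> U \<Longrightarrow> s q \<in> P c0 q"
begin

text \<open>Connections have components in every chart, so the local section of the reduction, given
  in \<open>c0\<close>, is carried to all charts meeting \<open>U\<close>.\<close>

definition frame :: "('m, 'n) chart \<Rightarrow> 'm \<Rightarrow> real^'n^'n" where
  "frame c q = jacobian c0 c q ** s q"

definition frame_in :: "('m, 'n) chart \<Rightarrow> real^'n \<Rightarrow> real^'n^'n" where
  "frame_in c x = frame c (chart_inv c x)"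

definition coframe :: "('m, 'n) chart \<Rightarrow> 'm \<Rightarrow> real^'n^'n" where
  "coframe c q = transpose (frame c q) ** g c q"

lemma frame_in: "c \<in> \<A> \<Longrightarrow> q \<in> fst c \<Longrightarrow> frame_in c (snd c q) = frame c q"
  by (simp add: frame_in_def chart_inv_left[OF at])

lemma frame_mem:
  assumes "c \<in> \<A>" "q \<in> U" "q \<in> fst c"
  shows "frame c q \<in> P c q"
proof -
  have "P c q = (\<lambda>A. jacobian c0 c q ** A) ` P c0 q"
    using red assms U(2) c0 unfolding G_reduction_def by blast
  then show ?thesis using s(2)[OF assms(2)] by (simp add: frame_def)
qed

lemma frame_orthonormal:
  assumes "c \<in> \<A>" "q \<in> U" "q \<in> fst c"
  shows "transpose (frame c q) ** g c q ** frame c q = mat 1"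
    and frames_eq: "P c q = (\<lambda>a. frame c q ** a) ` G"
  using red assms frame_mem[OF assms] unfolding G_reduction_def by blast+

lemma coframe_frame:
  assumes "c \<in> \<A>" "q \<in> U" "q \<in> fst c"
  shows "coframe c q ** frame c q = mat 1" "frame c q ** coframe c q = mat 1"
    "coframe c q *v (frame c q *v v) = v" "frame c q *v (coframe c q *v v) = v"
proof -
  show 1: "coframe c q ** frame c q = mat 1" using frame_orthonormal(1)[OF assms] by (simp add: coframe_def)
  then show 2: "frame c q ** coframe c q = mat 1" by (simp add: matrix_left_right_inverse)
  show "coframe c q *v (frame c q *v v) = v" "frame c q *v (coframe c q *v v) = v"
    by (simp_all add: matrix_vector_mul_assoc 1 2)
qed

lemma smooth_frame_in:
  assumes c: "c \<in> \<A>"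
  shows "smooth_on (snd c ` (U \<inter> fst c)) (frame_in c)"
proof -
  let ?S = "snd c ` (U \<inter> fst c)" and ?D = "snd c0 ` (fst c0 \<inter> fst c)"
  let ?\<tau> = "transition c0 c" and ?\<sigma> = "transition c c0"
  have D: "open ?D" by (rule open_chart_image[OF at c0]) (use c c0 in \<open>auto intro!: open_Int open_chart_domain[OF at]\<close>)
  have S: "open ?S" by (rule open_chart_image[OF at c]) (use open_chart_domain[OF at c] U in auto)
  have sm\<sigma>: "smooth_on ?S ?\<sigma>" by (rule smooth_on_subset[OF smooth_transition[OF at c c0]]) (use U in auto)
  have \<sigma>: "?\<sigma> (snd c q) = snd c0 q" if "q \<in> fst c" for q using that by (simp add: chart_inv_left[OF at c])
  have J: "smooth_on ?D (\<lambda>y. matrix (dir_deriv ?\<tau> y))"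
    by (rule smooth_on_matrix) (rule smooth_on_dir_deriv[OF D smooth_transition[OF at c0 c]])
  have 1: "smooth_on ?S (\<lambda>x. matrix (dir_deriv ?\<tau> (?\<sigma> x)))"
    by (rule smooth_on_compose[OF J sm\<sigma>]) (use U \<sigma> in auto)
  have 2: "smooth_on ?S (\<lambda>x. s (chart_inv c0 (?\<sigma> x)))"
    by (rule smooth_on_compose[OF s(1) sm\<sigma>]) (use U \<sigma> in auto)
  show ?thesis
  proof (rule smooth_on_cong[OF S smooth_on_matrix_mult[OF 1 2]])
    fix x assume "x \<in> ?S"
    then obtain q where q: "q \<in> U" "q \<in> fst c" "x = snd c q" by blast
    have "q \<in> fst c0" using q U by blast
    then show "matrix (dir_deriv ?\<tau> (?\<sigma> x)) ** s (chart_inv c0 (?\<sigma> x)) = frame_in c x"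
      using \<sigma>[OF q(2)] by (simp add: frame_in q frame_def jacobian_def chart_inv_left[OF at] c c0)
  qed
qed

lemma frame_field_on:
  assumes c: "c \<in> \<A>" and V: "open V" "V \<subseteq> U" "V \<subseteq> fst c"
  shows "frame_field (snd c ` V) (frame_in c) (metric_in c) (christoffel c)"
proof (rule frame_field_chart[OF c V(1,3)])
  show "smooth_on (snd c ` V) (frame_in c)"
    by (rule smooth_on_subset[OF smooth_frame_in[OF c]]) (use V in blast)
  show "transpose (frame_in c (snd c q)) ** g c q ** frame_in c (snd c q) = mat 1" if "q \<in> V" for q
  proof -
    have "q \<in> U" "q \<in> fst c" using that V by auto
    then show ?thesis using frame_orthonormal(1)[OF c] frame_in[OF c] by simp
  qed
qed

lemma frame_field_U:
  assumes "c \<in> \<A>"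
  shows "frame_field (snd c ` (U \<inter> fst c)) (frame_in c) (metric_in c) (christoffel c)"
  by (rule frame_field_on[OF assms]) (use U assms in \<open>auto intro!: open_Int open_chart_domain[OF at]\<close>)

text \<open>Both frames are pushed forward from \<open>c0\<close>, so this is the chain rule for the
  transition from \<open>c0\<close> to \<open>c'\<close> through \<open>c\<close>.\<close>

lemma frame_cocycle:
  assumes c: "c \<in> \<A>" "c' \<in> \<A>" and q: "q \<in> U" "q \<in> fst c" "q \<in> fst c'"
  shows "frame c' q = jacobian c c' q ** frame c q"
proof -
  let ?D = "snd c0 ` (fst c0 \<inter> fst c \<inter> fst c')" and ?x = "snd c0 q"
  have D: "open ?D"
    by (rule open_chart_image[OF at c0]) (use c c0 in \<open>auto intro!: open_Int open_chart_domain[OF at]\<close>)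
  have x: "?x \<in> ?D" using q U by blast
  have \<tau>: "transition c0 c ?x = snd c q" using q U chart_inv_left[OF at c0, of q] by auto
  have d1: "transition c0 c differentiable (at ?x)"
    by (rule smooth_on_differentiable[OF smooth_transition[OF at c0 c(1)]]) (use q U in blast)
  have d2: "transition c c' differentiable (at (snd c q))"
    by (rule smooth_on_differentiable[OF smooth_transition[OF at c]]) (use q in blast)
  have "dir_deriv (transition c0 c') ?x = dir_deriv (\<lambda>y. transition c c' (transition c0 c y)) ?x"
  proof (rule dir_deriv_cong[OF D x])
    fix y assume "y \<in> ?D"
    then obtain q' where "y = snd c0 q'" "q' \<in> fst c0" "q' \<in> fst c" "q' \<in> fst c'" by blast
    then show "transition c0 c' y = transition c c' (transition c0 c y)"
      by (simp add: chart_inv_left[OF at] c c0)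
  qed
  then have dd: "dir_deriv (transition c0 c') ?x v = dir_deriv (transition c c') (snd c q) (dir_deriv (transition c0 c) ?x v)" for v
    using dir_deriv_compose[OF d1, of "transition c c'" v] d2 \<tau> by simp
  have "jacobian c0 c' q = jacobian c c' q ** jacobian c0 c q"
    unfolding matrix_eq jacobian_def matrix_vector_mul_assoc[symmetric]
  proof
    fix v
    have l: "linear (dir_deriv (transition c0 c) ?x)" "linear (dir_deriv (transition c c') (snd c q))"
      using d1 d2 by (simp_all add: linear_frechet_derivative)
    then have l': "linear (dir_deriv (transition c0 c') ?x)"
      using dd linear_compose[OF l] by (simp add: o_def fun_eq_iff[symmetric])
    show "matrix (dir_deriv (transition c0 c') ?x) *v v
        = matrix (dir_deriv (transition c c') (snd c q)) *v (matrix (dir_deriv (transition c0 c) ?x) *v v)"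
      unfolding matrix_linear[OF l(1)] matrix_linear[OF l(2)] matrix_linear[OF l'] by (rule dd)
  qed
  then show ?thesis by (simp add: frame_def matrix_mul_assoc)
qed

lemma frame_change:
  assumes c: "c \<in> \<A>" "c' \<in> \<A>" and V: "V = U \<inter> fst c \<inter> fst c'"
  shows "frame_change (snd c ` V) (frame_in c) (metric_in c) (christoffel c)
     (snd c' ` V) (frame_in c') (metric_in c') (christoffel c') (transition c c')"
proof (rule frame_change.intro[OF _ _ frame_change_axioms.intro])
  have oV: "open V" unfolding V by (intro open_Int open_chart_domain[OF at] U c)
  show "frame_field (snd c ` V) (frame_in c) (metric_in c) (christoffel c)"
    "frame_field (snd c' ` V) (frame_in c') (metric_in c') (christoffel c')"
    by (rule frame_field_on; use c oV V in auto)+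
  show "smooth_on (snd c ` V) (transition c c')"
    by (rule smooth_on_subset[OF smooth_transition[OF at c]]) (use V in blast)
  fix x assume "x \<in> snd c ` V"
  then obtain q where q: "q \<in> V" "x = snd c q" by blast
  then have \<tau>: "transition c c' x = snd c' q" using V by (simp add: chart_inv_left[OF at c(1)])
  then show "transition c c' x \<in> snd c' ` V" using q by blast
  show "frame_in c' (transition c c' x) = matrix (dir_deriv (transition c c') x) ** frame_in c x"
    using frame_cocycle[OF c, of q] q V \<tau> by (simp add: frame_in c jacobian_def)
qed

abbreviation w_in :: "('m, 'n) chart \<Rightarrow> real^'n \<Rightarrow> real^'n \<Rightarrow> real^'n^'n" where
  "w_in c \<equiv> frame_field.w (frame_in c) (metric_in c) (christoffel c)"

abbreviation K_in :: "('m, 'n) chart \<Rightarrow> real^'n \<Rightarrow> real^'n \<Rightarrow> real^'n \<Rightarrow> real^'n^'n" where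
  "K_in c \<equiv> frame_field.K (frame_in c) (metric_in c) (christoffel c)"

lemma w_in_eq: "w_in c' (snd c' q) = w_in c (snd c q)"
  and K_in_eq: "K_in c' (snd c' q) a b = K_in c (snd c q) a b"
  if c: "c \<in> \<A>" "c' \<in> \<A>" and q: "q \<in> U" "q \<in> fst c" "q \<in> fst c'"
proof -
  interpret frame_change "snd c ` (U \<inter> fst c \<inter> fst c')" "frame_in c" "metric_in c" "christoffel c"
     "snd c' ` (U \<inter> fst c \<inter> fst c')" "frame_in c'" "metric_in c'" "christoffel c'" "transition c c'"
    by (rule frame_change[OF c refl])
  have x: "snd c q \<in> snd c ` (U \<inter> fst c \<inter> fst c')" using q by blast
  have \<tau>: "transition c c' (snd c q) = snd c' q" using q by (simp add: chart_inv_left[OF at c(1)])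
  show "w_in c' (snd c' q) = w_in c (snd c q)" using w_eq[OF x] unfolding \<tau> .
  show "K_in c' (snd c' q) a b = K_in c (snd c q) a b" using K_eq[OF x] unfolding \<tau> .
qed

text \<open>The G-connection used to compute the intrinsic torsion: its form in the adapted frame is the
  projection of the Levi-Civita form to the Lie algebra.\<close>
definition proj_form :: "('m, 'n) chart \<Rightarrow> 'm \<Rightarrow> real^'n \<Rightarrow> real^'n^'n" where
  "proj_form c q e = orth_proj (lie_algebra G) (w_in c (snd c q) e)"

text \<open>The passage from a connection form in a frame back to coordinates: it solves A \<omega>
  = dA + \<Gamma> A for \<Gamma>, with the projected form in place of \<omega> and the coframe as
  inverse of A.\<close>

definition form_at :: "('m, 'n) chart \<Rightarrow> 'm \<Rightarrow> real^'n \<Rightarrow> real^'n^'n" where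
  "form_at c q v = frame c q ** proj_form c q (coframe c q *v v) ** coframe c q
     - dir_deriv (frame_in c) (snd c q) v ** coframe c q"

definition minimal_connection :: "('m, 'n) connection" where
  "minimal_connection c q v z = form_at c q v *v z"

lemma linear_proj: "linear (orth_proj (lie_algebra G))"
  by (rule linear_orth_proj[OF subspace_lie_algebra])

lemma linear_proj_form:
  assumes c: "c \<in> \<A>" and q: "q \<in> U" "q \<in> fst c"
  shows "linear (proj_form c q)"
proof -
  interpret frame_field "snd c ` (U \<inter> fst c)" "frame_in c" "metric_in c" "christoffel c"
    by (rule frame_field_U[OF c])
  show ?thesis unfolding proj_form_def
    using linear_compose[OF linear_w linear_proj, of "snd c q"] q by (simp add: o_def)
qed

lemma linear_form_at:
  assumes c: "c \<in> \<A>" and q: "q \<in> U" "q \<in> fst c"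
  shows "linear (form_at c q)"
proof -
  interpret frame_field "snd c ` (U \<inter> fst c)" "frame_in c" "metric_in c" "christoffel c"
    by (rule frame_field_U[OF c])
  have "linear (dir_deriv (frame_in c) (snd c q))" by (rule linear_dA) (use q in blast)
  with linear_proj_form[OF assms] show ?thesis
    unfolding form_at_def
    by (intro linearI) (simp_all add: linear_add linear_cmul matrix_mult_simps matrix_vector_simps algebra_simps)
qed

text \<open>The projected form in the frame is the same in all charts by \<open>w_in_eq\<close>. The
  inhomogeneous term of the transformation law arises only from differentiating the frame, as for
  any connection given by a form in a moving frame.\<close>

lemma connection_on_minimal: "connection_on \<A> U minimal_connection"
  unfolding connection_on_def
proof (intro conjI ballI allI)
  fix c assume c: "c \<in> \<A>"
  let ?S = "snd c ` (U \<inter> fst c)"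
  interpret F: frame_field ?S "frame_in c" "metric_in c" "christoffel c"
    by (rule frame_field_U[OF c])
  show "bilinear (minimal_connection c p)" if p: "p \<in> U \<inter> fst c" for p
  proof -
    have l: "linear (form_at c p)" by (rule linear_form_at[OF c]) (use p in auto)
    show ?thesis unfolding bilinear_def minimal_connection_def
      by (auto intro!: linearI simp: linear_add[OF l] linear_cmul[OF l] matrix_vector_simps)
  qed
  fix v z
  have q: "chart_inv c x \<in> U" "chart_inv c x \<in> fst c" "snd c (chart_inv c x) = x" if "x \<in> ?S" for x
    using that chart_inv_left[OF at c] by auto
  have th: "smooth_on ?S (\<lambda>x. F.\<theta> x *v v)"
    by (intro smooth_on_bilinear[OF bounded_bilinear_matrix_vector] F.smooth_\<theta> smooth_on_const)
  have blp: "bounded_linear (orth_proj (lie_algebra G))" using linear_proj by (simp add: linear_conv_bounded_linear)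
  have L: "linear (\<lambda>e. orth_proj (lie_algebra G) (F.w x e))" if "x \<in> ?S" for x
    using linear_compose[OF F.linear_w[OF that] linear_proj] by (simp add: o_def)
  have "smooth_on ?S (\<lambda>x. orth_proj (lie_algebra G) (F.w x (F.\<theta> x *v v)))"
  proof (cases "?S = {}")
    case True
    then show ?thesis using smooth_on_cong[OF F.S smooth_on_const[of ?S 0]] by blast
  next
    case False
    then obtain x where x: "x \<in> ?S" by blast
    show ?thesis
      by (rule dir_deriv_linear_in(2)[OF F.S x L smooth_on_linear_compose[OF blp F.smooth_w] th])
  qed
  then have "smooth_on ?S (\<lambda>x. (frame_in c x ** orth_proj (lie_algebra G) (F.w x (F.\<theta> x *v v)) ** F.\<theta> x
      - dir_deriv (frame_in c) x v ** F.\<theta> x) *v z)"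
    by (intro smooth_on_bilinear[OF bounded_bilinear_matrix_vector] smooth_on_diff smooth_on_matrix_mult
        F.A F.smooth_\<theta> smooth_on_dir_deriv F.S smooth_on_const)
  then show "smooth_on ?S (\<lambda>x. minimal_connection c (chart_inv c x) v z)"
  proof (rule smooth_on_cong[OF F.S])
    fix x assume "x \<in> ?S"
    note q = q[OF this]
    have "coframe c (chart_inv c x) = F.\<theta> x" by (simp add: coframe_def F.\<theta>_def frame_in_def metric_in_def)
    then show "(frame_in c x ** orth_proj (lie_algebra G) (F.w x (F.\<theta> x *v v)) ** F.\<theta> x
        - dir_deriv (frame_in c) x v ** F.\<theta> x) *v z = minimal_connection c (chart_inv c x) v z"
      by (simp add: minimal_connection_def form_at_def proj_form_def q(3) frame_in_def)
  qed
next
  fix c c' p v z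
  assume c: "c \<in> \<A>" "c' \<in> \<A>" and p: "p \<in> U \<inter> fst c \<inter> fst c'"
  let ?V = "U \<inter> fst c \<inter> fst c'"
  let ?J = "jacobian c c'" and ?\<tau> = "transition c c'" and ?x = "snd c p"
  interpret C: frame_change "snd c ` ?V" "frame_in c" "metric_in c" "christoffel c"
     "snd c' ` ?V" "frame_in c'" "metric_in c'" "christoffel c'" ?\<tau>
    by (rule frame_change[OF c refl])
  have x: "?x \<in> snd c ` ?V" using p by blast
  have \<tau>x: "?\<tau> ?x = snd c' p" using p by (simp add: chart_inv_left[OF at c(1)])
  have q: "p \<in> U" "p \<in> fst c" "p \<in> fst c'" using p by auto
  note cf = coframe_frame[OF c(1) q(1,2)] and cf' = coframe_frame[OF c(2) q(1,3)]
  have fr: "frame c' p = ?J p ** frame c p" by (rule frame_cocycle[OF c q])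
  have co: "coframe c' p *v (?J p *v u) = coframe c p *v u" for u
  proof -
    have "coframe c' p *v (frame c' p *v (coframe c p *v u)) = coframe c p *v u" by (rule cf'(3))
    then show ?thesis by (simp add: fr cf(4) flip: matrix_vector_mul_assoc)
  qed
  have J: "?J p *v u = dir_deriv ?\<tau> ?x u" for u unfolding jacobian_def by (rule C.d\<tau>[OF x])
  have pf: "proj_form c' p = proj_form c p"
    unfolding proj_form_def[abs_def] w_in_eq[OF c q] ..
  \<comment> \<open>Differentiating \<open>frame c' p = ?J p ** frame c p\<close>: the Jacobian
    varies with the point and contributes the second derivative of the transition map.\<close>
  have dfr: "dir_deriv (frame_in c') (snd c' p) (?J p *v v) *v e
      = dir_deriv (\<lambda>y. dir_deriv ?\<tau> y (frame c p *v e)) ?x v + ?J p *v (dir_deriv (frame_in c) ?x v *v e)" for e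
  proof -
    have lin: "linear (dir_deriv ?\<tau> y)" if "y \<in> snd c ` ?V" for y
      using smooth_on_has_derivative[OF C.\<tau>(1) that] has_derivative_linear by blast
    have "dir_deriv (frame_in c') (snd c' p) (?J p *v v) *v e = dir_deriv (\<lambda>y. frame_in c' y *v e) (?\<tau> ?x) (dir_deriv ?\<tau> ?x v)"
      unfolding J \<tau>x[symmetric] by (simp only: C.F2.dA_vec[OF C.\<tau>(2)[OF x]])
    also have "\<dots> = dir_deriv (\<lambda>y. frame_in c' (?\<tau> y) *v e) ?x v"
      by (rule dir_deriv_compose[symmetric, OF smooth_on_differentiable[OF C.\<tau>(1) x]
            smooth_on_differentiable[OF C.F2.smooth_A_vec C.\<tau>(2)[OF x]]])
    also have "dir_deriv (\<lambda>y. frame_in c' (?\<tau> y) *v e) ?x = dir_deriv (\<lambda>y. dir_deriv ?\<tau> y (frame_in c y *v e)) ?x"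
      by (rule dir_deriv_cong[OF C.F1.S x]) (simp only: C.push C.d\<tau> matrix_vector_mul_assoc[symmetric])
    also have "dir_deriv (\<lambda>y. dir_deriv ?\<tau> y (frame_in c y *v e)) ?x v
      = dir_deriv (\<lambda>y. dir_deriv ?\<tau> y (frame_in c ?x *v e)) ?x v + dir_deriv ?\<tau> ?x (dir_deriv (\<lambda>y. frame_in c y *v e) ?x v)"
      by (rule dir_deriv_linear_in(1)[where L="dir_deriv ?\<tau>", OF C.F1.S x lin smooth_on_dir_deriv[OF C.F1.S C.\<tau>(1)] C.F1.smooth_A_vec])
    finally show ?thesis unfolding J C.F1.dA_vec[OF x] frame_in[OF c(1) q(2)] .
  qed
  show "?J p *v minimal_connection c p v z = dir_deriv (\<lambda>x. dir_deriv ?\<tau> x z) ?x v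
      + minimal_connection c' p (?J p *v v) (?J p *v z)"
    unfolding minimal_connection_def form_at_def matrix_vector_mult_diff_rdistrib matrix_vector_mul_assoc[symmetric]
      co dfr cf(4) pf fr
    by (simp add: matrix_vector_mult_diff_distrib)
qed

end

lemma subspace_lie_perp: "subspace (lie_perp \<gg>)"
  using subspace_so by (auto simp: lie_perp_def subspace_def inner_add_left)

text \<open>The decomposition in the definition is unique since an element of both \<gg> and
  \<open>lie_perp \<gg>\<close> is orthogonal to itself.\<close>

lemma perp_component_eq:
  assumes \<gg>: "subspace \<gg>" and \<eta>: "\<eta> \<in> V_tensor (lie_perp \<gg>)"
  shows "perp_component \<gg> \<eta> = \<eta>"
  unfolding perp_component_def
proof (rule the_equality)
  show "\<eta> \<in> V_tensor (lie_perp \<gg>) \<and> \<eta> - \<eta> \<in> V_tensor \<gg>"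
    using \<eta> subspace_0[OF \<gg>] by (simp add: V_tensor_iff[OF \<gg>] bilinear_lzero[OF bilinear_torsion_map])
  fix \<xi> assume \<xi>: "\<xi> \<in> V_tensor (lie_perp \<gg>) \<and> \<eta> - \<xi> \<in> V_tensor \<gg>"
  have "torsion_map \<xi> u = torsion_map \<eta> u" for u
  proof -
    let ?d = "torsion_map \<eta> u - torsion_map \<xi> u"
    have "?d \<in> \<gg>" using \<xi> by (simp add: V_tensor_iff[OF \<gg>] torsion_map_simps)
    moreover have "?d \<in> lie_perp \<gg>"
      by (rule subspace_diff[OF subspace_lie_perp]) (use \<xi> \<eta> in \<open>simp_all add: V_tensor_iff[OF subspace_lie_perp]\<close>)
    ultimately have "?d \<bullet> ?d = 0" unfolding lie_perp_def by blast
    then show ?thesis by simp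
  qed
  then show "\<xi> = \<eta>" by (rule torsion_map_eqI)
qed

lemma has_vector_derivative_columns:
  fixes F :: "real \<Rightarrow> real^'n::finite^'m::finite"
  assumes "\<And>i. ((\<lambda>t. column i (F t)) has_vector_derivative column i D) (at t)"
  shows "(F has_vector_derivative D) (at t)"
proof -
  define e where "e = (\<lambda>i v. (\<chi> j k. if k = i then v $ j else 0) :: real^'n^'m)"
  have F: "M = (\<Sum>i\<in>UNIV. e i (column i M))" for M :: "real^'n^'m"
    by (simp add: vec_eq_iff e_def column_def)
  have "bounded_linear (e i)" for i
    unfolding linear_conv_bounded_linear[symmetric]
    by (auto intro!: linearI simp: vec_eq_iff e_def)
  then have "((\<lambda>t. \<Sum>i\<in>UNIV. e i (column i (F t))) has_vector_derivative (\<Sum>i\<in>UNIV. e i (column i D))) (at t)"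
    by (intro has_vector_derivative_sum bounded_linear.has_vector_derivative[OF _ assms])
  then show ?thesis by (simp flip: F)
qed

context adapted_frame
begin

text \<open>Read in the adapted frame, a parallel frame \<open>F\<close> becomes a curve of matrices
  \<open>h\<close> with h' = B h and \<open>B\<close> valued in the Lie algebra. By
  \<open>integral_curve_in_group\<close> this curve stays in \<open>G\<close> once it meets
  \<open>G\<close>, so \<open>F\<close> stays in the reduction.\<close>

lemma G_connection_minimal:
  assumes "lie_subgroup G E \<U>"
  shows "G_connection_on \<A> P U minimal_connection"
  unfolding G_connection_on_def
proof (intro conjI connection_on_minimal ballI allI impI, elim conjE)
  fix c a b x F s0 t0
  assume c: "c \<in> \<A>" and x: "smooth_on {a<..<b} x" "x ` {a<..<b} \<subseteq> snd c ` (U \<inter> fst c)"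
    and par: "\<forall>i. parallel_along minimal_connection c {a<..<b} x (\<lambda>t. column i (F t))"
    and s0: "s0 \<in> {a<..<b}" and t0: "t0 \<in> {a<..<b}" and F0: "F s0 \<in> P c (chart_inv c (x s0))"
  interpret lie_subgroup G E \<U> by fact
  interpret F: frame_field "snd c ` (U \<inter> fst c)" "frame_in c" "metric_in c" "christoffel c"
    by (rule frame_field_U[OF c])
  let ?I = "{a<..<b}"
  define q where "q = (\<lambda>t. chart_inv c (x t))"
  have xS: "x t \<in> snd c ` (U \<inter> fst c)" if "t \<in> ?I" for t using x(2) that by blast
  have q: "q t \<in> U" "q t \<in> fst c" "snd c (q t) = x t" if "t \<in> ?I" for t
    using xS[OF that] chart_inv_left[OF at c] by (auto simp: q_def)
  define x' where "x' = (\<lambda>t. vector_derivative x (at t))"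
  have dx: "(x has_vector_derivative x' t) (at t)" if "t \<in> ?I" for t
    using smooth_on_differentiable[OF x(1) that] vector_derivative_works unfolding x'_def by blast
  have chain: "((\<lambda>t. Z (x t)) has_vector_derivative dir_deriv Z (x t) (x' t)) (at t)"
    if t: "t \<in> ?I" and Z: "smooth_on (snd c ` (U \<inter> fst c)) Z" for t and Z :: "real^'n \<Rightarrow> real^'n^'n"
  proof -
    note D = smooth_on_has_derivative[OF Z xS[OF t]]
    from has_derivative_compose[OF dx[OF t, unfolded has_vector_derivative_def] D]
    show ?thesis by (simp add: has_vector_derivative_def linear_cmul[OF has_derivative_linear[OF D]])
  qed
  define M where "M = (\<lambda>t. form_at c (q t) (x' t))"
  have dF: "(F has_vector_derivative - (M t ** F t)) (at t)" if t: "t \<in> ?I" for t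
  proof (rule has_vector_derivative_columns)
    fix i
    have "column i (- (M t ** F t)) = - (M t *v column i (F t))"
      by (simp add: vec_eq_iff column_def matrix_matrix_mult_def matrix_vector_mult_def)
    then show "((\<lambda>t. column i (F t)) has_vector_derivative column i (- (M t ** F t))) (at t)"
      using par t by (simp add: parallel_along_def minimal_connection_def M_def q_def x'_def)
  qed
  define h where "h = (\<lambda>t. F.\<theta> (x t) ** F t)"
  define B where "B = (\<lambda>t. - proj_form c (q t) (F.\<theta> (x t) *v x' t))"
  have Ah: "frame_in c (x t) ** h t = F t" if "t \<in> ?I" for t
    using F.\<theta>A_cancel(1)[OF xS[OF that]] by (simp add: h_def)
  have dh: "(h has_vector_derivative B t ** h t) (at t)" if t: "t \<in> ?I" for t
  proof -
    \<comment> \<open>The derivative of \<open>F.\<theta>\<close> is left unevaluated.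
      Differentiating the identity that the frame times \<open>h\<close> is \<open>F\<close> and
      cancelling the invertible frame determines \<open>h'\<close> without it.\<close>
    define h' where "h' = F.\<theta> (x t) ** (- (M t ** F t)) + dir_deriv F.\<theta> (x t) (x' t) ** F t"
    have 1: "(h has_vector_derivative h') (at t)"
      unfolding h_def h'_def by (rule has_vector_derivative_matrix_mult[OF chain[OF t F.smooth_\<theta>] dF[OF t]])
    let ?A = "frame_in c (x t)" and ?dA = "dir_deriv (frame_in c) (x t) (x' t)"
    have "((\<lambda>t. frame_in c (x t) ** h t) has_vector_derivative ?A ** h' + ?dA ** h t) (at t)"
      by (rule has_vector_derivative_matrix_mult[OF chain[OF t F.A] 1])
    then have "(F has_vector_derivative ?A ** h' + ?dA ** h t) (at t)"
      by (rule has_vector_derivative_transform_within_open[OF _ _ t]) (use Ah in auto)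
    then have "?A ** h' + ?dA ** h t = - (M t ** F t)"
      by (rule vector_derivative_unique_at[OF _ dF[OF t]])
    moreover have "M t = ?A ** - B t ** F.\<theta> (x t) - ?dA ** F.\<theta> (x t)"
      unfolding M_def form_at_def q(3)[OF t]
      by (simp add: B_def coframe_def F.\<theta>_def frame_in_def[of c "x t"] metric_in_def q_def)
    ultimately have "?A ** h' = ?A ** (B t ** h t)"
      by (simp add: h_def matrix_mult_simps matrix_mul_assoc)
    then have "F.\<theta> (x t) ** (?A ** h') = F.\<theta> (x t) ** (?A ** (B t ** h t))" by simp
    then have "h' = B t ** h t" unfolding F.\<theta>A_cancel(2)[OF xS[OF t]] .
    with 1 show ?thesis by simp
  qed
  have B: "B t \<in> lie_algebra G" for t
    unfolding B_def proj_form_def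
    using orth_proj(1)[OF subspace_lie_algebra] subspace_neg[OF subspace_lie_algebra] by blast
  have fr: "P c (q t) = (\<lambda>a. frame_in c (x t) ** a) ` G" if "t \<in> ?I" for t
    using frames_eq[OF c q(1,2)[OF that]] by (simp add: frame_in_def q_def)
  obtain a where a: "a \<in> G" "F s0 = frame_in c (x s0) ** a" using F0 fr[OF s0] by (auto simp: q_def)
  have "h s0 = a" by (simp add: h_def a(2) F.\<theta>A_cancel(2)[OF xS[OF s0]])
  then have "h t0 \<in> G" using integral_curve_in_group[OF dh B s0 _ t0] a(1) by simp
  then have "frame_in c (x t0) ** h t0 \<in> P c (q t0)" unfolding fr[OF t0] by (rule imageI)
  then show "F t0 \<in> P c (chart_inv c (x t0))" by (simp add: Ah[OF t0] q_def)
qed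

text \<open>Both connections have the form A \<omega> A^-1 - dA A^-1 with the same frame A. The
  derivative terms cancel, and the difference of the two forms in the frame remains.\<close>

lemma connection_difference_minimal:
  assumes c: "c \<in> \<A>" and p: "p \<in> U" "p \<in> fst c"
  shows "connection_difference g minimal_connection c p (frame c p)
    = torsion_tensor (\<lambda>e. w_in c (snd c p) e - proj_form c p e)"
proof -
  interpret F: frame_field "snd c ` (U \<inter> fst c)" "frame_in c" "metric_in c" "christoffel c"
    by (rule frame_field_U[OF c])
  have x: "snd c p \<in> snd c ` (U \<inter> fst c)" using p by blast
  let ?A = "frame c p"
  note cf = coframe_frame[OF c p]
  have comp: "(N *v axis k 1) $ j = N $ j $ k" for N :: "real^'n^'n" and j k
    by (simp only: matrix_vector_mult_basis) (simp add: column_def)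
  have "coframe c p *v (levi_civita g c p (?A *v e) (?A *v e') - minimal_connection c p (?A *v e) (?A *v e'))
      = (F.w (snd c p) e - proj_form c p e) *v e'" for e e'
  proof -
    have "?A *v (F.w (snd c p) e *v e')
        = dir_deriv (frame_in c) (snd c p) (?A *v e) *v e' + christoffel c (snd c p) (?A *v e) *v (?A *v e')"
      using F.A\<omega>[OF x, of "?A *v e"] frame_in[OF c p(2)]
      by (simp add: F.w_def matrix_vector_mul_assoc matrix_vector_mult_add_rdistrib)
    then have "levi_civita g c p (?A *v e) (?A *v e') - minimal_connection c p (?A *v e) (?A *v e')
        = ?A *v ((F.w (snd c p) e - proj_form c p e) *v e')"
      by (simp add: minimal_connection_def form_at_def christoffel[OF c p(2)] matrix_vector_simps cf(3)
          flip: matrix_vector_mul_assoc)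
    then show ?thesis by (simp add: cf(3))
  qed
  then show ?thesis
    unfolding connection_difference_def torsion_tensor_def matrix_inv_eqI[OF cf(1)]
    by (simp add: vec_eq_iff matrix_vector_mult_basis[symmetric] comp del: matrix_vector_mult_basis)
qed

text \<open>The form \<open>w\<close> is skew and its projection to the Lie algebra is subtracted,
  so the difference to the minimal connection already lies in V \<otimes>
  \<open>lie_perp (lie_algebra G)\<close> and equals its own perpendicular component, the intrinsic
  torsion.\<close>

lemma torsion_in:
  assumes "lie_subgroup G E \<U>" and tor: "intrinsic_torsion_in \<A> g G P W"
    and c: "c \<in> \<A>" and p: "p \<in> U" "p \<in> fst c"
  shows "torsion_tensor (\<lambda>e. w_in c (snd c p) e - orth_proj (lie_algebra G) (w_in c (snd c p) e)) \<in> W"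
proof -
  interpret F: frame_field "snd c ` (U \<inter> fst c)" "frame_in c" "metric_in c" "christoffel c"
    by (rule frame_field_U[OF c])
  have x: "snd c p \<in> snd c ` (U \<inter> fst c)" using p by blast
  let ?\<gg> = "lie_algebra G"
  let ?f = "\<lambda>e. F.w (snd c p) e - proj_form c p e"
  have lin: "linear ?f"
    by (rule linear_compose_sub[OF F.linear_w[OF x] linear_proj_form[OF c p]])
  have "torsion_tensor ?f \<in> V_tensor (lie_perp ?\<gg>)"
    unfolding V_tensor_iff[OF subspace_lie_perp] torsion_map_tensor[OF lin]
  proof
    fix u
    have pr: "proj_form c p u \<in> ?\<gg>" unfolding proj_form_def by (rule orth_proj(1)[OF subspace_lie_algebra])
    have "?f u \<in> so_algebra"
      using subspace_diff[OF subspace_so] F.w_skew[OF x, of u] pr lie_algebra_subset_so by (auto simp: so_algebra_def)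
    then show "?f u \<in> lie_perp ?\<gg>"
      using orth_proj(2)[OF subspace_lie_algebra] by (simp add: lie_perp_def proj_form_def)
  qed
  then have eq: "perp_component ?\<gg> (connection_difference g minimal_connection c p (frame c p)) = torsion_tensor ?f"
    unfolding connection_difference_minimal[OF c p] by (rule perp_component_eq[OF subspace_lie_algebra])
  have "U \<subseteq> manifold_of \<A>" using U c0 by (auto simp: manifold_of_def)
  then have "perp_component ?\<gg> (connection_difference g minimal_connection c p (frame c p)) \<in> W"
    using tor G_connection_minimal[OF assms(1)] U(1) c p frame_mem[OF c p] unfolding intrinsic_torsion_in_def by blast
  then show ?thesis unfolding eq by (simp add: proj_form_def)
qed

end

section \<open>From one adapted frame to the whole manifold\<close>

theorem theorem3p3:
  fixes \<A> :: "('m::{t2_space,second_countable_topology}, 'n::finite) chart set"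
    and g :: "('m, 'n) metric"
    and G :: "(real^'n^'n) set"
    and P :: "('m, 'n) frames"
    and W :: "(real^('n \<times> ('n \<times> 'n))) set"
  assumes "riemannian_G_manifold \<A> g G P"
    and "submodule G (std_rep \<otimes>\<^sub>R (std_rep \<otimes>\<^sub>R std_rep)) W (V_tensor (lie_perp (lie_algebra G)))"
    and "intrinsic_torsion_in \<A> g G P W"
    and "invariants G ((std_rep \<otimes>\<^sub>R (std_rep \<otimes>\<^sub>R (std_rep \<otimes>\<^sub>R std_rep))) \<otimes>\<^sub>R (std_rep \<otimes>\<^sub>R std_rep))
           ((UNIV \<otimes>\<^sub>S W) \<otimes>\<^sub>S Sym2_0) = {0}"
    and "invariants G (((std_rep \<otimes>\<^sub>R (std_rep \<otimes>\<^sub>R std_rep)) \<otimes>\<^sub>R (std_rep \<otimes>\<^sub>R (std_rep \<otimes>\<^sub>R std_rep)))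
             \<otimes>\<^sub>R (std_rep \<otimes>\<^sub>R std_rep))
           (Sym2 W \<otimes>\<^sub>S Sym2_0) = {0}"
    and "invariants G (((std_rep \<otimes>\<^sub>R std_rep) \<otimes>\<^sub>R (std_rep \<otimes>\<^sub>R std_rep)) \<otimes>\<^sub>R (std_rep \<otimes>\<^sub>R std_rep))
           (curvature_space (lie_algebra G) \<otimes>\<^sub>S Sym2_0) = {0}"
  shows "einstein \<A> g"
proof -
  have at: "smooth_atlas \<A>" and rm: "riemannian_metric \<A> g" and lie: "orthogonal_lie_subgroup G"
    and red: "G_reduction \<A> g G P"
    using assms(1) by (auto simp: riemannian_G_manifold_def)
  have W: "subspace W" "\<And>a x. a \<in> G \<Longrightarrow> x \<in> W \<Longrightarrow> (std_rep \<otimes>\<^sub>R (std_rep \<otimes>\<^sub>R std_rep)) a *v x \<in> W"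
    using assms(2) by (auto simp: submodule_def)
  interpret G: matrix_group G
    using lie by unfold_locales (auto simp: orthogonal_lie_subgroup_def)
  obtain E \<U> where "immersed_atlas E \<U> G" "smooth_group_operations E \<U>"
    using lie by (auto simp: orthogonal_lie_subgroup_def)
  then have LG: "lie_subgroup G E \<U>" by unfold_locales
  interpret riemannian_atlas \<A> g by unfold_locales (rule at, rule rm)
  \<comment> \<open>All charts at \<open>p\<close> are included, so the constant depends on the
    point alone and may later be chosen pointwise without a compatibility check.\<close>
  define einstein_with where "einstein_with = (\<lambda>p r. \<forall>c\<in>\<A>. p \<in> fst c \<longrightarrow>
    (\<forall>v z. ricci g c p v z = r * (v \<bullet> (g c p *v z))))"
  \<comment> \<open>Existence of the constant near \<open>p\<close>, and for dimensions other than 2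
    its agreement with the constant at \<open>p\<close>; this is local constancy, phrased before a
    function is chosen.\<close>
  have local: "\<exists>U. open U \<and> p \<in> U \<and> (\<forall>q\<in>U. \<exists>r. einstein_with q r) \<and>
      (CARD('n) \<noteq> 2 \<longrightarrow> (\<forall>q\<in>U. \<forall>r r'. einstein_with p r \<and> einstein_with q r' \<longrightarrow> r' = r))"
    if c0: "c0 \<in> \<A>" and p: "p \<in> fst c0" for c0 p
  proof -
    obtain U s where Uo: "open U" "p \<in> U" "U \<subseteq> fst c0"
      and so: "smooth_on (snd c0 ` U) (\<lambda>x. s (chart_inv c0 x))" "\<forall>q\<in>U. s q \<in> P c0 q"
      using red c0 p unfolding G_reduction_def by blast
    interpret adapted_frame \<A> g G P c0 U s
      by unfold_locales (use red c0 Uo so in auto)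
    interpret F: frame_field "snd c0 ` U" "frame_in c0" "metric_in c0" "christoffel c0"
      by (rule frame_field_on[OF c0 Uo(1) subset_refl Uo(3)])
    have K: "\<exists>r. \<forall>b z. trace (matrix (\<lambda>m. F.K x m b *v z)) = r * (b \<bullet> z)" if x: "x \<in> snd c0 ` U" for x
    proof (rule F.einstein_at[OF G.matrix_group_axioms W assms(4-6) _ x])
      fix y assume "y \<in> snd c0 ` U"
      then obtain q where "q \<in> U" "y = snd c0 q" by blast
      then show "torsion_tensor (\<lambda>e. F.w y e - orth_proj (lie_algebra G) (F.w y e)) \<in> W"
        using torsion_in[OF LG assms(3) c0, of q] Uo(3) by blast
    qed
    \<comment> \<open>Every chart is reduced to the single function \<open>F.K\<close> of
      \<open>c0\<close>: the curvature in frame components does not depend on the chart, so only the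
      coframe refers to \<open>c\<close>.\<close>
    have ricci: "ricci g c q v z = trace (matrix (\<lambda>m. F.K (snd c0 q) m (coframe c q *v v) *v (coframe c q *v z)))"
      "(coframe c q *v v) \<bullet> (coframe c q *v z) = v \<bullet> (g c q *v z)"
      if c: "c \<in> \<A>" and q: "q \<in> U" "q \<in> fst c" for c q v z
    proof -
      note cf = coframe_frame[OF c q]
      have oV: "open (U \<inter> fst c)" by (intro open_Int Uo(1) open_chart_domain[OF at c])
      have "ricci g c q v z = ricci g c q (frame_in c (snd c q) *v (coframe c q *v v)) (frame_in c (snd c q) *v (coframe c q *v z))"
        by (simp add: frame_in[OF c q(2)] cf(4))
      also have "\<dots> = trace (matrix (\<lambda>m. K_in c (snd c q) m (coframe c q *v v) *v (coframe c q *v z)))"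
        by (rule ricci_frame[OF frame_field_U[OF c] c oV]) (use q in auto)
      finally show "ricci g c q v z = trace (matrix (\<lambda>m. F.K (snd c0 q) m (coframe c q *v v) *v (coframe c q *v z)))"
        using K_in_eq[OF c0 c q(1) _ q(2)] q(1) Uo(3) by (simp add: subset_iff)
      have "v \<bullet> (g c q *v z) = (frame c q *v (coframe c q *v v)) \<bullet> (g c q *v (frame c q *v (coframe c q *v z)))"
        by (simp add: cf(4))
      also have "\<dots> = (coframe c q *v v) \<bullet> ((transpose (frame c q) ** g c q ** frame c q) *v (coframe c q *v z))"
        by (simp add: inner_transpose[of "frame c q"] flip: matrix_vector_mul_assoc)
      finally show "(coframe c q *v v) \<bullet> (coframe c q *v z) = v \<bullet> (g c q *v z)"
        by (simp add: frame_orthonormal(1)[OF c q])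
    qed
    have iff: "einstein_with q r \<longleftrightarrow> (\<forall>b z. trace (matrix (\<lambda>m. F.K (snd c0 q) m b *v z)) = r * (b \<bullet> z))"
      if q: "q \<in> U" for q r
    proof
      assume e: "einstein_with q r"
      have q0: "q \<in> fst c0" using q Uo(3) by blast
      show "\<forall>b z. trace (matrix (\<lambda>m. F.K (snd c0 q) m b *v z)) = r * (b \<bullet> z)"
      proof (intro allI)
        fix b z
        have "ricci g c0 q (frame c0 q *v b) (frame c0 q *v z) = r * ((frame c0 q *v b) \<bullet> (g c0 q *v (frame c0 q *v z)))"
          using e c0 q0 by (simp add: einstein_with_def)
        then show "trace (matrix (\<lambda>m. F.K (snd c0 q) m b *v z)) = r * (b \<bullet> z)"
          unfolding ricci(1)[OF c0 q q0] ricci(2)[OF c0 q q0, symmetric] coframe_frame(3)[OF c0 q q0] .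
      qed
    next
      assume "\<forall>b z. trace (matrix (\<lambda>m. F.K (snd c0 q) m b *v z)) = r * (b \<bullet> z)"
      then show "einstein_with q r"
        unfolding einstein_with_def using ricci[OF _ q] by simp
    qed
    have ex: "\<exists>r. einstein_with q r" if "q \<in> U" for q using K[of "snd c0 q"] iff[OF that] that by blast
    have uniq: "r = r'" if q: "q \<in> U" and e: "einstein_with q r" "einstein_with q r'" for q r r'
    proof -
      \<comment> \<open>The index type is nonempty, so there is a unit vector, and evaluating on it
        determines the constant.\<close>
      obtain i :: 'n where True by simp
      let ?e = "axis i (1::real)"
      have "r * (?e \<bullet> ?e) = r' * (?e \<bullet> ?e)"
        using e[unfolded iff[OF q], rule_format, of ?e ?e] by simp
      then show ?thesis by (simp add: inner_axis_axis)
    qed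
    \<comment> \<open>The Einstein function in the coordinates of \<open>c0\<close>, the form in
      which \<open>schur\<close> can differentiate it.\<close>
    define \<sigma> where "\<sigma> = (\<lambda>x. SOME r. einstein_with (chart_inv c0 x) r)"
    have \<sigma>: "einstein_with q (\<sigma> (snd c0 q))" if "q \<in> U" for q
    proof -
      have "chart_inv c0 (snd c0 q) = q" using that Uo(3) chart_inv_left[OF at c0] by blast
      then show ?thesis unfolding \<sigma>_def using ex[OF that] by (simp add: someI_ex)
    qed
    obtain d where d: "d > 0" "ball (snd c0 p) d \<subseteq> snd c0 ` U"
      using F.S Uo(2) open_contains_ball by blast
    \<comment> \<open>The neighbourhood is shrunk to the preimage of a coordinate ball, whose
      convexity lets a vanishing derivative imply constancy.\<close>
    define U' where "U' = U \<inter> snd c0 -` ball (snd c0 p) d"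
    have "continuous_on (fst c0) (snd c0)"
      using at c0 unfolding smooth_atlas_def by (blast dest: homeomorphism_cont1)
    then have "open U'" unfolding U'_def
      using continuous_on_subset[OF _ Uo(3)] continuous_open_preimage[OF _ Uo(1) open_ball] by blast
    moreover have "p \<in> U'" using Uo(2) d(1) by (simp add: U'_def)
    moreover have "r' = r" if n: "CARD('n) \<noteq> 2" and q: "q \<in> U'" and e: "einstein_with p r" "einstein_with q r'" for q r r'
    proof -
      have z: "(\<sigma> has_derivative (\<lambda>u. 0)) (at x within ball (snd c0 p) d)" if "x \<in> ball (snd c0 p) d" for x
      proof (rule has_derivative_at_withinI, rule F.schur[OF n])
        show "x \<in> snd c0 ` U" using that d(2) by blast
        show "trace (matrix (\<lambda>m. F.K y m b *v z)) = \<sigma> y * (b \<bullet> z)" if "y \<in> snd c0 ` U" for y b z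
          using that \<sigma> iff by blast
      qed
      obtain k where k: "\<forall>x\<in>ball (snd c0 p) d. \<sigma> x = k"
        using has_derivative_zero_constant[OF convex_ball z] by blast
      have "q \<in> U" "snd c0 q \<in> ball (snd c0 p) d" using q by (auto simp: U'_def)
      then have "r' = k" "r = k"
        using uniq[OF _ e(2) \<sigma>] uniq[OF _ e(1) \<sigma>] k Uo(2) d(1) by auto
      then show ?thesis by simp
    qed
    ultimately show ?thesis using ex by (intro exI[of _ U']) (auto simp: U'_def)
  qed
  define s where "s = (\<lambda>p. SOME r. einstein_with p r)"
  have s: "einstein_with p (s p)" if p: "p \<in> manifold_of \<A>" for p
  proof -
    obtain c0 where "c0 \<in> \<A>" "p \<in> fst c0" using p by (auto simp: manifold_of_def)
    from local[OF this] have "\<exists>r. einstein_with p r" by blast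
    then show ?thesis unfolding s_def by (rule someI_ex)
  qed
  show ?thesis
    unfolding einstein_def
  proof (intro exI[of _ s] conjI ballI allI impI)
    fix c p v z assume "c \<in> \<A>" "p \<in> fst c"
    then show "ricci g c p v z = s p * (v \<bullet> (g c p *v z))"
      using s[of p] by (auto simp: einstein_with_def manifold_of_def)
  next
    fix T assume n: "CARD('n) \<noteq> 2" and T: "T \<subseteq> manifold_of \<A>" "connected T"
    show "s constant_on T"
    proof (rule locally_constant_imp_constant[OF T(2)])
      fix p assume p: "p \<in> T"
      then obtain c0 where "c0 \<in> \<A>" "p \<in> fst c0" using T(1) by (auto simp: manifold_of_def)
      from local[OF this] n obtain U where U: "open U" "p \<in> U"
        "\<forall>q\<in>U. \<forall>r r'. einstein_with p r \<and> einstein_with q r' \<longrightarrow> r' = r" by blast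
      show "\<exists>V. openin (top_of_set T) V \<and> p \<in> V \<and> (\<forall>x\<in>V. s x = s p)"
      proof (intro exI conjI ballI)
        show "openin (top_of_set T) (T \<inter> U)" by (rule openin_open_Int[OF U(1)])
        show "p \<in> T \<inter> U" using p U(2) by blast
        show "s q = s p" if "q \<in> T \<inter> U" for q
          using U(3) s[of p] s[of q] that p T(1) by blast
      qed
    qed
  qed
qed

end
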